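(* Let $\mathcal U=(U_i)_{i\in I}$ be an open covering of a manifold $N$, and $\mathbf G\to\mathbf H$ a crossed module of Lie groups. There is a one-to-one correspondence between the set $H^1_{\mathcal U}(\mathbf G\to\mathbf H)$ and the set of all adapted Lie groupoid $\mathbf G\to\mathbf H$-extensions of the Čech groupoid $N[\mathcal U]$ up to isomorphisms (of Lie groupoid $\mathbf G\to\mathbf H$-extensions of $N[\mathcal U]$).
   Context: **Crossed module.** A crossed module of (finite-dimensional) Lie groups $\mathbf G\xrightarrow{\rho}\mathbf H$ consists of Lie groups $\mathbf G,\mathbf H$ and Lie group homomorphisms $\rho:\mathbf G\to\mathbf H$ and $j:\mathbf H\to\mathrm{Aut}(\mathbf G)$ such that, writing $h(g):=j(h)(g)$, one has $\rho(h(g))=h\rho(g)h^{-1}$ and $\rho(g)(g')=gg'g^{-1}$ for all $g,g'\in\mathbf G$, $h\in\mathbf H$. The neutral elements of $\mathbf G$ and $\mathbf H$ are both denoted $e$. **Lie groupoids.** In a Lie groupoid $\Gamma\rightrightarrows M$ with source $s$, target $t$ and unit map $\epsilon$, the product $xx'$ is defined when $t(x)=s(x')$. A left action of $\Gamma\rightrightarrows M$ on a surjective submersion $\pi:P\to M$ is a smooth map $\Gamma\times_{t,M,\pi}P\to P$, $(\gamma,p)\mapsto\gamma\cdot p$, with $\pi(\gamma\cdot p)=s(\gamma)$, compatible with products and units. **Čech groupoid.** For an open cover $\mathcal U=(U_i)_{i\in I}$ of $N$, put $U_{ij}=U_i\cap U_j$, $U_{ijk}=U_i\cap U_j\cap U_k$;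 $x_i$ (resp. $x_{ij}$) denotes $x$ seen as an element of the component $U_i$ (resp. $U_{ij}$) of a disjoint union indexed by $I$ (resp. by ordered pairs). The Čech groupoid $N[\mathcal U]$ is $\coprod_{i,j}U_{ij}\rightrightarrows\coprod_iU_i$ with $s(x_{ij})=x_i$, $t(x_{ij})=x_j$, $x_{ij}\bullet x_{jk}=x_{ik}$, unit $x_i\mapsto x_{ii}$, inverse $x_{ij}^{-1}=x_{ji}$. **Extensions.** A Lie groupoid extension $\mathcal R\xrightarrow{\phi}\mathcal G$ consists of Lie groupoids $\mathcal R,\mathcal G$ over the same manifold $M$ and a groupoid morphism $\phi$ over $\mathrm{id}_M$ which is a surjective submersion. Its kernel is $K=\phi^{-1}(\epsilon(M))$, a bundle of Lie groups over $M$. It is a Lie groupoid $\mathbf G$-extension if $K$ is a locally trivial bundle of Lie groups with typical fiber $\mathbf G$. Its band is $\mathrm{Band}(\mathcal R\to\mathcal G)=\coprod_{m\in M}\mathrm{Isom}(\mathbf G,K_m)$ (Lie group isomorphisms), with its natural structure of principal right $\mathrm{Aut}(\mathbf G)$-bundle over $M$ ($b\cdot\alpha=b\circ\alpha$), on which $\mathcal R$ acts on the left by $(r\cdot b)(g)=r\,b(g)\,r^{-1}$ for $b\in\mathrm{Isom}(\mathbf G,K_{t(r)})$. A principal $\mathbf H$-bundle over a Lie groupoid $\mathcal R\rightrightarrows M$ is a (right) principal $\mathbf H$-bundle $P\xrightarrow{\pi} M$ with a left action of $\mathcal R\rightrightarrows M$ commuting with the $\mathbf H$-action. A Lie groupoid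 $\mathbf G\to\mathbf H$-extension of $\mathcal G\rightrightarrows M$ is a triple $(\mathcal R\to\mathcal G,P\to M,\chi)$ where $\mathcal R\to\mathcal G$ is a Lie groupoid $\mathbf G$-extension, $P\to M$ is a principal $\mathbf H$-bundle over $\mathcal R\rightrightarrows M$, and $\chi:P\to\mathrm{Band}(\mathcal R\to\mathcal G)$ is a smooth map over $\mathrm{id}_M$ with $\chi(r\cdot p\cdot h)=r\cdot\chi(p)\cdot j(h)$, such that $p\cdot\rho(g)=\chi(p)(g)\cdot p$ for all $p\in P,g\in\mathbf G$. An isomorphism of $\mathbf G\to\mathbf H$-extensions of $\mathcal G\rightrightarrows M$ from $(\mathcal R\xrightarrow{\phi}\mathcal G,P,\chi)$ to $(\mathcal R'\xrightarrow{\phi'}\mathcal G,P',\chi')$ is a pair $(\Phi,\Psi)$ with $\Phi:\mathcal R\to\mathcal R'$ an isomorphism of Lie groupoids over $\mathrm{id}_M$ with $\phi'\circ\Phi=\phi$, and $\Psi:P\to P'$ a diffeomorphism over $\mathrm{id}_M$ with $\Psi(r\cdot p\cdot h)=\Phi(r)\cdot\Psi(p)\cdot h$, such that $\chi'\circ\Psi=\bar\Phi\circ\chi$, where $\bar\Phi(\eta)(g)=\Phi(\eta(g))$. **Adapted extensions.** A $\mathbf G\to\mathbf H$-extension $(\mathcal R\xrightarrow{\phi}N[\mathcal U],P\to\coprod_iU_i,\chi)$ of $N[\mathcal U]$ is adapted if: (1) $\mathcal R=\mathbf G\times\coprod_{i,j}U_{ij}$ as a manifold and $\phi$ is the projection on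 the second component; (2) $P=\coprod_iU_i\times\mathbf H$ with right action $(x_i,h)\cdot h'=(x_i,hh')$; (3) $\chi(x_i,h)$ is the element $g\mapsto(h(g),x_{ii})$ of the band over $x_i$; (4) the product of $\mathcal R$ satisfies $(g,x_{ii})(g',x_{ij})=(gg',x_{ij})$ for all $i,j\in I$, $x\in U_{ij}$, $g,g'\in\mathbf G$. **Cohomology w.r.t. $\mathcal U$.** A $\mathbf G\to\mathbf H$-valued non-Abelian $1$-cocycle w.r.t. $\mathcal U$ is a pair $(\lambda,\mathbf g)\in C^\infty(\coprod_{i,j}U_{ij},\mathbf H)\times C^\infty(\coprod_{i,j,k}U_{ijk},\mathbf G)$ with, for all indices, $\rho(\mathbf g_{ijk})\lambda_{ik}=\lambda_{ij}\lambda_{jk}$, $\mathbf g_{ijk}\mathbf g_{ikl}=\lambda_{ij}(\mathbf g_{jkl})\mathbf g_{ijl}$, $\mathbf g_{iij}=e$. A $1$-coboundary is a pair $(r,\mathbf v)\in C^\infty(\coprod_iU_i,\mathbf H)\times C^\infty(\coprod_{i,j}U_{ij},\mathbf G)$; it relates $(\lambda,\mathbf g)$ and $(\lambda',\mathbf g')$ if $\lambda'_{ij}=\rho(\mathbf v_{ij})r_i\lambda_{ij}r_j^{-1}$ and $\mathbf g'_{ijk}\mathbf v_{ik}=\lambda'_{ij}(\mathbf v_{jk})\mathbf v_{ij}\,r_i(\mathbf g_{ijk})$ for all indices. Being related by a coboundary is an equivalence relation on cocycles w.r.t. $\mathcal U$, and $H^1_{\mathcal U}(\mathbf G\to\mathbf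 H)$ is the quotient set. *)

theory Defs
  imports "HOL-Analysis.Analysis" "HOL-Algebra.Group"
begin

section \<open>Model spaces\<close>

text \<open>
  Manifolds are modelled on finite-dimensional inner product spaces. The library class
  \<^class>\<open>euclidean_space\<close> excludes dimension 0, and hence discrete Lie groups; the class
  below does not, as its instance \<^typ>\<open>unit\<close> shows.
\<close>

class fin_dim_inner = real_inner +
  assumes finite_spanning: "\<exists>B. finite B \<and> (\<forall>x. \<exists>c. x = (\<Sum>b\<in>B. c b *\<^sub>R b))"

lemma finite_span: "\<exists>B::'a::fin_dim_inner set. finite B \<and> span B = UNIV"
proof -
  obtain B :: "'a set" where B: "finite B" "\<forall>x. \<exists>c. x = (\<Sum>b\<in>B. c b *\<^sub>R b)"
    using finite_spanning by blast
  then have "span B = UNIV" unfolding span_finite[OF B(1)] by blast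
  with B(1) show ?thesis by blast
qed

lemma fin_dim_innerI:
  assumes "finite (B::'a::real_inner set)" "span B = UNIV"
  shows "\<exists>B::'a set. finite B \<and> (\<forall>x. \<exists>c. x = (\<Sum>b\<in>B. c b *\<^sub>R b))"
proof -
  have "\<exists>c. x = (\<Sum>b\<in>B. c b *\<^sub>R b)" for x
    using assms(2) unfolding span_finite[OF assms(1)] by blast
  with assms(1) show ?thesis by blast
qed

instance euclidean_space \<subseteq> fin_dim_inner
  by standard (rule fin_dim_innerI[OF finite_Basis span_Basis])

instance prod :: (fin_dim_inner, fin_dim_inner) fin_dim_inner
proof
  obtain B :: "'a set" where B: "finite B" "span B = UNIV" using finite_span by blast
  obtain C :: "'b set" where C: "finite C" "span C = UNIV" using finite_span by blast
  have fin: "finite (B \<times> {0} \<union> {0} \<times> C)" using B C by auto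
  have "(a, b) \<in> span (B \<times> {0} \<union> {0} \<times> C)" for a :: 'a and b :: 'b
  proof -
    have l: "linear (\<lambda>x::'a. (x, 0::'b))" and r: "linear (\<lambda>y::'b. (0::'a, y))"
      by (auto intro!: linearI)
    have "(a, 0) \<in> span ((\<lambda>x::'a. (x, 0::'b)) ` B)"
      using linear_span_image[OF l, of B] B by auto
    moreover have "(0, b) \<in> span ((\<lambda>y::'b. (0::'a, y)) ` C)"
      using linear_span_image[OF r, of C] C by auto
    moreover have "(\<lambda>x::'a. (x, 0::'b)) ` B \<subseteq> B \<times> {0} \<union> {0} \<times> C"
      and "(\<lambda>y::'b. (0::'a, y)) ` C \<subseteq> B \<times> {0} \<union> {0} \<times> C"
      by auto
    ultimately have "(a, 0) \<in> span (B \<times> {0} \<union> {0} \<times> C)" "(0, b) \<in> span (B \<times> {0} \<union> {0} \<times> C)"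
      by (metis span_mono subsetD)+
    then have "(a, 0) + (0, b) \<in> span (B \<times> {0} \<union> {0} \<times> C)"
      by (rule span_add)
    then show ?thesis by simp
  qed
  then have "span (B \<times> {0} \<union> {0} \<times> C) = (UNIV :: ('a \<times> 'b) set)" by auto
  from fin_dim_innerI[OF fin this]
  show "\<exists>B::('a \<times> 'b) set. finite B \<and> (\<forall>x. \<exists>c. x = (\<Sum>b\<in>B. c b *\<^sub>R b))" .
qed

instantiation unit :: fin_dim_inner
begin
definition zero_unit :: unit where "zero_unit = ()"
definition plus_unit :: "unit \<Rightarrow> unit \<Rightarrow> unit" where "plus_unit x y = ()"
definition minus_unit :: "unit \<Rightarrow> unit \<Rightarrow> unit" where "minus_unit x y = ()"
definition uminus_unit :: "unit \<Rightarrow> unit" where "uminus_unit x = ()"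
definition scaleR_unit :: "real \<Rightarrow> unit \<Rightarrow> unit" where "scaleR_unit c x = ()"
definition inner_unit :: "unit \<Rightarrow> unit \<Rightarrow> real" where "inner_unit x y = 0"
definition norm_unit :: "unit \<Rightarrow> real" where "norm_unit x = 0"
definition dist_unit :: "unit \<Rightarrow> unit \<Rightarrow> real" where "dist_unit x y = 0"
definition sgn_unit :: "unit \<Rightarrow> unit" where "sgn_unit x = ()"
definition uniformity_unit :: "(unit \<times> unit) filter"
  where "uniformity_unit = (INF e\<in>{0<..}. principal {(x, y). dist x y < e})"
definition open_unit :: "unit set \<Rightarrow> bool"
  where "open_unit U \<longleftrightarrow> (\<forall>x\<in>U. eventually (\<lambda>(x', y). x' = x \<longrightarrow> y \<in> U) uniformity)"
instance
  by standard
    (auto simp: inner_unit_def norm_unit_def dist_unit_def uniformity_unit_def open_unit_def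
      intro: exI[of _ "{}"])
end


section \<open>Smooth maps between open subsets of model spaces\<close>

text \<open>In finite dimension, being $C^{n+1}$ means being differentiable with all directional
  derivatives $C^n$. Only used on open sets.\<close>

primrec Ck_on :: "nat \<Rightarrow> ('e::fin_dim_inner \<Rightarrow> 'f::fin_dim_inner) \<Rightarrow> 'e set \<Rightarrow> bool" where
  "Ck_on 0 f S = continuous_on S f"
| "Ck_on (Suc n) f S =
    ((\<forall>x\<in>S. f differentiable (at x)) \<and> (\<forall>v. Ck_on n (\<lambda>x. frechet_derivative f (at x) v) S))"

definition smooth_on :: "('e::fin_dim_inner \<Rightarrow> 'f::fin_dim_inner) \<Rightarrow> 'e set \<Rightarrow> bool" where
  "smooth_on f S \<longleftrightarrow> (\<forall>n. Ck_on n f S)"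


section \<open>Manifolds\<close>

text \<open>A manifold is given by a topology and a (not necessarily maximal) smooth atlas; a chart is
  a pair of its domain and its coordinate map, whose values outside the domain are irrelevant.
  Second countability is not required: nothing below depends on it, and the disjoint union of
  the members of an uncountable cover has to be a manifold.\<close>

record ('a, 'e) manifold =
  mfd_top :: "'a topology"
  atlas :: "('a set \<times> ('a \<Rightarrow> 'e)) set"

abbreviation points :: "('a, 'e) manifold \<Rightarrow> 'a set" where
  "points M \<equiv> topspace (mfd_top M)"

definition smooth_manifold :: "('a, 'e::fin_dim_inner) manifold \<Rightarrow> bool" where
  "smooth_manifold M \<longleftrightarrow>
    Hausdorff_space (mfd_top M) \<and>
    (\<Union>(U, c)\<in>atlas M. U) = points M \<and>
    (\<forall>(U, c)\<in>atlas M. openin (mfd_top M) U \<and> open (c ` U) \<and>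
       homeomorphic_map (subtopology (mfd_top M) U) (top_of_set (c ` U)) c) \<and>
    (\<forall>(U, c)\<in>atlas M. \<forall>(V, d)\<in>atlas M. smooth_on (d \<circ> inv_into U c) (c ` (U \<inter> V)))"

definition smooth_map ::
  "('a, 'e::fin_dim_inner) manifold \<Rightarrow> ('b, 'f::fin_dim_inner) manifold \<Rightarrow> ('a \<Rightarrow> 'b) \<Rightarrow> bool" where
  "smooth_map M N f \<longleftrightarrow>
    continuous_map (mfd_top M) (mfd_top N) f \<and>
    (\<forall>(U, c)\<in>atlas M. \<forall>(V, d)\<in>atlas N.
       smooth_on (d \<circ> f \<circ> inv_into U c) (c ` (U \<inter> f -` V)))"

definition diffeomorphism ::
  "('a, 'e::fin_dim_inner) manifold \<Rightarrow> ('b, 'f::fin_dim_inner) manifold \<Rightarrow> ('a \<Rightarrow> 'b) \<Rightarrow> bool" where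
  "diffeomorphism M N f \<longleftrightarrow>
    bij_betw f (points M) (points N) \<and> smooth_map M N f \<and> smooth_map N M (inv_into (points M) f)"

definition surjective_submersion ::
  "('a, 'e::fin_dim_inner) manifold \<Rightarrow> ('b, 'f::fin_dim_inner) manifold \<Rightarrow> ('a \<Rightarrow> 'b) \<Rightarrow> bool" where
  "surjective_submersion M N f \<longleftrightarrow>
    smooth_map M N f \<and> f ` points M = points N \<and>
    (\<forall>(U, c)\<in>atlas M. \<forall>(V, d)\<in>atlas N. \<forall>p\<in>U \<inter> f -` V.
       surj (frechet_derivative (d \<circ> f \<circ> inv_into U c) (at (c p))))"

definition open_submfd :: "('a, 'e) manifold \<Rightarrow> 'a set \<Rightarrow> ('a, 'e) manifold" where
  "open_submfd M W =
    \<lparr>mfd_top = subtopology (mfd_top M) W, atlas = (\<lambda>(U, c). (U \<inter> W, c)) ` atlas M\<rparr>"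

definition prod_mfd ::
  "('a, 'e) manifold \<Rightarrow> ('b, 'f) manifold \<Rightarrow> ('a \<times> 'b, 'e \<times> 'f) manifold" (infixr \<open>\<times>\<^sub>M\<^sub>f\<close> 80) where
  "M \<times>\<^sub>M\<^sub>f N =
    \<lparr>mfd_top = prod_topology (mfd_top M) (mfd_top N),
     atlas = {(U \<times> V, map_prod c d) | U c V d. (U, c) \<in> atlas M \<and> (V, d) \<in> atlas N}\<rparr>"

definition coprod_mfd :: "'i set \<Rightarrow> ('i \<Rightarrow> ('a, 'e) manifold) \<Rightarrow> ('i \<times> 'a, 'e) manifold" where
  "coprod_mfd I X =
    \<lparr>mfd_top = sum_topology (\<lambda>i. mfd_top (X i)) I,
     atlas = {({i} \<times> U, c \<circ> snd) | i U c. i \<in> I \<and> (U, c) \<in> atlas (X i)}\<rparr>"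

text \<open>Smoothness on a subset \<open>A\<close> means local extendability to smooth maps on open sets of the
  ambient manifold. For an embedded submanifold this is smoothness for the induced structure;
  it is used for fibre products along submersions and for parts of the kernel of an extension.\<close>

definition smooth_map_on ::
  "'a set \<Rightarrow> ('a, 'e::fin_dim_inner) manifold \<Rightarrow> ('b, 'f::fin_dim_inner) manifold \<Rightarrow> ('a \<Rightarrow> 'b) \<Rightarrow> bool" where
  "smooth_map_on A M N f \<longleftrightarrow>
    (\<forall>p\<in>A. \<exists>W F. openin (mfd_top M) W \<and> p \<in> W \<and> smooth_map (open_submfd M W) N F \<and>
       (\<forall>x\<in>A \<inter> W. F x = f x))"

definition diffeo_on ::
  "'a set \<Rightarrow> ('a, 'e::fin_dim_inner) manifold \<Rightarrow> 'b set \<Rightarrow> ('b, 'f::fin_dim_inner) manifold \<Rightarrow> ('a \<Rightarrow> 'b) \<Rightarrow> bool" where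
  "diffeo_on A M B N f \<longleftrightarrow>
    bij_betw f A B \<and> smooth_map_on A M N f \<and> smooth_map_on B N M (inv_into A f)"


section \<open>Lie groups and crossed modules\<close>

record ('g, 'f) lie_group = "'g monoid" +
  mfd :: "('g, 'f) manifold"

definition is_lie_group :: "('g, 'f::fin_dim_inner) lie_group \<Rightarrow> bool" where
  "is_lie_group G \<longleftrightarrow>
    group G \<and> smooth_manifold (mfd G) \<and> points (mfd G) = carrier G \<and>
    smooth_map (mfd G \<times>\<^sub>M\<^sub>f mfd G) (mfd G) (\<lambda>(x, y). x \<otimes>\<^bsub>G\<^esub> y) \<and>
    smooth_map (mfd G) (mfd G) (\<lambda>x. inv\<^bsub>G\<^esub> x)"

definition lie_aut :: "('g, 'f::fin_dim_inner) lie_group \<Rightarrow> ('g \<Rightarrow> 'g) set" where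
  "lie_aut G = {a \<in> iso G G. diffeomorphism (mfd G) (mfd G) a}"

record ('g, 'f, 'h, 'k) crossed_mod =
  grpG :: "('g, 'f) lie_group"
  grpH :: "('h, 'k) lie_group"
  rho :: "'g \<Rightarrow> 'h"
  jact :: "'h \<Rightarrow> 'g \<Rightarrow> 'g"

text \<open>\<open>jact X h g\<close> is $h(g) = j(h)(g)$. Smoothness of $j$ is smoothness of the associated action
  $H \times G \to G$, which makes sense without a Lie group structure on $\mathrm{Aut}(G)$.\<close>

definition crossed_module ::
  "('g, 'f::fin_dim_inner, 'h, 'k::fin_dim_inner) crossed_mod \<Rightarrow> bool" where
  "crossed_module X \<longleftrightarrow>
    (let G = grpG X; H = grpH X; \<rho> = rho X; j = jact X in
      is_lie_group G \<and> is_lie_group H \<and>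
      \<rho> \<in> hom G H \<and> smooth_map (mfd G) (mfd H) \<rho> \<and>
      (\<forall>h\<in>carrier H. j h \<in> lie_aut G) \<and>
      (\<forall>h\<in>carrier H. \<forall>h'\<in>carrier H. \<forall>g\<in>carrier G. j (h \<otimes>\<^bsub>H\<^esub> h') g = j h (j h' g)) \<and>
      smooth_map (mfd H \<times>\<^sub>M\<^sub>f mfd G) (mfd G) (\<lambda>(h, g). j h g) \<and>
      (\<forall>h\<in>carrier H. \<forall>g\<in>carrier G. \<rho> (j h g) = h \<otimes>\<^bsub>H\<^esub> \<rho> g \<otimes>\<^bsub>H\<^esub> inv\<^bsub>H\<^esub> h) \<and>
      (\<forall>g\<in>carrier G. \<forall>g'\<in>carrier G. j (\<rho> g) g' = g \<otimes>\<^bsub>G\<^esub> g' \<otimes>\<^bsub>G\<^esub> inv\<^bsub>G\<^esub> g))"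


section \<open>Lie groupoids, actions, principal bundles\<close>

text \<open>\<open>cmp \<Gamma> x y\<close> is the product $xy$, defined when $t(x) = s(y)$.\<close>

record ('r, 'er, 'm, 'em) lie_groupoid =
  obj :: "('m, 'em) manifold"
  arr :: "('r, 'er) manifold"
  src :: "'r \<Rightarrow> 'm"
  tgt :: "'r \<Rightarrow> 'm"
  idt :: "'m \<Rightarrow> 'r"
  cmp :: "'r \<Rightarrow> 'r \<Rightarrow> 'r"
  ginv :: "'r \<Rightarrow> 'r"

abbreviation objects :: "('r, 'er, 'm, 'em) lie_groupoid \<Rightarrow> 'm set" where
  "objects \<Gamma> \<equiv> points (obj \<Gamma>)"

abbreviation arrows :: "('r, 'er, 'm, 'em) lie_groupoid \<Rightarrow> 'r set" where
  "arrows \<Gamma> \<equiv> points (arr \<Gamma>)"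

definition composable :: "('r, 'er, 'm, 'em) lie_groupoid \<Rightarrow> ('r \<times> 'r) set" where
  "composable \<Gamma> = {(x, y). x \<in> arrows \<Gamma> \<and> y \<in> arrows \<Gamma> \<and> tgt \<Gamma> x = src \<Gamma> y}"

definition is_lie_groupoid ::
  "('r, 'er::fin_dim_inner, 'm, 'em::fin_dim_inner) lie_groupoid \<Rightarrow> bool" where
  "is_lie_groupoid \<Gamma> \<longleftrightarrow>
    smooth_manifold (obj \<Gamma>) \<and> smooth_manifold (arr \<Gamma>) \<and>
    surjective_submersion (arr \<Gamma>) (obj \<Gamma>) (src \<Gamma>) \<and>
    surjective_submersion (arr \<Gamma>) (obj \<Gamma>) (tgt \<Gamma>) \<and>
    smooth_map (obj \<Gamma>) (arr \<Gamma>) (idt \<Gamma>) \<and>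
    smooth_map_on (composable \<Gamma>) (arr \<Gamma> \<times>\<^sub>M\<^sub>f arr \<Gamma>) (arr \<Gamma>) (\<lambda>(x, y). cmp \<Gamma> x y) \<and>
    smooth_map (arr \<Gamma>) (arr \<Gamma>) (ginv \<Gamma>) \<and>
    (\<forall>m\<in>objects \<Gamma>. src \<Gamma> (idt \<Gamma> m) = m \<and> tgt \<Gamma> (idt \<Gamma> m) = m) \<and>
    (\<forall>(x, y)\<in>composable \<Gamma>. cmp \<Gamma> x y \<in> arrows \<Gamma> \<and>
       src \<Gamma> (cmp \<Gamma> x y) = src \<Gamma> x \<and> tgt \<Gamma> (cmp \<Gamma> x y) = tgt \<Gamma> y) \<and>
    (\<forall>x y z. (x, y) \<in> composable \<Gamma> \<and> (y, z) \<in> composable \<Gamma> \<longrightarrow>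
       cmp \<Gamma> (cmp \<Gamma> x y) z = cmp \<Gamma> x (cmp \<Gamma> y z)) \<and>
    (\<forall>x\<in>arrows \<Gamma>. cmp \<Gamma> (idt \<Gamma> (src \<Gamma> x)) x = x \<and> cmp \<Gamma> x (idt \<Gamma> (tgt \<Gamma> x)) = x) \<and>
    (\<forall>x\<in>arrows \<Gamma>. src \<Gamma> (ginv \<Gamma> x) = tgt \<Gamma> x \<and> tgt \<Gamma> (ginv \<Gamma> x) = src \<Gamma> x \<and>
       cmp \<Gamma> x (ginv \<Gamma> x) = idt \<Gamma> (src \<Gamma> x) \<and> cmp \<Gamma> (ginv \<Gamma> x) x = idt \<Gamma> (tgt \<Gamma> x))"

definition morphism_over_id ::
  "('r, 'er::fin_dim_inner, 'm, 'em::fin_dim_inner) lie_groupoid \<Rightarrow>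
   ('q, 'eq::fin_dim_inner, 'm, 'em) lie_groupoid \<Rightarrow> ('r \<Rightarrow> 'q) \<Rightarrow> bool" where
  "morphism_over_id \<Gamma> \<Delta> f \<longleftrightarrow>
    obj \<Gamma> = obj \<Delta> \<and> smooth_map (arr \<Gamma>) (arr \<Delta>) f \<and>
    (\<forall>x\<in>arrows \<Gamma>. src \<Delta> (f x) = src \<Gamma> x \<and> tgt \<Delta> (f x) = tgt \<Gamma> x) \<and>
    (\<forall>m\<in>objects \<Gamma>. f (idt \<Gamma> m) = idt \<Delta> m) \<and>
    (\<forall>(x, y)\<in>composable \<Gamma>. f (cmp \<Gamma> x y) = cmp \<Delta> (f x) (f y))"

definition left_action ::
  "('r, 'er::fin_dim_inner, 'm, 'em::fin_dim_inner) lie_groupoid \<Rightarrow>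
   ('p, 'ep::fin_dim_inner) manifold \<Rightarrow> ('p \<Rightarrow> 'm) \<Rightarrow> ('r \<Rightarrow> 'p \<Rightarrow> 'p) \<Rightarrow> bool" where
  "left_action \<Gamma> P \<pi> act \<longleftrightarrow>
    surjective_submersion P (obj \<Gamma>) \<pi> \<and>
    smooth_map_on {(x, p). x \<in> arrows \<Gamma> \<and> p \<in> points P \<and> tgt \<Gamma> x = \<pi> p}
      (arr \<Gamma> \<times>\<^sub>M\<^sub>f P) P (\<lambda>(x, p). act x p) \<and>
    (\<forall>x\<in>arrows \<Gamma>. \<forall>p\<in>points P. tgt \<Gamma> x = \<pi> p \<longrightarrow>
       act x p \<in> points P \<and> \<pi> (act x p) = src \<Gamma> x) \<and>
    (\<forall>(x, y)\<in>composable \<Gamma>. \<forall>p\<in>points P. tgt \<Gamma> y = \<pi> p \<longrightarrow>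
       act (cmp \<Gamma> x y) p = act x (act y p)) \<and>
    (\<forall>p\<in>points P. act (idt \<Gamma> (\<pi> p)) p = p)"

definition right_principal_bundle ::
  "('h, 'k::fin_dim_inner) lie_group \<Rightarrow> ('p, 'ep::fin_dim_inner) manifold \<Rightarrow>
   ('m, 'em::fin_dim_inner) manifold \<Rightarrow> ('p \<Rightarrow> 'm) \<Rightarrow> ('p \<Rightarrow> 'h \<Rightarrow> 'p) \<Rightarrow> bool" where
  "right_principal_bundle H P M \<pi> act \<longleftrightarrow>
    smooth_manifold P \<and> smooth_manifold M \<and> surjective_submersion P M \<pi> \<and>
    smooth_map (P \<times>\<^sub>M\<^sub>f mfd H) P (\<lambda>(p, h). act p h) \<and>
    (\<forall>p\<in>points P. act p \<one>\<^bsub>H\<^esub> = p) \<and>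
    (\<forall>p\<in>points P. \<forall>h\<in>carrier H. \<forall>h'\<in>carrier H. act p (h \<otimes>\<^bsub>H\<^esub> h') = act (act p h) h') \<and>
    (\<forall>p\<in>points P. \<forall>h\<in>carrier H. \<pi> (act p h) = \<pi> p) \<and>
    (\<forall>m\<in>points M. \<exists>V \<tau>. openin (mfd_top M) V \<and> m \<in> V \<and>
       diffeomorphism (open_submfd M V \<times>\<^sub>M\<^sub>f mfd H) (open_submfd P {p \<in> points P. \<pi> p \<in> V}) \<tau> \<and>
       (\<forall>x\<in>V. \<forall>h\<in>carrier H. \<pi> (\<tau> (x, h)) = x \<and>
          (\<forall>h'\<in>carrier H. act (\<tau> (x, h)) h' = \<tau> (x, h \<otimes>\<^bsub>H\<^esub> h'))))"


section \<open>Groupoid extensions\<close>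

definition groupoid_extension ::
  "('r, 'er::fin_dim_inner, 'm, 'em::fin_dim_inner) lie_groupoid \<Rightarrow>
   ('q, 'eq::fin_dim_inner, 'm, 'em) lie_groupoid \<Rightarrow> ('r \<Rightarrow> 'q) \<Rightarrow> bool" where
  "groupoid_extension R \<Gamma> \<phi> \<longleftrightarrow>
    is_lie_groupoid R \<and> is_lie_groupoid \<Gamma> \<and> morphism_over_id R \<Gamma> \<phi> \<and>
    surjective_submersion (arr R) (arr \<Gamma>) \<phi>"

definition kernel_over ::
  "('r, 'er, 'm, 'em) lie_groupoid \<Rightarrow> ('q, 'eq, 'm, 'em) lie_groupoid \<Rightarrow> ('r \<Rightarrow> 'q) \<Rightarrow>
   'm set \<Rightarrow> 'r set" where
  "kernel_over R \<Gamma> \<phi> V = {x \<in> arrows R. \<phi> x \<in> idt \<Gamma> ` V}"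

definition kernel_group ::
  "('r, 'er, 'm, 'em) lie_groupoid \<Rightarrow> ('q, 'eq, 'm, 'em) lie_groupoid \<Rightarrow> ('r \<Rightarrow> 'q) \<Rightarrow>
   'm \<Rightarrow> 'r monoid" where
  "kernel_group R \<Gamma> \<phi> m =
    \<lparr>carrier = kernel_over R \<Gamma> \<phi> {m}, mult = cmp R, one = idt R m\<rparr>"

text \<open>The kernel is locally trivial as a bundle of Lie groups.\<close>

definition G_extension ::
  "('g, 'f::fin_dim_inner) lie_group \<Rightarrow>
   ('r, 'er::fin_dim_inner, 'm, 'em::fin_dim_inner) lie_groupoid \<Rightarrow>
   ('q, 'eq::fin_dim_inner, 'm, 'em) lie_groupoid \<Rightarrow> ('r \<Rightarrow> 'q) \<Rightarrow> bool" where
  "G_extension G R \<Gamma> \<phi> \<longleftrightarrow>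
    groupoid_extension R \<Gamma> \<phi> \<and>
    (\<forall>m\<in>objects R. \<exists>V \<tau>. openin (mfd_top (obj R)) V \<and> m \<in> V \<and>
       diffeo_on (V \<times> carrier G) (obj R \<times>\<^sub>M\<^sub>f mfd G) (kernel_over R \<Gamma> \<phi> V) (arr R) \<tau> \<and>
       (\<forall>x\<in>V. (\<lambda>g. \<tau> (x, g)) \<in> iso G (kernel_group R \<Gamma> \<phi> x)))"

text \<open>Elements of the band are pairs of a base point $m$ and a Lie group isomorphism
  $G \to K_m$, the latter being \<^const>\<open>undefined\<close> outside of $G$.\<close>

definition band ::
  "('g, 'f::fin_dim_inner) lie_group \<Rightarrow>
   ('r, 'er::fin_dim_inner, 'm, 'em::fin_dim_inner) lie_groupoid \<Rightarrow>
   ('q, 'eq::fin_dim_inner, 'm, 'em) lie_groupoid \<Rightarrow> ('r \<Rightarrow> 'q) \<Rightarrow> ('m \<times> ('g \<Rightarrow> 'r)) set" where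
  "band G R \<Gamma> \<phi> = (SIGMA m : objects R.
    {b \<in> iso G (kernel_group R \<Gamma> \<phi> m) \<inter> extensional (carrier G).
       diffeo_on (carrier G) (mfd G) (kernel_over R \<Gamma> \<phi> {m}) (arr R) b})"

definition band_left ::
  "('g, 'f) lie_group \<Rightarrow> ('r, 'er, 'm, 'em) lie_groupoid \<Rightarrow>
   'r \<Rightarrow> 'm \<times> ('g \<Rightarrow> 'r) \<Rightarrow> 'm \<times> ('g \<Rightarrow> 'r)" where
  "band_left G R r b = (src R r, \<lambda>g\<in>carrier G. cmp R (cmp R r (snd b g)) (ginv R r))"

definition band_right ::
  "('g, 'f) lie_group \<Rightarrow> 'm \<times> ('g \<Rightarrow> 'r) \<Rightarrow> ('g \<Rightarrow> 'g) \<Rightarrow> 'm \<times> ('g \<Rightarrow> 'r)" where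
  "band_right G b \<alpha> = (fst b, \<lambda>g\<in>carrier G. snd b (\<alpha> g))"

definition band_map ::
  "('g, 'f) lie_group \<Rightarrow> ('r \<Rightarrow> 's) \<Rightarrow> 'm \<times> ('g \<Rightarrow> 'r) \<Rightarrow> 'm \<times> ('g \<Rightarrow> 's)" where
  "band_map G \<Phi> b = (fst b, \<lambda>g\<in>carrier G. \<Phi> (snd b g))"

record ('r, 'er, 'm, 'em, 'q, 'p, 'ep, 'h, 'g) gh_ext =
  ext_gpd :: "('r, 'er, 'm, 'em) lie_groupoid"
  ext_proj :: "'r \<Rightarrow> 'q"
  ext_bdl :: "('p, 'ep) manifold"
  bdl_proj :: "'p \<Rightarrow> 'm"
  bdl_right :: "'p \<Rightarrow> 'h \<Rightarrow> 'p"
  bdl_left :: "'r \<Rightarrow> 'p \<Rightarrow> 'p"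
  ext_chi :: "'p \<Rightarrow> 'm \<times> ('g \<Rightarrow> 'r)"

text \<open>A map into the band is smooth for the structure induced by local trivialisations of the
  kernel iff its evaluation map is smooth; as for \<^const>\<open>crossed_module\<close>, the latter form
  avoids a manifold structure on $\mathrm{Aut}(G)$.\<close>

definition gh_extension ::
  "('g, 'f::fin_dim_inner, 'h, 'k::fin_dim_inner) crossed_mod \<Rightarrow>
   ('q, 'eq::fin_dim_inner, 'm, 'em::fin_dim_inner) lie_groupoid \<Rightarrow>
   ('r, 'er::fin_dim_inner, 'm, 'em, 'q, 'p, 'ep::fin_dim_inner, 'h, 'g) gh_ext \<Rightarrow> bool" where
  "gh_extension X \<Gamma> E \<longleftrightarrow>
    (let G = grpG X; H = grpH X; R = ext_gpd E; \<phi> = ext_proj E; P = ext_bdl E;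
         \<pi> = bdl_proj E; ra = bdl_right E; la = bdl_left E; \<kappa> = ext_chi E in
      G_extension G R \<Gamma> \<phi> \<and>
      right_principal_bundle H P (obj R) \<pi> ra \<and>
      left_action R P \<pi> la \<and>
      (\<forall>r\<in>arrows R. \<forall>p\<in>points P. \<forall>h\<in>carrier H. tgt R r = \<pi> p \<longrightarrow>
         ra (la r p) h = la r (ra p h)) \<and>
      (\<forall>p\<in>points P. \<kappa> p \<in> band G R \<Gamma> \<phi> \<and> fst (\<kappa> p) = \<pi> p) \<and>
      smooth_map (P \<times>\<^sub>M\<^sub>f mfd G) (arr R) (\<lambda>(p, g). snd (\<kappa> p) g) \<and>
      (\<forall>r\<in>arrows R. \<forall>p\<in>points P. \<forall>h\<in>carrier H. tgt R r = \<pi> p \<longrightarrow>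
         \<kappa> (ra (la r p) h) = band_right G (band_left G R r (\<kappa> p)) (jact X h)) \<and>
      (\<forall>p\<in>points P. \<forall>g\<in>carrier G. ra p (rho X g) = la (snd (\<kappa> p) g) p))"

definition gh_iso ::
  "('g, 'f::fin_dim_inner, 'h, 'k::fin_dim_inner) crossed_mod \<Rightarrow>
   ('r, 'er::fin_dim_inner, 'm, 'em::fin_dim_inner, 'q, 'p, 'ep::fin_dim_inner, 'h, 'g) gh_ext \<Rightarrow>
   ('r', 'er'::fin_dim_inner, 'm, 'em, 'q, 'p', 'ep'::fin_dim_inner, 'h, 'g) gh_ext \<Rightarrow>
   ('r \<Rightarrow> 'r') \<Rightarrow> ('p \<Rightarrow> 'p') \<Rightarrow> bool" where
  "gh_iso X E E' \<Phi> \<Psi> \<longleftrightarrow>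
    (let R = ext_gpd E; R' = ext_gpd E'; P = ext_bdl E; P' = ext_bdl E' in
      morphism_over_id R R' \<Phi> \<and> diffeomorphism (arr R) (arr R') \<Phi> \<and>
      (\<forall>r\<in>arrows R. ext_proj E' (\<Phi> r) = ext_proj E r) \<and>
      diffeomorphism P P' \<Psi> \<and>
      (\<forall>p\<in>points P. bdl_proj E' (\<Psi> p) = bdl_proj E p) \<and>
      (\<forall>r\<in>arrows R. \<forall>p\<in>points P. \<forall>h\<in>carrier (grpH X). tgt R r = bdl_proj E p \<longrightarrow>
         \<Psi> (bdl_right E (bdl_left E r p) h) = bdl_right E' (bdl_left E' (\<Phi> r) (\<Psi> p)) h) \<and>
      (\<forall>p\<in>points P. ext_chi E' (\<Psi> p) = band_map (grpG X) \<Phi> (ext_chi E p)))"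


section \<open>Covers and the Cech groupoid\<close>

definition open_cover :: "('n, 'e) manifold \<Rightarrow> 'i set \<Rightarrow> ('i \<Rightarrow> 'n set) \<Rightarrow> bool" where
  "open_cover N I U \<longleftrightarrow> (\<forall>i\<in>I. openin (mfd_top N) (U i)) \<and> (\<Union>i\<in>I. U i) = points N"

text \<open>The points $x_i$, $x_{ij}$, $x_{ijk}$ are \<open>(i, x)\<close>, \<open>((i, j), x)\<close>, \<open>((i, j, k), x)\<close>.\<close>

definition cover1 :: "('n, 'e) manifold \<Rightarrow> 'i set \<Rightarrow> ('i \<Rightarrow> 'n set) \<Rightarrow> ('i \<times> 'n, 'e) manifold" where
  "cover1 N I U = coprod_mfd I (\<lambda>i. open_submfd N (U i))"

definition cover2 ::
  "('n, 'e) manifold \<Rightarrow> 'i set \<Rightarrow> ('i \<Rightarrow> 'n set) \<Rightarrow> (('i \<times> 'i) \<times> 'n, 'e) manifold" where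
  "cover2 N I U = coprod_mfd (I \<times> I) (\<lambda>(i, j). open_submfd N (U i \<inter> U j))"

definition cover3 ::
  "('n, 'e) manifold \<Rightarrow> 'i set \<Rightarrow> ('i \<Rightarrow> 'n set) \<Rightarrow> (('i \<times> 'i \<times> 'i) \<times> 'n, 'e) manifold" where
  "cover3 N I U = coprod_mfd (I \<times> I \<times> I) (\<lambda>(i, j, k). open_submfd N (U i \<inter> U j \<inter> U k))"

definition cech_groupoid ::
  "('n, 'e) manifold \<Rightarrow> 'i set \<Rightarrow> ('i \<Rightarrow> 'n set) \<Rightarrow>
   (('i \<times> 'i) \<times> 'n, 'e, 'i \<times> 'n, 'e) lie_groupoid" where
  "cech_groupoid N I U =
    \<lparr>obj = cover1 N I U, arr = cover2 N I U,
     src = (\<lambda>((i, j), x). (i, x)), tgt = (\<lambda>((i, j), x). (j, x)),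
     idt = (\<lambda>(i, x). ((i, i), x)),
     cmp = (\<lambda>((i, j), x) ((j', k), y). ((i, k), x)),
     ginv = (\<lambda>((i, j), x). ((j, i), x))\<rparr>"


section \<open>Adapted extensions of the Cech groupoid\<close>

type_synonym ('g, 'f, 'h, 'k, 'i, 'n, 'e) cech_ext =
  "('g \<times> (('i \<times> 'i) \<times> 'n), 'f \<times> 'e, 'i \<times> 'n, 'e, ('i \<times> 'i) \<times> 'n,
    ('i \<times> 'n) \<times> 'h, 'e \<times> 'k, 'h, 'g) gh_ext"

definition adapted_exts ::
  "('g, 'f::fin_dim_inner, 'h, 'k::fin_dim_inner) crossed_mod \<Rightarrow>
   ('n, 'e::fin_dim_inner) manifold \<Rightarrow> 'i set \<Rightarrow> ('i \<Rightarrow> 'n set) \<Rightarrow>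
   ('g, 'f, 'h, 'k, 'i, 'n, 'e) cech_ext set" where
  "adapted_exts X N I U = {E.
    (let G = grpG X; H = grpH X; R = ext_gpd E in
      gh_extension X (cech_groupoid N I U) E \<and>
      arr R = mfd G \<times>\<^sub>M\<^sub>f cover2 N I U \<and>
      (\<forall>(g, y)\<in>arrows R. ext_proj E (g, y) = y) \<and>
      ext_bdl E = cover1 N I U \<times>\<^sub>M\<^sub>f mfd H \<and>
      (\<forall>(y, h)\<in>points (ext_bdl E). bdl_proj E (y, h) = y) \<and>
      (\<forall>(y, h)\<in>points (ext_bdl E). \<forall>h'\<in>carrier H.
         bdl_right E (y, h) h' = (y, h \<otimes>\<^bsub>H\<^esub> h')) \<and>
      (\<forall>i\<in>I. \<forall>x\<in>U i. \<forall>h\<in>carrier H.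
         ext_chi E ((i, x), h) = ((i, x), \<lambda>g\<in>carrier G. (jact X h g, ((i, i), x)))) \<and>
      (\<forall>i\<in>I. \<forall>j\<in>I. \<forall>x\<in>U i \<inter> U j. \<forall>g\<in>carrier G. \<forall>g'\<in>carrier G.
         cmp R (g, ((i, i), x)) (g', ((i, j), x)) = (g \<otimes>\<^bsub>G\<^esub> g', ((i, j), x))))}"

definition adapted_iso_rel ::
  "('g, 'f::fin_dim_inner, 'h, 'k::fin_dim_inner) crossed_mod \<Rightarrow>
   ('n, 'e::fin_dim_inner) manifold \<Rightarrow> 'i set \<Rightarrow> ('i \<Rightarrow> 'n set) \<Rightarrow>
   ('g, 'f, 'h, 'k, 'i, 'n, 'e) cech_ext rel" where
  "adapted_iso_rel X N I U =
    {(E, E'). E \<in> adapted_exts X N I U \<and> E' \<in> adapted_exts X N I U \<and> (\<exists>\<Phi> \<Psi>. gh_iso X E E' \<Phi> \<Psi>)}"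


section \<open>Non-Abelian cohomology with respect to a cover\<close>

type_synonym ('g, 'h, 'i, 'n) cochain =
  "(('i \<times> 'i) \<times> 'n \<Rightarrow> 'h) \<times> (('i \<times> 'i \<times> 'i) \<times> 'n \<Rightarrow> 'g)"

definition cocycles ::
  "('g, 'f::fin_dim_inner, 'h, 'k::fin_dim_inner) crossed_mod \<Rightarrow>
   ('n, 'e::fin_dim_inner) manifold \<Rightarrow> 'i set \<Rightarrow> ('i \<Rightarrow> 'n set) \<Rightarrow>
   ('g, 'h, 'i, 'n) cochain set" where
  "cocycles X N I U = {(L, \<g>).
    (let G = grpG X; H = grpH X in
      smooth_map (cover2 N I U) (mfd H) L \<and> smooth_map (cover3 N I U) (mfd G) \<g> \<and>
      (\<forall>i\<in>I. \<forall>j\<in>I. \<forall>k\<in>I. \<forall>x\<in>U i \<inter> U j \<inter> U k.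
         rho X (\<g> ((i, j, k), x)) \<otimes>\<^bsub>H\<^esub> L ((i, k), x) = L ((i, j), x) \<otimes>\<^bsub>H\<^esub> L ((j, k), x)) \<and>
      (\<forall>i\<in>I. \<forall>j\<in>I. \<forall>k\<in>I. \<forall>l\<in>I. \<forall>x\<in>U i \<inter> U j \<inter> U k \<inter> U l.
         \<g> ((i, j, k), x) \<otimes>\<^bsub>G\<^esub> \<g> ((i, k, l), x) =
         jact X (L ((i, j), x)) (\<g> ((j, k, l), x)) \<otimes>\<^bsub>G\<^esub> \<g> ((i, j, l), x)) \<and>
      (\<forall>i\<in>I. \<forall>j\<in>I. \<forall>x\<in>U i \<inter> U j. \<g> ((i, i, j), x) = \<one>\<^bsub>G\<^esub>))}"

definition cohomologous ::
  "('g, 'f::fin_dim_inner, 'h, 'k::fin_dim_inner) crossed_mod \<Rightarrow>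
   ('n, 'e::fin_dim_inner) manifold \<Rightarrow> 'i set \<Rightarrow> ('i \<Rightarrow> 'n set) \<Rightarrow>
   ('g, 'h, 'i, 'n) cochain rel" where
  "cohomologous X N I U = {((L, \<g>), (L', \<g>')).
    (L, \<g>) \<in> cocycles X N I U \<and> (L', \<g>') \<in> cocycles X N I U \<and>
    (let G = grpG X; H = grpH X in
     \<exists>r v. smooth_map (cover1 N I U) (mfd H) r \<and> smooth_map (cover2 N I U) (mfd G) v \<and>
      (\<forall>i\<in>I. \<forall>j\<in>I. \<forall>x\<in>U i \<inter> U j.
         L' ((i, j), x) =
         rho X (v ((i, j), x)) \<otimes>\<^bsub>H\<^esub> r (i, x) \<otimes>\<^bsub>H\<^esub> L ((i, j), x) \<otimes>\<^bsub>H\<^esub> inv\<^bsub>H\<^esub> (r (j, x))) \<and>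
      (\<forall>i\<in>I. \<forall>j\<in>I. \<forall>k\<in>I. \<forall>x\<in>U i \<inter> U j \<inter> U k.
         \<g>' ((i, j, k), x) \<otimes>\<^bsub>G\<^esub> v ((i, k), x) =
         jact X (L' ((i, j), x)) (v ((j, k), x)) \<otimes>\<^bsub>G\<^esub> v ((i, j), x)
           \<otimes>\<^bsub>G\<^esub> jact X (r (i, x)) (\<g> ((i, j, k), x))))}"

definition nonabelian_H1 ::
  "('g, 'f::fin_dim_inner, 'h, 'k::fin_dim_inner) crossed_mod \<Rightarrow>
   ('n, 'e::fin_dim_inner) manifold \<Rightarrow> 'i set \<Rightarrow> ('i \<Rightarrow> 'n set) \<Rightarrow>
   ('g, 'h, 'i, 'n) cochain set set" where
  "nonabelian_H1 X N I U = cocycles X N I U // cohomologous X N I U"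

end

theory Submission
  imports Defs
begin

text \<open>
  In an adapted extension the elements \<open>(e, x\<^sub>i\<^sub>j)\<close> determine everything. Define \<open>L\<close> and \<open>\<gamma>\<close> by
  \<open>(e, x\<^sub>i\<^sub>j) \<cdot> (x\<^sub>j, e) = (x\<^sub>i, L\<^sub>i\<^sub>j)\<close> and \<open>(e, x\<^sub>i\<^sub>j) (e, x\<^sub>j\<^sub>k) = (\<gamma>\<^sub>i\<^sub>j\<^sub>k, x\<^sub>i\<^sub>k)\<close>. Equivariance of \<open>\<chi>\<close> forces
  \<open>(g, x\<^sub>i\<^sub>j) (g', x\<^sub>j\<^sub>k) = (g L\<^sub>i\<^sub>j(g') \<gamma>\<^sub>i\<^sub>j\<^sub>k, x\<^sub>i\<^sub>k)\<close> and
  \<open>(g, x\<^sub>i\<^sub>j) \<cdot> (x\<^sub>j, h) = (x\<^sub>i, \<rho>(g) L\<^sub>i\<^sub>j h)\<close>; associativity and the action axiom are then the cocycle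
  equations, and conversely these formulas turn a cocycle into an adapted extension. An isomorphism
  has the form \<open>(x\<^sub>i, h) \<mapsto> (x\<^sub>i, r\<^sub>i h)\<close>, \<open>(g, x\<^sub>i\<^sub>j) \<mapsto> (r\<^sub>i(g) v\<^sub>i\<^sub>j\<inverse>, x\<^sub>i\<^sub>j)\<close>, and compatibility
  with action and product says that \<open>(r, v)\<close> is a coboundary relating the two cocycles.
\<close>

text \<open>The product and the action are smooth only on fibre products, in the sense of local
  extendability. To obtain smooth \<open>L\<close> and \<open>\<gamma>\<close> from an extension,
  they are precomposed with smooth maps landing in those fibre products. To build the product of an
  extension, its formula is extended to a neighbourhood of each composable pair, where the indices
  are constant and \<open>\<gamma>\<close> can be evaluated at the base point of the first arrow.

  The normalisation \<open>\<gamma>_iij = e\<close> corresponds to condition (4) of adaptedness. It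
  forces \<open>L_ii = e\<close>, \<open>\<gamma>_ijj = e\<close> and \<open>v_ii = e\<close>, so
  that \<open>(e, x_ii)\<close> is the unit, the kernel is the trivial bundle with fibre
  \<open>G\<close>, and isomorphisms preserve units and the map into the band. The Peiffer identity,
  as \<open>jact_rho_mult\<close>, does the remaining algebra.

  Isomorphism of adapted extensions is the pullback of cohomology along the map sending an extension
  to its pair \<open>(L, \<gamma>)\<close>, and this map meets every class; hence taking preimages
  of classes is the bijection. A cocycle is recovered from its extension only on the overlaps, its
  values elsewhere being arbitrary.\<close>

section \<open>Smooth maps between model spaces\<close>

text \<open>Gram-Schmidt makes the coefficients explicit linear functions of \<open>x\<close>, hence
  smooth ones; coefficients chosen by \<open>span_finite\<close> need not even be
  continuous.\<close>

lemma orthogonal_expansion: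
  obtains B :: "'a::fin_dim_inner set"
  where "finite B" "\<And>x. x = (\<Sum>b\<in>B. ((x \<bullet> b) / (b \<bullet> b)) *\<^sub>R b)"
proof -
  obtain B0 :: "'a set" where "finite B0" "span B0 = UNIV"
    using finite_span by blast
  then obtain B :: "'a set" where B: "finite B" "span B = UNIV" "pairwise orthogonal B"
    using basis_orthogonal by metis
  have "x = (\<Sum>b\<in>B. ((x \<bullet> b) / (b \<bullet> b)) *\<^sub>R b)" for x
  proof -
    obtain c where c: "x = (\<Sum>b\<in>B. c b *\<^sub>R b)"
      using B(2) span_finite[OF B(1)] by blast
    have "x \<bullet> b = c b * (b \<bullet> b)" if b: "b \<in> B" for b
    proof -
      have "x \<bullet> b = (\<Sum>a\<in>B. c a * (a \<bullet> b))"
        by (simp add: c inner_sum_left)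
      also have "\<dots> = (\<Sum>a\<in>B. if a = b then c b * (b \<bullet> b) else 0)"
        using B(3) b by (intro sum.cong) (auto simp: pairwise_def orthogonal_def)
      finally show ?thesis using B(1) b by simp
    qed
    \<comment> \<open>The orthogonal family may contain 0; the corresponding term is a multiple of
      \<open>b\<close> and vanishes on both sides.\<close>
    then have "(\<Sum>b\<in>B. ((x \<bullet> b) / (b \<bullet> b)) *\<^sub>R b) = (\<Sum>b\<in>B. c b *\<^sub>R b)"
      by (intro sum.cong) auto
    with c show ?thesis by simp
  qed
  with B(1) show ?thesis using that by blast
qed

lemma Ck_on_subset: "Ck_on n f S \<Longrightarrow> T \<subseteq> S \<Longrightarrow> Ck_on n f T"
  by (induction n arbitrary: f) (auto intro: continuous_on_subset)

text \<open>Derivatives are taken in the full space, so agreement on \<open>S\<close> transfers them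
  only because \<open>S\<close> is a neighbourhood of each of its points.\<close>

lemma Ck_on_cong:
  assumes "Ck_on n f S" "open S" "\<And>x. x \<in> S \<Longrightarrow> f x = g x"
  shows "Ck_on n g S"
  using assms
proof (induction n arbitrary: f g)
  case 0
  then show ?case by (simp cong: continuous_on_cong)
next
  case (Suc n)
  have d: "f differentiable (at x)" if "x \<in> S" for x
    using Suc.prems(1) that by simp
  have "g differentiable (at x)" if "x \<in> S" for x
    using d[OF that] Suc.prems(2,3) that
    by (meson differentiable_def has_derivative_transform_within_open)
  moreover have "Ck_on n (\<lambda>x. frechet_derivative g (at x) v) S" for v
  proof (rule Suc.IH)
    show "Ck_on n (\<lambda>x. frechet_derivative f (at x) v) S" using Suc.prems(1) by simp
    show "frechet_derivative f (at x) v = frechet_derivative g (at x) v" if "x \<in> S" for x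
      using frechet_derivative_transform_within_open[OF d[OF that] Suc.prems(2) that Suc.prems(3)]
      by simp
  qed (rule Suc.prems(2))
  ultimately show ?case by simp
qed

lemma Ck_on_local:
  assumes "\<And>x. x \<in> S \<Longrightarrow> \<exists>T. open T \<and> x \<in> T \<and> Ck_on n f T"
  shows "Ck_on n f S"
  using assms
proof (induction n arbitrary: f)
  case 0
  have "isCont f x" if "x \<in> S" for x
    using 0[OF that] by (auto simp: continuous_on_eq_continuous_at)
  then show ?case by (simp add: continuous_at_imp_continuous_on)
next
  case (Suc n)
  have "f differentiable (at x)" if "x \<in> S" for x
    using Suc.prems[OF that] by auto
  moreover have "Ck_on n (\<lambda>x. frechet_derivative f (at x) v) S" for v
    using Suc.prems by (intro Suc.IH) fastforce
  ultimately show ?case by simp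
qed

lemma Ck_on_SucD: "Ck_on (Suc n) f S \<Longrightarrow> Ck_on n f S"
  by (induction n arbitrary: f)
    (auto intro!: continuous_at_imp_continuous_on differentiable_imp_continuous_within)

text \<open>Lets an explicit formula \<open>f'\<close> stand in for the chosen
  \<open>frechet_derivative\<close>, by uniqueness of the derivative. The closure properties below
  are inductions through this rule.\<close>

lemma Ck_on_SucI:
  assumes "open S"
    and "\<And>x. x \<in> S \<Longrightarrow> (f has_derivative f' x) (at x)"
    and "\<And>v. Ck_on n (\<lambda>x. f' x v) S"
  shows "Ck_on (Suc n) f S"
proof -
  have "f' x v = frechet_derivative f (at x) v" if "x \<in> S" for x v
    using frechet_derivative_at[OF assms(2)[OF that]] by simp
  then have "Ck_on n (\<lambda>x. frechet_derivative f (at x) v) S" for v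
    by (rule Ck_on_cong[OF assms(3,1)])
  moreover have "f differentiable (at x)" if "x \<in> S" for x
    using assms(2)[OF that] by (auto simp: differentiable_def)
  ultimately show ?thesis by simp
qed

lemma Ck_on_SucE:
  assumes "Ck_on (Suc n) f S"
  shows "\<And>x. x \<in> S \<Longrightarrow> (f has_derivative frechet_derivative f (at x)) (at x)"
    and "\<And>v. Ck_on n (\<lambda>x. frechet_derivative f (at x) v) S"
  using assms by (auto simp: frechet_derivative_works)

section \<open>Closure properties of \<open>C^n\<close> maps\<close>

lemma Ck_on_const: "open S \<Longrightarrow> Ck_on n (\<lambda>x. c) S"
  by (induction n arbitrary: c) (auto intro!: Ck_on_SucI[where f' = "\<lambda>x v. 0"] simp del: Ck_on.simps(2))

lemma Ck_on_bounded_linear: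
  assumes "bounded_linear L" "open S"
  shows "Ck_on n L S"
proof (cases n)
  case 0
  then show ?thesis using assms(1) by (auto intro: linear_continuous_on)
next
  case (Suc m)
  show ?thesis unfolding Suc
    by (rule Ck_on_SucI[where f' = "\<lambda>x. L"])
      (use assms in \<open>auto intro: bounded_linear_imp_has_derivative Ck_on_const\<close>)
qed

lemma Ck_on_Pair:
  assumes "open S" "Ck_on n f S" "Ck_on n g S"
  shows "Ck_on n (\<lambda>x. (f x, g x)) S"
  using assms
proof (induction n arbitrary: f g)
  case 0
  then show ?case by (simp add: continuous_on_Pair)
next
  case (Suc n)
  note f = Ck_on_SucE[OF Suc.prems(2)] and g = Ck_on_SucE[OF Suc.prems(3)]
  show ?case
    by (rule Ck_on_SucI[OF Suc.prems(1) has_derivative_Pair[OF f(1) g(1)]])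
      (auto intro: Suc.IH[OF Suc.prems(1) f(2) g(2)])
qed

lemma Ck_on_add:
  assumes "open S" "Ck_on n f S" "Ck_on n g S"
  shows "Ck_on n (\<lambda>x. f x + g x) S"
  using assms
proof (induction n arbitrary: f g)
  case 0
  then show ?case by (simp add: continuous_on_add)
next
  case (Suc n)
  note f = Ck_on_SucE[OF Suc.prems(2)] and g = Ck_on_SucE[OF Suc.prems(3)]
  show ?case
    by (rule Ck_on_SucI[OF Suc.prems(1) has_derivative_add[OF f(1) g(1)]])
      (auto intro: Suc.IH[OF Suc.prems(1) f(2) g(2)])
qed

lemma Ck_on_scaleR:
  fixes a :: "'a::fin_dim_inner \<Rightarrow> real"
  assumes "open S" "Ck_on n a S" "Ck_on n f S"
  shows "Ck_on n (\<lambda>x. a x *\<^sub>R f x) S"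
  using assms
proof (induction n arbitrary: a f)
  case 0
  then show ?case by (simp add: continuous_on_scaleR)
next
  case (Suc n)
  note a = Ck_on_SucE[OF Suc.prems(2)] and f = Ck_on_SucE[OF Suc.prems(3)]
  \<comment> \<open>The product rule retains the underived factors, so \<open>a\<close> and
    \<open>f\<close> themselves are also needed at the lower order.\<close>
  show ?case
    by (rule Ck_on_SucI[OF Suc.prems(1) has_derivative_scaleR[OF a(1) f(1)]])
      (auto simp del: Ck_on.simps intro!: Ck_on_add Suc.IH[OF Suc.prems(1)] Suc.prems(1) a(2) f(2)
        Ck_on_SucD[OF Suc.prems(2)] Ck_on_SucD[OF Suc.prems(3)])
qed

lemma Ck_on_sum:
  assumes "open S" "finite B" "\<And>b. b \<in> B \<Longrightarrow> Ck_on n (f b) S"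
  shows "Ck_on n (\<lambda>x. \<Sum>b\<in>B. f b x) S"
  using assms(2,3) by induction (auto intro: Ck_on_const Ck_on_add assms(1))

lemma Ck_on_bounded_linear_compose:
  assumes "open S" "bounded_linear L" "Ck_on n f S"
  shows "Ck_on n (\<lambda>x. L (f x)) S"
  using assms(3)
proof (induction n arbitrary: f)
  case 0
  then show ?case using assms(2) by (simp add: bounded_linear.continuous_on)
next
  case (Suc n)
  note f = Ck_on_SucE[OF Suc.prems]
  show ?case
    by (rule Ck_on_SucI[OF assms(1) bounded_linear.has_derivative[OF assms(2) f(1)]])
      (auto intro: Suc.IH[OF f(2)])
qed

text \<open>The directional derivatives of \<open>g \<circ> f\<close> become sums of products by expanding
  \<open>Df(x) v\<close> in an orthogonal basis.\<close>

lemma Ck_on_compose: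
  fixes f :: "'a::fin_dim_inner \<Rightarrow> 'b::fin_dim_inner" and g :: "'b \<Rightarrow> 'c::fin_dim_inner"
  assumes "open S" "open T" "f ` S \<subseteq> T" "Ck_on n f S" "Ck_on n g T"
  shows "Ck_on n (g \<circ> f) S"
  using assms(4,5)
proof (induction n arbitrary: g)
  case 0
  then show ?case
    using assms(3) by (simp add: continuous_on_compose continuous_on_subset del: o_apply)
next
  case (Suc n)
  note f = Ck_on_SucE[OF Suc.prems(1)] and g = Ck_on_SucE[OF Suc.prems(2)]
  obtain B :: "'b set" where B: "finite B" "\<And>y. y = (\<Sum>b\<in>B. ((y \<bullet> b) / (b \<bullet> b)) *\<^sub>R b)"
    using orthogonal_expansion by metis
  let ?d = "\<lambda>x v. \<Sum>b\<in>B. ((frechet_derivative f (at x) v \<bullet> b) / (b \<bullet> b)) *\<^sub>R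
    frechet_derivative g (at (f x)) b"
  have eq: "frechet_derivative g (at (f x)) (frechet_derivative f (at x) v) = ?d x v"
    if x: "x \<in> S" for x v
  proof -
    interpret linear "frechet_derivative g (at (f x))"
      using g(1) x assms(3) by (blast intro: has_derivative_linear)
    show ?thesis
      by (subst B(2)[of "frechet_derivative f (at x) v"]) (simp add: sum scale)
  qed
  show ?case
  proof (rule Ck_on_SucI[OF assms(1)])
    show "(g \<circ> f has_derivative frechet_derivative g (at (f x)) \<circ> frechet_derivative f (at x)) (at x)"
      if "x \<in> S" for x
      using f(1) g(1) that assms(3) by (blast intro: diff_chain_at)
    fix v
    \<comment> \<open>The induction generalises \<open>g\<close> alone: the hypothesis is applied to
      a directional derivative of \<open>g\<close> and to the same \<open>f\<close>, at one order
      less.\<close>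
    have "Ck_on n ((\<lambda>y. frechet_derivative g (at y) b) \<circ> f) S" for b
      by (rule Suc.IH[OF Ck_on_SucD[OF Suc.prems(1)] g(2)])
    then have "Ck_on n (\<lambda>x. ?d x v) S"
      unfolding divide_inverse o_def
      by (intro Ck_on_sum Ck_on_scaleR assms(1) B(1)
          Ck_on_bounded_linear_compose[OF assms(1) _ f(2),
            where L = "\<lambda>z. (z \<bullet> b) * inverse (b \<bullet> b)" for b]
          bounded_linear_compose[OF bounded_linear_mult_left bounded_linear_inner_left])
    then show "Ck_on n (\<lambda>x. (frechet_derivative g (at (f x)) \<circ> frechet_derivative f (at x)) v) S"
      by (rule Ck_on_cong[OF _ assms(1)]) (use eq in auto)
  qed
qed

lemma smooth_on_subset: "smooth_on f S \<Longrightarrow> T \<subseteq> S \<Longrightarrow> smooth_on f T"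
  by (auto simp: smooth_on_def intro: Ck_on_subset)

lemma smooth_on_cong:
  "smooth_on f S \<Longrightarrow> open S \<Longrightarrow> (\<And>x. x \<in> S \<Longrightarrow> f x = g x) \<Longrightarrow> smooth_on g S"
  unfolding smooth_on_def using Ck_on_cong by blast

lemma smooth_on_local:
  "(\<And>x. x \<in> S \<Longrightarrow> \<exists>T. open T \<and> x \<in> T \<and> smooth_on f T) \<Longrightarrow> smooth_on f S"
  unfolding smooth_on_def using Ck_on_local by meson

lemma smooth_on_bounded_linear: "bounded_linear L \<Longrightarrow> open S \<Longrightarrow> smooth_on L S"
  by (simp add: smooth_on_def Ck_on_bounded_linear)

lemma smooth_on_const: "open S \<Longrightarrow> smooth_on (\<lambda>x. c) S"
  by (simp add: smooth_on_def Ck_on_const)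

lemma smooth_on_Pair:
  "open S \<Longrightarrow> smooth_on f S \<Longrightarrow> smooth_on g S \<Longrightarrow> smooth_on (\<lambda>x. (f x, g x)) S"
  by (simp add: smooth_on_def Ck_on_Pair)

lemma smooth_on_compose:
  assumes "open S" "open T" "f ` S \<subseteq> T" "smooth_on f S" "smooth_on g T"
  shows "smooth_on (g \<circ> f) S"
  using assms(4,5) Ck_on_compose[OF assms(1-3)] unfolding smooth_on_def by blast

lemma smooth_on_has_derivative:
  assumes "smooth_on f S" "x \<in> S"
  shows "(f has_derivative frechet_derivative f (at x)) (at x)"
  using assms Ck_on_SucE(1)[of 0] unfolding smooth_on_def by blast

section \<open>Smooth maps between manifolds\<close>

lemma smooth_on_empty: "smooth_on f {}"
proof -
  have "Ck_on n f {}" for n by (induction n arbitrary: f) auto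
  then show ?thesis by (simp add: smooth_on_def)
qed

section \<open>Charts and coordinate expressions\<close>

lemma manifold_chart:
  assumes "smooth_manifold M" "(U, c) \<in> atlas M"
  shows chart_openin: "openin (mfd_top M) U"
    and chart_subset: "U \<subseteq> points M"
    and chart_homeo: "homeomorphic_map (subtopology (mfd_top M) U) (top_of_set (c ` U)) c"
    and chart_inj: "inj_on c U"
proof -
  show o: "openin (mfd_top M) U"
    and h: "homeomorphic_map (subtopology (mfd_top M) U) (top_of_set (c ` U)) c"
    using assms unfolding smooth_manifold_def by auto
  show "U \<subseteq> points M" using o by (rule openin_subset)
  then show "inj_on c U"
    using homeomorphic_imp_injective_map[OF h] by (simp add: Int_absorb1)
qed

lemma chart_image_open:
  assumes "smooth_manifold M" "(U, c) \<in> atlas M" "openin (mfd_top M) W" "W \<subseteq> U"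
  shows "open (c ` W)"
proof -
  have "openin (top_of_set (c ` U)) (c ` W)"
    using homeomorphic_imp_open_map[OF chart_homeo[OF assms(1,2)]] assms(3,4)
    by (simp add: open_map_def openin_open_subtopology chart_openin[OF assms(1,2)])
  moreover have "open (c ` U)"
    using assms(1,2) by (auto simp: smooth_manifold_def)
  ultimately show ?thesis using openin_open_trans by blast
qed

lemma transition_smooth:
  assumes "smooth_manifold M" "(U, c) \<in> atlas M" "(V, d) \<in> atlas M"
  shows "smooth_on (d \<circ> inv_into U c) (c ` (U \<inter> V))"
  using assms by (auto simp: smooth_manifold_def)

lemma chart_at:
  assumes "smooth_manifold M" "p \<in> points M"
  obtains U c where "(U, c) \<in> atlas M" "p \<in> U"
proof -
  have "p \<in> (\<Union>(U, c)\<in>atlas M. U)"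
    using assms unfolding smooth_manifold_def by simp
  then show ?thesis using that by auto
qed

lemma openin_preimage:
  assumes "continuous_map X Y f" "openin X U" "openin Y V"
  shows "openin X (U \<inter> f -` V)"
proof -
  have "U \<inter> f -` V = U \<inter> {x \<in> topspace X. f x \<in> V}"
    using openin_subset[OF assms(2)] by auto
  then show ?thesis using assms by (simp add: openin_Int openin_continuous_map_preimage)
qed

lemma smooth_map_continuous: "smooth_map M N f \<Longrightarrow> continuous_map (mfd_top M) (mfd_top N) f"
  by (simp add: smooth_map_def)

lemma smooth_map_funcset: "smooth_map M N f \<Longrightarrow> x \<in> points M \<Longrightarrow> f x \<in> points N"
  by (auto simp: smooth_map_def continuous_map_def)

lemma smooth_mapD:
  "smooth_map M N f \<Longrightarrow> (U, c) \<in> atlas M \<Longrightarrow> (V, d) \<in> atlas N \<Longrightarrow>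
    smooth_on (d \<circ> f \<circ> inv_into U c) (c ` (U \<inter> f -` V))"
  by (auto simp: smooth_map_def)

text \<open>\<open>smooth_map\<close> asks for every pair of charts of the two atlases. One pair
  around each point suffices, since transition maps carry smoothness over to all the others.\<close>

lemma smooth_map_charts:
  fixes M :: "('a, 'e::fin_dim_inner) manifold" and N :: "('b, 'f::fin_dim_inner) manifold"
  assumes M: "smooth_manifold M" and N: "smooth_manifold N"
    and f: "continuous_map (mfd_top M) (mfd_top N) f"
    and loc: "\<And>p. p \<in> points M \<Longrightarrow> \<exists>U c V d W. (U, c) \<in> atlas M \<and> (V, d) \<in> atlas N \<and>
      openin (mfd_top M) W \<and> p \<in> W \<and> W \<subseteq> U \<inter> f -` V \<and> smooth_on (d \<circ> f \<circ> inv_into U c) (c ` W)"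
  shows "smooth_map M N f"
  unfolding smooth_map_def
proof (intro conjI f ballI, clarify)
  fix U' :: "'a set" and c' :: "'a \<Rightarrow> 'e" and V' :: "'b set" and d' :: "'b \<Rightarrow> 'f"
  assume Uc': "(U', c') \<in> atlas M" and Vd': "(V', d') \<in> atlas N"
  show "smooth_on (d' \<circ> f \<circ> inv_into U' c') (c' ` (U' \<inter> f -` V'))"
  proof (rule smooth_on_local)
    fix z assume "z \<in> c' ` (U' \<inter> f -` V')"
    then obtain p where p: "z = c' p" "p \<in> U'" "f p \<in> V'" by auto
    with chart_subset[OF M Uc'] have "p \<in> points M" by auto
    from loc[OF this] obtain U c V d W where
      Uc: "(U, c) \<in> atlas M" and Vd: "(V, d) \<in> atlas N" and
      W: "openin (mfd_top M) W" "p \<in> W" "W \<subseteq> U \<inter> f -` V" "smooth_on (d \<circ> f \<circ> inv_into U c) (c ` W)"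
      by blast
    note inj = chart_inj[OF M Uc] chart_inj[OF M Uc'] chart_inj[OF N Vd]
    \<comment> \<open>On \<open>S\<close> the old and new charts are all available, and the new
      coordinate expression is the old one placed between two transition maps.\<close>
    define S where "S = U' \<inter> W \<inter> f -` V'"
    have S: "openin (mfd_top M) S" "S \<subseteq> U'" "S \<subseteq> W" "S \<subseteq> U" "S \<subseteq> f -` V" "S \<subseteq> f -` V'"
      using W(3) openin_preimage[OF f openin_Int[OF chart_openin[OF M Uc'] W(1)]
          chart_openin[OF N Vd']]
      by (auto simp: S_def)
    have open1: "open (c' ` S)" and open2: "open (c ` S)"
      using chart_image_open M Uc Uc' S by blast+
    have open3: "open (d ` (V \<inter> V'))"
      using chart_image_open[OF N Vd] chart_openin[OF N Vd] chart_openin[OF N Vd']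
      by (simp add: openin_Int)
    have 1: "smooth_on (c \<circ> inv_into U' c') (c' ` S)"
      by (rule smooth_on_subset[OF transition_smooth[OF M Uc' Uc]]) (use S in auto)
    have 2: "smooth_on (d \<circ> f \<circ> inv_into U c) (c ` S)"
      by (rule smooth_on_subset[OF W(4)]) (use S in auto)
    have i': "inv_into U' c' (c' x) = x" if "x \<in> S" for x
      using inj(2) S(2) that by (auto intro: inv_into_f_f)
    have i: "inv_into U c (c x) = x" if "x \<in> S" for x
      using inj(1) S(4) that by (auto intro: inv_into_f_f)
    have j: "inv_into V d (d (f x)) = f x" if "x \<in> S" for x
      using inj(3) S(5) that by (auto intro: inv_into_f_f)
    have "smooth_on ((d \<circ> f \<circ> inv_into U c) \<circ> (c \<circ> inv_into U' c')) (c' ` S)"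
      by (rule smooth_on_compose[OF open1 open2 _ 1 2]) (auto simp: i')
    note 3 = this
    have "(d \<circ> f \<circ> inv_into U c \<circ> (c \<circ> inv_into U' c')) ` c' ` S \<subseteq> d ` (V \<inter> V')"
      using S by (auto simp: i' i)
    from smooth_on_compose[OF open1 open3 this 3 transition_smooth[OF N Vd Vd']]
    have "smooth_on ((d' \<circ> inv_into V d) \<circ> ((d \<circ> f \<circ> inv_into U c) \<circ> (c \<circ> inv_into U' c'))) (c' ` S)" .
    then have "smooth_on (d' \<circ> f \<circ> inv_into U' c') (c' ` S)"
      by (rule smooth_on_cong[OF _ open1]) (auto simp: i i' j)
    moreover have "z \<in> c' ` S" using p W(2) by (auto simp: S_def)
    ultimately show "\<exists>T. open T \<and> z \<in> T \<and> smooth_on (d' \<circ> f \<circ> inv_into U' c') T"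
      using open1 by blast
  qed
qed

lemma smooth_map_compose:
  fixes M :: "('a, 'e::fin_dim_inner) manifold" and N :: "('b, 'f::fin_dim_inner) manifold"
    and P :: "('c, 'k::fin_dim_inner) manifold"
  assumes M: "smooth_manifold M" and N: "smooth_manifold N" and P: "smooth_manifold P"
    and f: "smooth_map M N f" and g: "smooth_map N P g"
  shows "smooth_map M P (\<lambda>x. g (f x))"
proof (rule smooth_map_charts[OF M P])
  note cf = smooth_map_continuous[OF f] and cg = smooth_map_continuous[OF g]
  show c: "continuous_map (mfd_top M) (mfd_top P) (\<lambda>x. g (f x))"
    using continuous_map_compose[OF cf cg] by (simp add: o_def)
  fix p assume p: "p \<in> points M"
  obtain U c where U: "(U, c) \<in> atlas M" "p \<in> U" using chart_at M p by metis
  obtain V d where V: "(V, d) \<in> atlas N" "f p \<in> V"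
    using chart_at N smooth_map_funcset[OF f p] by metis
  obtain Z e where Z: "(Z, e) \<in> atlas P" "g (f p) \<in> Z"
    using chart_at P smooth_map_funcset[OF g smooth_map_funcset[OF f p]] by metis
  \<comment> \<open>Three charts must fit together: \<open>f\<close> sends \<open>W\<close> into the
    part \<open>B\<close> of \<open>V\<close> that \<open>g\<close> sends into
    \<open>Z\<close>.\<close>
  define B where "B = V \<inter> g -` Z"
  define W where "W = U \<inter> f -` B"
  have oB: "openin (mfd_top N) B"
    unfolding B_def using openin_preimage[OF cg chart_openin[OF N V(1)] chart_openin[OF P Z(1)]] .
  have oW: "openin (mfd_top M) W"
    unfolding W_def using openin_preimage[OF cf chart_openin[OF M U(1)] oB] .
  have o: "open (c ` W)" "open (d ` B)"
    using chart_image_open[OF M U(1) oW] chart_image_open[OF N V(1) oB] by (auto simp: W_def B_def)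
  have i: "inv_into U c (c x) = x" if "x \<in> W" for x
    using chart_inj[OF M U(1)] that by (auto simp: W_def)
  have j: "inv_into V d (d y) = y" if "y \<in> B" for y
    using chart_inj[OF N V(1)] that by (auto simp: B_def)
  have "smooth_on ((e \<circ> g \<circ> inv_into V d) \<circ> (d \<circ> f \<circ> inv_into U c)) (c ` W)"
  proof (rule smooth_on_compose[OF o])
    show "(d \<circ> f \<circ> inv_into U c) ` c ` W \<subseteq> d ` B" by (auto simp: i) (auto simp: W_def)
    show "smooth_on (d \<circ> f \<circ> inv_into U c) (c ` W)"
      by (rule smooth_on_subset[OF smooth_mapD[OF f U(1) V(1)]]) (auto simp: W_def B_def)
    show "smooth_on (e \<circ> g \<circ> inv_into V d) (d ` B)"
      by (rule smooth_on_subset[OF smooth_mapD[OF g V(1) Z(1)]]) (auto simp: B_def)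
  qed
  then have "smooth_on (e \<circ> (\<lambda>x. g (f x)) \<circ> inv_into U c) (c ` W)"
    by (rule smooth_on_cong[OF _ o(1)]) (auto simp: i j W_def)
  then show "\<exists>U c V d W. (U, c) \<in> atlas M \<and> (V, d) \<in> atlas P \<and> openin (mfd_top M) W \<and> p \<in> W \<and>
      W \<subseteq> U \<inter> (\<lambda>x. g (f x)) -` V \<and> smooth_on (d \<circ> (\<lambda>x. g (f x)) \<circ> inv_into U c) (c ` W)"
    using U V Z oW by (intro exI[of _ U] exI[of _ c] exI[of _ Z] exI[of _ e] exI[of _ W])
      (auto simp: W_def B_def)
qed

text \<open>Chart domains lie inside \<open>points M\<close>, so within a chart both maps have the
  same preimages, and their values elsewhere never enter.\<close>

lemma smooth_map_cong:
  assumes M: "smooth_manifold M" and N: "smooth_manifold N"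
    and f: "smooth_map M N f" and eq: "\<And>x. x \<in> points M \<Longrightarrow> f x = g x"
  shows "smooth_map M N g"
  unfolding smooth_map_def
proof (intro conjI ballI, goal_cases)
  case 1
  show ?case using continuous_map_eq[OF smooth_map_continuous[OF f] eq] .
next
  case (2 x)
  obtain U c where x: "x = (U, c)" by (cases x)
  with 2 have U: "(U, c) \<in> atlas M" by simp
  have "smooth_on (d \<circ> g \<circ> inv_into U c) (c ` (U \<inter> g -` V))" if V: "(V, d) \<in> atlas N" for V d
  proof -
    have s: "U \<subseteq> points M" by (rule chart_subset[OF M U])
    have e: "U \<inter> g -` V = U \<inter> f -` V" using s eq by auto
    have "open (c ` (U \<inter> f -` V))"
      using chart_image_open[OF M U openin_preimage[OF smooth_map_continuous[OF f]
            chart_openin[OF M U] chart_openin[OF N V]]] by simp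
    then show ?thesis unfolding e
      by (rule smooth_on_cong[OF smooth_mapD[OF f U V]])
        (use s in \<open>auto simp: chart_inj[OF M U] eq subset_iff\<close>)
  qed
  then show ?case by (auto simp: x)
qed

lemma smooth_map_id: "smooth_manifold M \<Longrightarrow> smooth_map M M (\<lambda>x. x)"
  unfolding smooth_map_def using transition_smooth[of M] by (auto simp: o_def)

lemma smooth_map_const:
  assumes "smooth_manifold M" "n \<in> points N"
  shows "smooth_map M N (\<lambda>_. n)"
  unfolding smooth_map_def
proof (intro conjI ballI, goal_cases)
  case (2 x)
  obtain U c where x: "x = (U, c)" by (cases x)
  with 2 have U: "(U, c) \<in> atlas M" by simp
  have "open (c ` U)" using chart_image_open[OF assms(1) U chart_openin[OF assms(1) U]] by simp
  then have "smooth_on (d \<circ> (\<lambda>_. n) \<circ> inv_into U c) (c ` (U \<inter> (\<lambda>_. n) -` V))" for V d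
    by (cases "n \<in> V") (simp_all add: o_def smooth_on_empty smooth_on_const)
  then show ?case by (auto simp: x)
qed (use assms in simp)

subsection \<open>Open submanifolds\<close>

lemma points_open_submfd [simp]: "points (open_submfd M W) = points M \<inter> W"
  by (simp add: open_submfd_def)

lemma mfd_top_open_submfd [simp]: "mfd_top (open_submfd M W) = subtopology (mfd_top M) W"
  by (simp add: open_submfd_def)

text \<open>Restricting a chart to \<open>V\<close> changes the function \<open>inv_into\<close>,
  though not on the image of \<open>V\<close>. This compares coordinate expressions on an open
  submanifold with those on the ambient manifold.\<close>

lemma inv_into_subset: "inj_on c U \<Longrightarrow> V \<subseteq> U \<Longrightarrow> x \<in> V \<Longrightarrow> inv_into V c (c x) = inv_into U c (c x)"
  by (metis inj_on_subset inv_into_f_f subsetD)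

lemma smooth_manifold_open_submfd:
  assumes M: "smooth_manifold M" and W: "openin (mfd_top M) W"
  shows "smooth_manifold (open_submfd M W)"
  unfolding smooth_manifold_def
proof (intro conjI)
  show "Hausdorff_space (mfd_top (open_submfd M W))"
    using M by (simp add: smooth_manifold_def Hausdorff_space_subtopology)
  have "(\<Union>(U, c)\<in>atlas M. U) = points M" using M by (simp add: smooth_manifold_def)
  then show "(\<Union>(U, c)\<in>atlas (open_submfd M W). U) = points (open_submfd M W)"
    by (simp add: open_submfd_def split_def flip: UN_extend_simps)
  have "openin (subtopology (mfd_top M) W) (U \<inter> W) \<and> open (c ` (U \<inter> W)) \<and>
      homeomorphic_map (subtopology (subtopology (mfd_top M) W) (U \<inter> W)) (top_of_set (c ` (U \<inter> W))) c"
    if U: "(U, c) \<in> atlas M" for U c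
  proof (intro conjI)
    show "openin (subtopology (mfd_top M) W) (U \<inter> W)"
      using chart_openin[OF M U] by (rule openin_subtopology_Int)
    show "open (c ` (U \<inter> W))"
      using chart_image_open[OF M U] chart_openin[OF M U] W by (simp add: openin_Int)
    have "homeomorphic_map (subtopology (subtopology (mfd_top M) U) W)
        (subtopology (top_of_set (c ` U)) (c ` (U \<inter> W))) c"
      using chart_inj[OF M U] chart_subset[OF M U]
      by (intro homeomorphic_map_subtopologies_alt chart_homeo[OF M U]) (auto simp: inj_on_def)
    then show "homeomorphic_map (subtopology (subtopology (mfd_top M) W) (U \<inter> W))
        (top_of_set (c ` (U \<inter> W))) c"
      by (simp add: subtopology_subtopology Int_ac Int_absorb1 image_mono)
  qed
  then show "\<forall>(U, c)\<in>atlas (open_submfd M W). openin (mfd_top (open_submfd M W)) U \<and>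
      open (c ` U) \<and>
      homeomorphic_map (subtopology (mfd_top (open_submfd M W)) U) (top_of_set (c ` U)) c"
    by (auto simp: open_submfd_def)
  have "smooth_on (d \<circ> inv_into (U \<inter> W) c) (c ` (U \<inter> W \<inter> (V \<inter> W)))"
    if U: "(U, c) \<in> atlas M" and V: "(V, d) \<in> atlas M" for U c V d
  proof (rule smooth_on_cong)
    show "smooth_on (d \<circ> inv_into U c) (c ` (U \<inter> W \<inter> (V \<inter> W)))"
      by (rule smooth_on_subset[OF transition_smooth[OF M U V]]) auto
    show "open (c ` (U \<inter> W \<inter> (V \<inter> W)))"
      using chart_image_open[OF M U] chart_openin[OF M U] chart_openin[OF M V] W
      by (simp add: openin_Int inf_commute inf_left_commute)
  qed (use chart_inj[OF M U] in \<open>auto simp: inv_into_subset inj_on_Int\<close>)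
  then show "\<forall>(U, c)\<in>atlas (open_submfd M W). \<forall>(V, d)\<in>atlas (open_submfd M W).
      smooth_on (d \<circ> inv_into U c) (c ` (U \<inter> V))"
    by (auto simp: open_submfd_def)
qed

lemma smooth_map_restrict:
  assumes M: "smooth_manifold M" and N: "smooth_manifold N" and W: "openin (mfd_top M) W"
    and f: "smooth_map M N f"
  shows "smooth_map (open_submfd M W) N f"
proof -
  have "smooth_on (d \<circ> f \<circ> inv_into (U \<inter> W) c) (c ` (U \<inter> W \<inter> f -` V))"
    if U: "(U, c) \<in> atlas M" and V: "(V, d) \<in> atlas N" for U c V d
  proof (rule smooth_on_cong)
    show "smooth_on (d \<circ> f \<circ> inv_into U c) (c ` (U \<inter> W \<inter> f -` V))"
      by (rule smooth_on_subset[OF smooth_mapD[OF f U V]]) auto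
    show "open (c ` (U \<inter> W \<inter> f -` V))"
      by (rule chart_image_open[OF M U openin_preimage[OF smooth_map_continuous[OF f]]])
        (auto intro: openin_Int chart_openin M N U V W)
  qed (use chart_inj[OF M U] in \<open>auto simp: inv_into_subset inj_on_Int\<close>)
  then show ?thesis
    using smooth_map_continuous[OF f]
    by (auto simp: smooth_map_def open_submfd_def continuous_map_from_subtopology)
qed

lemma smooth_map_into_open_submfd:
  assumes "smooth_map M N f" "\<And>x. x \<in> points M \<Longrightarrow> f x \<in> W"
  shows "smooth_map M (open_submfd N W) f"
proof -
  have "smooth_on (d \<circ> f \<circ> inv_into U c) (c ` (U \<inter> f -` (V \<inter> W)))"
    if "(U, c) \<in> atlas M" and "(V, d) \<in> atlas N" for U c V d
    by (rule smooth_on_subset[OF smooth_mapD[OF assms(1) that]]) auto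
  then show ?thesis
    using smooth_map_continuous[OF assms(1)] assms(2)
    by (auto simp: smooth_map_def open_submfd_def continuous_map_in_subtopology)
qed

lemma smooth_map_inclusion:
  "smooth_manifold M \<Longrightarrow> openin (mfd_top M) W \<Longrightarrow> smooth_map (open_submfd M W) M (\<lambda>x. x)"
  by (simp add: smooth_map_restrict smooth_map_id)

text \<open>In contrast to \<open>smooth_map_charts\<close>, continuity is part of the conclusion:
  it too is glued from the open pieces.\<close>

lemma smooth_map_local:
  fixes M :: "('a, 'e::fin_dim_inner) manifold" and N :: "('b, 'f::fin_dim_inner) manifold"
  assumes M: "smooth_manifold M" and N: "smooth_manifold N"
    and loc: "\<And>p. p \<in> points M \<Longrightarrow>
      \<exists>W. openin (mfd_top M) W \<and> p \<in> W \<and> smooth_map (open_submfd M W) N f"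
  shows "smooth_map M N f"
  unfolding smooth_map_def
proof (intro conjI ballI, goal_cases)
  case 1
  have fN: "f p \<in> points N" if p: "p \<in> points M" for p
    using loc[OF p] smooth_map_funcset p by fastforce
  have "openin (mfd_top M) {x \<in> points M. f x \<in> V}" if V: "openin (mfd_top N) V" for V
  proof (subst openin_subopen, clarify)
    fix p assume p: "p \<in> points M" "f p \<in> V"
    from loc[OF p(1)] obtain W where
      W: "openin (mfd_top M) W" "p \<in> W" "smooth_map (open_submfd M W) N f" by blast
    have "openin (subtopology (mfd_top M) W) {x \<in> topspace (subtopology (mfd_top M) W). f x \<in> V}"
      using openin_continuous_map_preimage[OF smooth_map_continuous[OF W(3)] V] by simp
    then have "openin (mfd_top M) {x \<in> points M \<inter> W. f x \<in> V}"
      using W(1) by (simp add: openin_open_subtopology)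
    with p W(2) show "\<exists>T. openin (mfd_top M) T \<and> p \<in> T \<and> T \<subseteq> {x \<in> points M. f x \<in> V}"
      by (intro exI[of _ "{x \<in> points M \<inter> W. f x \<in> V}"]) auto
  qed
  with fN show ?case by (auto simp: continuous_map_def)
next
  case (2 x)
  obtain U c where x: "x = (U, c)" by (cases x)
  with 2 have U: "(U, c) \<in> atlas M" by simp
  have "smooth_on (d \<circ> f \<circ> inv_into U c) (c ` (U \<inter> f -` V))" if V: "(V, d) \<in> atlas N" for V d
  proof (rule smooth_on_local)
    fix z assume "z \<in> c ` (U \<inter> f -` V)"
    then obtain p where p: "z = c p" "p \<in> U" "f p \<in> V" by auto
    with chart_subset[OF M U] have "p \<in> points M" by auto
    from loc[OF this] obtain W where
      W: "openin (mfd_top M) W" "p \<in> W" "smooth_map (open_submfd M W) N f" by blast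
    have MW: "smooth_manifold (open_submfd M W)"
      by (rule smooth_manifold_open_submfd[OF M W(1)])
    have UW: "(U \<inter> W, c) \<in> atlas (open_submfd M W)"
      using U by (auto simp: open_submfd_def image_iff intro!: bexI[of _ "(U, c)"])
    let ?T = "c ` (U \<inter> W \<inter> f -` V)"
    have o: "open ?T"
      by (rule chart_image_open[OF MW UW openin_preimage[OF smooth_map_continuous[OF W(3)]
              chart_openin[OF MW UW] chart_openin[OF N V]]]) auto
    have "smooth_on (d \<circ> f \<circ> inv_into U c) ?T"
      by (rule smooth_on_cong[OF smooth_mapD[OF W(3) UW V] o])
        (use chart_inj[OF M U] in \<open>auto simp: inv_into_subset inj_on_Int\<close>)
    with o p W(2) show "\<exists>T. open T \<and> z \<in> T \<and> smooth_on (d \<circ> f \<circ> inv_into U c) T"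
      by (intro exI[of _ ?T]) auto
  qed
  then show ?case by (auto simp: x)
qed

subsection \<open>Products\<close>

lemma points_prod_mfd [simp]: "points (M \<times>\<^sub>M\<^sub>f N) = points M \<times> points N"
  by (simp add: prod_mfd_def)

lemma mfd_top_prod_mfd [simp]: "mfd_top (M \<times>\<^sub>M\<^sub>f N) = prod_topology (mfd_top M) (mfd_top N)"
  by (simp add: prod_mfd_def)

lemma atlas_prod_mfdE:
  assumes "(W, e) \<in> atlas (M \<times>\<^sub>M\<^sub>f N)"
  obtains U c V d where "W = U \<times> V" "e = map_prod c d" "(U, c) \<in> atlas M" "(V, d) \<in> atlas N"
  using assms by (auto simp: prod_mfd_def)

lemma inv_into_map_prod:
  assumes "inj_on c U" "inj_on d V" "x \<in> U" "y \<in> V"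
  shows "inv_into (U \<times> V) (map_prod c d) (c x, d y) = (x, y)"
proof -
  have "inj_on (map_prod c d) (U \<times> V)" using assms(1,2) by (rule map_prod_inj_on)
  from inv_into_f_f[OF this, of "(x, y)"] show ?thesis using assms(3,4) by simp
qed

lemma smooth_on_comp_fst:
  fixes f :: "'e::fin_dim_inner \<Rightarrow> 'f::fin_dim_inner"
  assumes "open S" "open (T :: 'k::fin_dim_inner set)" "smooth_on f S"
  shows "smooth_on (f \<circ> fst) (S \<times> T)"
  by (rule smooth_on_compose[OF open_Times[OF assms(1,2)] assms(1)])
    (auto intro: smooth_on_bounded_linear bounded_linear_fst open_Times assms)

lemma smooth_on_comp_snd:
  fixes f :: "'k::fin_dim_inner \<Rightarrow> 'f::fin_dim_inner"
  assumes "open (S :: 'e::fin_dim_inner set)" "open T" "smooth_on f T"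
  shows "smooth_on (f \<circ> snd) (S \<times> T)"
  by (rule smooth_on_compose[OF open_Times[OF assms(1,2)] assms(2)])
    (auto intro: smooth_on_bounded_linear bounded_linear_snd open_Times assms)

lemma smooth_manifold_prod:
  fixes M :: "('a, 'e::fin_dim_inner) manifold" and N :: "('b, 'f::fin_dim_inner) manifold"
  assumes M: "smooth_manifold M" and N: "smooth_manifold N"
  shows "smooth_manifold (M \<times>\<^sub>M\<^sub>f N)"
  unfolding smooth_manifold_def
proof (intro conjI ballI)
  show "Hausdorff_space (mfd_top (M \<times>\<^sub>M\<^sub>f N))"
    using M N by (simp add: smooth_manifold_def Hausdorff_space_prod_topology)
  show "(\<Union>(U, c)\<in>atlas (M \<times>\<^sub>M\<^sub>f N). U) = points (M \<times>\<^sub>M\<^sub>f N)"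
  proof (intro equalityI subsetI)
    fix z assume "z \<in> (\<Union>(U, c)\<in>atlas (M \<times>\<^sub>M\<^sub>f N). U)"
    then show "z \<in> points (M \<times>\<^sub>M\<^sub>f N)"
      using chart_subset[OF M] chart_subset[OF N] by (fastforce simp: prod_mfd_def)
  next
    fix z assume "z \<in> points (M \<times>\<^sub>M\<^sub>f N)"
    then obtain x y where z: "z = (x, y)" "x \<in> points M" "y \<in> points N" by auto
    obtain U c where "(U, c) \<in> atlas M" "x \<in> U" using chart_at[OF M z(2)] .
    moreover obtain V d where "(V, d) \<in> atlas N" "y \<in> V" using chart_at[OF N z(3)] .
    ultimately have "(U \<times> V, map_prod c d) \<in> atlas (M \<times>\<^sub>M\<^sub>f N)" "z \<in> U \<times> V"
      by (auto simp: prod_mfd_def z(1))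
    then show "z \<in> (\<Union>(U, c)\<in>atlas (M \<times>\<^sub>M\<^sub>f N). U)"
      by (intro UN_I[of "(U \<times> V, map_prod c d)"]) simp_all
  qed
next
  fix w assume w: "w \<in> atlas (M \<times>\<^sub>M\<^sub>f N)"
  obtain W e where we: "w = (W, e)" by (cases w)
  from w obtain U c V d where W: "W = U \<times> V" and e: "e = map_prod c d" and
    U: "(U, c) \<in> atlas M" and V: "(V, d) \<in> atlas N"
    unfolding we by (rule atlas_prod_mfdE)
  have "openin (mfd_top (M \<times>\<^sub>M\<^sub>f N)) W"
    using chart_openin[OF M U] chart_openin[OF N V] by (simp add: W openin_prod_Times_iff)
  moreover have im: "e ` W = c ` U \<times> d ` V" by (auto simp: W e map_prod_def)
  moreover have "open (e ` W)"
    unfolding im using chart_image_open[OF M U chart_openin[OF M U]]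
      chart_image_open[OF N V chart_openin[OF N V]] by (simp add: open_Times)
  moreover have "homeomorphic_map (subtopology (mfd_top (M \<times>\<^sub>M\<^sub>f N)) W) (top_of_set (e ` W)) e"
  proof -
    from chart_homeo[OF M U] obtain c' where
      c': "homeomorphic_maps (subtopology (mfd_top M) U) (top_of_set (c ` U)) c c'"
      by (auto simp: homeomorphic_map_maps)
    from chart_homeo[OF N V] obtain d' where
      d': "homeomorphic_maps (subtopology (mfd_top N) V) (top_of_set (d ` V)) d d'"
      by (auto simp: homeomorphic_map_maps)
    have "homeomorphic_maps (prod_topology (subtopology (mfd_top M) U) (subtopology (mfd_top N) V))
        (prod_topology (top_of_set (c ` U)) (top_of_set (d ` V)))
        (\<lambda>(x, y). (c x, d y)) (\<lambda>(x, y). (c' x, d' y))"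
      using c' d' by (simp add: homeomorphic_maps_prod flip: prod_topology_subtopology_eu)
    then have "homeomorphic_map (subtopology (mfd_top (M \<times>\<^sub>M\<^sub>f N)) (U \<times> V)) (top_of_set (c ` U \<times> d ` V))
        (\<lambda>(x, y). (c x, d y))"
      using homeomorphic_map_maps by (auto simp: subtopology_Times)
    then show ?thesis unfolding im by (simp add: W e map_prod_def)
  qed
  ultimately show "case w of (U, c) \<Rightarrow> openin (mfd_top (M \<times>\<^sub>M\<^sub>f N)) U \<and> open (c ` U) \<and>
      homeomorphic_map (subtopology (mfd_top (M \<times>\<^sub>M\<^sub>f N)) U) (top_of_set (c ` U)) c"
    by (simp add: we)
  have "smooth_on (e' \<circ> inv_into W e) (e ` (W \<inter> W'))" if w': "(W', e') \<in> atlas (M \<times>\<^sub>M\<^sub>f N)" for W' e'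
  proof -
    from w' obtain U' c' V' d' where W': "W' = U' \<times> V'" and e': "e' = map_prod c' d'" and
      U': "(U', c') \<in> atlas M" and V': "(V', d') \<in> atlas N"
      by (rule atlas_prod_mfdE)
    have im: "e ` (W \<inter> W') = c ` (U \<inter> U') \<times> d ` (V \<inter> V')"
      by (auto simp: W e W' map_prod_def)
    have o: "open (c ` (U \<inter> U'))" "open (d ` (V \<inter> V'))"
      using chart_image_open[OF M U] chart_openin[OF M U] chart_openin[OF M U']
        chart_image_open[OF N V] chart_openin[OF N V] chart_openin[OF N V']
      by (auto simp: openin_Int)
    have "smooth_on (\<lambda>z. (((c' \<circ> inv_into U c) \<circ> fst) z, ((d' \<circ> inv_into V d) \<circ> snd) z))
        (c ` (U \<inter> U') \<times> d ` (V \<inter> V'))"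
      by (intro smooth_on_Pair smooth_on_comp_fst smooth_on_comp_snd open_Times o
          transition_smooth[OF M U U'] transition_smooth[OF N V V'])
    then show ?thesis
      unfolding im
      by (rule smooth_on_cong)
        (auto simp: open_Times o W e e' inv_into_map_prod chart_inj[OF M U] chart_inj[OF N V])
  qed
  then show "case w of (U, c) \<Rightarrow> \<forall>(V, d)\<in>atlas (M \<times>\<^sub>M\<^sub>f N). smooth_on (d \<circ> inv_into U c) (c ` (U \<inter> V))"
    by (auto simp: we)
qed

lemma smooth_map_fst:
  assumes M: "smooth_manifold M" and N: "smooth_manifold N"
  shows "smooth_map (M \<times>\<^sub>M\<^sub>f N) M fst"
proof -
  have "smooth_on (c' \<circ> fst \<circ> inv_into (U \<times> V) (map_prod c d)) (map_prod c d ` (U \<times> V \<inter> fst -` U'))"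
    if U: "(U, c) \<in> atlas M" and V: "(V, d) \<in> atlas N" and U': "(U', c') \<in> atlas M" for U c V d U' c'
  proof -
    have im: "map_prod c d ` (U \<times> V \<inter> fst -` U') = c ` (U \<inter> U') \<times> d ` V"
      by (auto simp: map_prod_def)
    have o: "open (c ` (U \<inter> U'))" "open (d ` V)"
      using chart_image_open[OF M U] chart_openin[OF M U] chart_openin[OF M U']
        chart_image_open[OF N V chart_openin[OF N V]]
      by (auto simp: openin_Int)
    show ?thesis
      unfolding im
      by (rule smooth_on_cong[OF smooth_on_comp_fst[OF o transition_smooth[OF M U U']]])
        (auto simp: open_Times o inv_into_map_prod chart_inj[OF M U] chart_inj[OF N V])
  qed
  then show ?thesis
    by (auto simp: smooth_map_def continuous_map_fst elim!: atlas_prod_mfdE)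
qed

lemma smooth_map_snd:
  assumes M: "smooth_manifold M" and N: "smooth_manifold N"
  shows "smooth_map (M \<times>\<^sub>M\<^sub>f N) N snd"
proof -
  have "smooth_on (d' \<circ> snd \<circ> inv_into (U \<times> V) (map_prod c d)) (map_prod c d ` (U \<times> V \<inter> snd -` V'))"
    if U: "(U, c) \<in> atlas M" and V: "(V, d) \<in> atlas N" and V': "(V', d') \<in> atlas N" for U c V d V' d'
  proof -
    have im: "map_prod c d ` (U \<times> V \<inter> snd -` V') = c ` U \<times> d ` (V \<inter> V')"
      by (auto simp: map_prod_def)
    have o: "open (c ` U)" "open (d ` (V \<inter> V'))"
      using chart_image_open[OF N V] chart_openin[OF N V] chart_openin[OF N V']
        chart_image_open[OF M U chart_openin[OF M U]]
      by (auto simp: openin_Int)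
    show ?thesis
      unfolding im
      by (rule smooth_on_cong[OF smooth_on_comp_snd[OF o transition_smooth[OF N V V']]])
        (auto simp: open_Times o inv_into_map_prod chart_inj[OF M U] chart_inj[OF N V])
  qed
  then show ?thesis
    by (auto simp: smooth_map_def continuous_map_snd elim!: atlas_prod_mfdE)
qed

lemma smooth_map_Pair:
  assumes L: "smooth_manifold L" and M: "smooth_manifold M" and N: "smooth_manifold N"
    and f: "smooth_map L M f" and g: "smooth_map L N g"
  shows "smooth_map L (M \<times>\<^sub>M\<^sub>f N) (\<lambda>x. (f x, g x))"
proof -
  note cf = smooth_map_continuous[OF f] and cg = smooth_map_continuous[OF g]
  have "smooth_on (map_prod d e \<circ> (\<lambda>x. (f x, g x)) \<circ> inv_into U c)
      (c ` (U \<inter> (\<lambda>x. (f x, g x)) -` (V \<times> W)))"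
    if U: "(U, c) \<in> atlas L" and V: "(V, d) \<in> atlas M" and W: "(W, e) \<in> atlas N" for U c V d W e
  proof -
    have "openin (mfd_top L) (U \<inter> (\<lambda>x. (f x, g x)) -` (V \<times> W))"
      by (rule openin_preimage[OF continuous_map_pairedI[OF cf cg]])
        (auto simp: openin_prod_Times_iff intro: chart_openin L M N U V W)
    then have o: "open (c ` (U \<inter> (\<lambda>x. (f x, g x)) -` (V \<times> W)))"
      by (rule chart_image_open[OF L U]) auto
    have "smooth_on (d \<circ> f \<circ> inv_into U c) (c ` (U \<inter> (\<lambda>x. (f x, g x)) -` (V \<times> W)))"
      by (rule smooth_on_subset[OF smooth_mapD[OF f U V]]) auto
    moreover have "smooth_on (e \<circ> g \<circ> inv_into U c) (c ` (U \<inter> (\<lambda>x. (f x, g x)) -` (V \<times> W)))"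
      by (rule smooth_on_subset[OF smooth_mapD[OF g U W]]) auto
    ultimately show ?thesis using smooth_on_Pair[OF o] by (auto simp: o_def)
  qed
  then show ?thesis
    by (auto simp: smooth_map_def continuous_map_pairedI cf cg elim!: atlas_prod_mfdE)
qed

subsection \<open>Coproducts\<close>

lemma points_coprod_mfd [simp]: "points (coprod_mfd I X) = (SIGMA i:I. points (X i))"
  by (simp add: coprod_mfd_def comp_def)

lemma mfd_top_coprod_mfd [simp]: "mfd_top (coprod_mfd I X) = sum_topology (\<lambda>i. mfd_top (X i)) I"
  by (simp add: coprod_mfd_def)

lemma atlas_coprod_mfdE:
  assumes "(W, e) \<in> atlas (coprod_mfd I X)"
  obtains i U c where "W = {i} \<times> U" "e = c \<circ> snd" "i \<in> I" "(U, c) \<in> atlas (X i)"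
  using assms by (auto simp: coprod_mfd_def)

lemma openin_sum_component:
  assumes "i \<in> I" "openin (T i) U"
  shows "openin (sum_topology T I) ({i} \<times> U)"
proof -
  have "openin (T j) {x. (j, x) \<in> {i} \<times> U}" for j
    using assms(2) by (cases "j = i") auto
  then show ?thesis
    using assms openin_subset[OF assms(2)] by (auto simp: openin_sum_topology)
qed

lemma inv_into_component:
  assumes "inj_on c U" "x \<in> U"
  shows "inv_into ({i} \<times> U) (c \<circ> snd) (c x) = (i, x)"
proof -
  have "inj_on (c \<circ> snd) ({i} \<times> U)" using assms(1) by (auto simp: inj_on_def)
  from inv_into_f_f[OF this, of "(i, x)"] show ?thesis using assms(2) by simp
qed

lemma Hausdorff_space_sum_topology:
  assumes "\<And>i. i \<in> I \<Longrightarrow> Hausdorff_space (T i)"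
  shows "Hausdorff_space (sum_topology T I)"
  unfolding Hausdorff_space_def
proof (intro allI impI)
  fix z w assume zw: "z \<in> topspace (sum_topology T I) \<and> w \<in> topspace (sum_topology T I) \<and> z \<noteq> w"
  obtain i x j y where z: "z = (i, x)" "w = (j, y)"
    by (cases z, cases w)
  with zw have ne: "(i, x) \<noteq> (j, y)" and
    i: "i \<in> I" "x \<in> topspace (T i)" and j: "j \<in> I" "y \<in> topspace (T j)"
    by simp_all
  show "\<exists>U V. openin (sum_topology T I) U \<and> openin (sum_topology T I) V \<and> z \<in> U \<and> w \<in> V \<and> disjnt U V"
  proof (cases "i = j")
    case True
    with ne have "x \<noteq> y" by auto
    with assms[OF i(1)] i j True obtain U V where
      "openin (T i) U" "openin (T i) V" "x \<in> U" "y \<in> V" "disjnt U V"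
      unfolding Hausdorff_space_def by metis
    then show ?thesis using i(1) True z
      by (intro exI[of _ "{i} \<times> U"] exI[of _ "{i} \<times> V"])
        (auto simp: openin_sum_component disjnt_iff)
  next
    case False
    then show ?thesis using i j z
      by (intro exI[of _ "{i} \<times> topspace (T i)"] exI[of _ "{j} \<times> topspace (T j)"])
        (auto simp: openin_sum_component disjnt_iff)
  qed
qed

lemma smooth_manifold_coprod:
  fixes X :: "'i \<Rightarrow> ('a, 'e::fin_dim_inner) manifold"
  assumes X: "\<And>i. i \<in> I \<Longrightarrow> smooth_manifold (X i)"
  shows "smooth_manifold (coprod_mfd I X)"
  unfolding smooth_manifold_def
proof (intro conjI ballI)
  show "Hausdorff_space (mfd_top (coprod_mfd I X))"
    using X by (auto simp: smooth_manifold_def intro: Hausdorff_space_sum_topology)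
  show "(\<Union>(U, c)\<in>atlas (coprod_mfd I X). U) = points (coprod_mfd I X)"
  proof (intro equalityI subsetI)
    fix z assume "z \<in> (\<Union>(U, c)\<in>atlas (coprod_mfd I X). U)"
    then show "z \<in> points (coprod_mfd I X)"
      using chart_subset[OF X] by (fastforce simp: coprod_mfd_def)
  next
    fix z assume "z \<in> points (coprod_mfd I X)"
    then obtain i x where z: "z = (i, x)" "i \<in> I" "x \<in> points (X i)" by auto
    obtain U c where "(U, c) \<in> atlas (X i)" "x \<in> U" using chart_at[OF X[OF z(2)] z(3)] .
    then have "({i} \<times> U, c \<circ> snd) \<in> atlas (coprod_mfd I X)" "z \<in> {i} \<times> U"
      using z by (auto simp: coprod_mfd_def)
    then show "z \<in> (\<Union>(U, c)\<in>atlas (coprod_mfd I X). U)"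
      by (intro UN_I[of "({i} \<times> U, c \<circ> snd)"]) simp_all
  qed
next
  fix w assume w: "w \<in> atlas (coprod_mfd I X)"
  obtain W e where we: "w = (W, e)" by (cases w)
  from w obtain i U c where W: "W = {i} \<times> U" and e: "e = c \<circ> snd" and
    i: "i \<in> I" and U: "(U, c) \<in> atlas (X i)"
    unfolding we by (rule atlas_coprod_mfdE)
  let ?T = "sum_topology (\<lambda>i. mfd_top (X i)) I"
  note oU = chart_openin[OF X[OF i] U] and sU = chart_subset[OF X[OF i] U]
  have oW: "openin ?T ({i} \<times> U)"
    using i oU by (rule openin_sum_component)
  have im: "e ` W = c ` U" by (force simp: W e)
  moreover have "open (e ` W)"
    unfolding im using chart_image_open[OF X[OF i] U oU] by simp
  moreover have "homeomorphic_map (subtopology ?T W) (top_of_set (e ` W)) e"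
  proof -
    \<comment> \<open>Forgetting the index identifies \<open>{i} \<times> U\<close> with
      \<open>U\<close>, after which the chart \<open>c\<close> of the component supplies the
      homeomorphism.\<close>
    have "homeomorphic_maps (subtopology ?T ({i} \<times> U)) (subtopology (mfd_top (X i)) U) snd (Pair i)"
      unfolding homeomorphic_maps_def
    proof (intro conjI)
      have "openin (subtopology ?T ({i} \<times> U)) {z \<in> topspace (subtopology ?T ({i} \<times> U)). snd z \<in> V}"
        if V: "openin (subtopology (mfd_top (X i)) U) V" for V
      proof -
        have "openin (mfd_top (X i)) V" "V \<subseteq> U"
          using V oU by (auto simp: openin_open_subtopology)
        moreover from this have "{z \<in> topspace (subtopology ?T ({i} \<times> U)). snd z \<in> V} = {i} \<times> V"
          using i sU by auto
        ultimately show ?thesis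
          using openin_sum_component[of i I "\<lambda>i. mfd_top (X i)" V] i oW
          by (auto simp: openin_open_subtopology)
      qed
      then show "continuous_map (subtopology ?T ({i} \<times> U)) (subtopology (mfd_top (X i)) U) snd"
        using sU by (auto simp: continuous_map_def)
      show "continuous_map (subtopology (mfd_top (X i)) U) (subtopology ?T ({i} \<times> U)) (Pair i)"
        using continuous_map_from_subtopology[OF continuous_map_component_injection[OF i,
            of "\<lambda>i. mfd_top (X i)"]]
        by (auto simp: continuous_map_in_subtopology)
    qed auto
    then have "homeomorphic_map (subtopology ?T W) (subtopology (mfd_top (X i)) U) snd"
      unfolding W by (rule homeomorphic_maps_imp_map)
    from homeomorphic_map_compose[OF this chart_homeo[OF X[OF i] U]]
    show ?thesis unfolding im by (simp only: e)
  qed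
  ultimately show "case w of (U, c) \<Rightarrow> openin (mfd_top (coprod_mfd I X)) U \<and> open (c ` U) \<and>
      homeomorphic_map (subtopology (mfd_top (coprod_mfd I X)) U) (top_of_set (c ` U)) c"
    using oW by (simp add: we W)
  have "smooth_on (e' \<circ> inv_into W e) (e ` (W \<inter> W'))" if w': "(W', e') \<in> atlas (coprod_mfd I X)" for W' e'
  proof -
    from w' obtain j V d where W': "W' = {j} \<times> V" and e': "e' = d \<circ> snd" and
      j: "j \<in> I" and V: "(V, d) \<in> atlas (X j)"
      by (rule atlas_coprod_mfdE)
    show ?thesis
    proof (cases "i = j")
      case True
      with V have V: "(V, d) \<in> atlas (X i)" by simp
      have im: "e ` (W \<inter> W') = c ` (U \<inter> V)" using True by (force simp: W e W')
      have "open (c ` (U \<inter> V))"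
        using chart_image_open[OF X[OF i] U] oU chart_openin[OF X[OF i] V] by (simp add: openin_Int)
      then show ?thesis unfolding im
        by (rule smooth_on_cong[OF transition_smooth[OF X[OF i] U V]])
          (auto simp: W e e' inv_into_component chart_inj[OF X[OF i] U])
    next
      case False
      then have "W \<inter> W' = {}" by (auto simp: W W')
      then show ?thesis by (simp add: smooth_on_empty)
    qed
  qed
  then show "case w of (U, c) \<Rightarrow> \<forall>(V, d)\<in>atlas (coprod_mfd I X). smooth_on (d \<circ> inv_into U c) (c ` (U \<inter> V))"
    by (auto simp: we)
qed

lemma smooth_map_coprod:
  fixes X :: "'i \<Rightarrow> ('a, 'e::fin_dim_inner) manifold"
  assumes X: "\<And>i. i \<in> I \<Longrightarrow> smooth_manifold (X i)" and N: "smooth_manifold N"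
    and f: "\<And>i. i \<in> I \<Longrightarrow> smooth_map (X i) N (\<lambda>x. f (i, x))"
  shows "smooth_map (coprod_mfd I X) N f"
proof -
  have "smooth_on (d \<circ> f \<circ> inv_into ({i} \<times> U) (c \<circ> snd)) ((c \<circ> snd) ` ({i} \<times> U \<inter> f -` V))"
    if i: "i \<in> I" and U: "(U, c) \<in> atlas (X i)" and V: "(V, d) \<in> atlas N" for i U c V d
  proof -
    have im: "(c \<circ> snd) ` ({i} \<times> U \<inter> f -` V) = c ` (U \<inter> (\<lambda>x. f (i, x)) -` V)" by force
    have "open (c ` (U \<inter> (\<lambda>x. f (i, x)) -` V))"
      by (rule chart_image_open[OF X[OF i] U openin_preimage[OF smooth_map_continuous[OF f[OF i]]]])
        (auto intro: chart_openin X i N U V)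
    then show ?thesis unfolding im
      by (rule smooth_on_cong[OF smooth_mapD[OF f[OF i] U V]])
        (auto simp: inv_into_component chart_inj[OF X[OF i] U])
  qed
  moreover have "continuous_map (sum_topology (\<lambda>i. mfd_top (X i)) I) (mfd_top N) f"
  proof -
    have "openin (mfd_top (X i)) {x. (i, x) \<in> {z \<in> topspace (sum_topology (\<lambda>i. mfd_top (X i)) I). f z \<in> V}}"
      if "i \<in> I" "openin (mfd_top N) V" for i V
      using openin_continuous_map_preimage[OF smooth_map_continuous[OF f] that(2), of i] that(1) by simp
    then show ?thesis
      using smooth_map_funcset[OF f] by (auto simp: continuous_map_def openin_sum_topology)
  qed
  ultimately show ?thesis
    by (auto simp: smooth_map_def elim!: atlas_coprod_mfdE)
qed

lemma smooth_map_injection: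
  assumes i: "i \<in> I" and X: "smooth_manifold (X i)"
  shows "smooth_map (X i) (coprod_mfd I X) (Pair i)"
proof -
  have "smooth_on ((d \<circ> snd) \<circ> Pair i \<circ> inv_into U c) (c ` (U \<inter> Pair i -` ({j} \<times> V)))"
    if U: "(U, c) \<in> atlas (X i)" and V: "(V, d) \<in> atlas (X j)" for U c j V d
  proof (cases "i = j")
    case True
    then have "U \<inter> Pair i -` ({j} \<times> V) = U \<inter> V" by auto
    then show ?thesis using transition_smooth[OF X U, of V d] V True by (simp add: o_def)
  next
    case False
    then have "U \<inter> Pair i -` ({j} \<times> V) = {}" by auto
    then show ?thesis by (simp add: smooth_on_empty)
  qed
  then show ?thesis
    using continuous_map_component_injection[OF i, of "\<lambda>i. mfd_top (X i)"]
    by (auto simp: smooth_map_def elim!: atlas_coprod_mfdE)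
qed

subsection \<open>Submersions, diffeomorphisms and maps on subsets\<close>

lemma smooth_map_imp_smooth_map_on:
  assumes "smooth_manifold M" "smooth_manifold N" "A \<subseteq> points M" "smooth_map M N f"
  shows "smooth_map_on A M N f"
  unfolding smooth_map_on_def
  using assms by (intro ballI exI[of _ "points M"] exI[of _ f]) (auto intro: smooth_map_restrict)

text \<open>Near each point, \<open>f\<close> may be replaced by a local smooth extension, because
  \<open>g\<close> takes its values in \<open>A\<close>. This converts the products and actions,
  smooth on fibre products only, into smooth maps between manifolds.\<close>

lemma smooth_map_on_compose:
  assumes L: "smooth_manifold L" and M: "smooth_manifold M" and N: "smooth_manifold N"
    and f: "smooth_map_on A M N f" and g: "smooth_map L M g" and gA: "g ` points L \<subseteq> A"
  shows "smooth_map L N (\<lambda>x. f (g x))"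
proof (rule smooth_map_local[OF L N])
  fix p assume p: "p \<in> points L"
  with gA have "g p \<in> A" by auto
  with f[unfolded smooth_map_on_def] obtain W F where W: "openin (mfd_top M) W" "g p \<in> W" and
    F: "smooth_map (open_submfd M W) N F" "\<forall>x\<in>A \<inter> W. F x = f x"
    by metis
  define V where "V = points L \<inter> g -` W"
  have V: "openin (mfd_top L) V"
    unfolding V_def by (rule openin_preimage[OF smooth_map_continuous[OF g] openin_topspace W(1)])
  note LV = smooth_manifold_open_submfd[OF L V] and MW = smooth_manifold_open_submfd[OF M W(1)]
  have "smooth_map (open_submfd L V) (open_submfd M W) g"
    by (rule smooth_map_into_open_submfd[OF smooth_map_restrict[OF L M V g]]) (auto simp: V_def)
  from smooth_map_compose[OF LV MW N this F(1)]
  have "smooth_map (open_submfd L V) N (\<lambda>x. f (g x))"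
    by (rule smooth_map_cong[OF LV N]) (use F(2) gA in \<open>auto simp: V_def\<close>)
  with p V W(2) show "\<exists>W. openin (mfd_top L) W \<and> p \<in> W \<and> smooth_map (open_submfd L W) N (\<lambda>x. f (g x))"
    by (auto simp: V_def)
qed

text \<open>The derivative of a local section is a right inverse of the derivative.\<close>

lemma surjective_submersion_sections:
  fixes M :: "('a, 'e::fin_dim_inner) manifold" and N :: "('b, 'f::fin_dim_inner) manifold"
  assumes M: "smooth_manifold M" and N: "smooth_manifold N"
    and f: "smooth_map M N f" and onto: "f ` points M = points N"
    and sec: "\<And>p. p \<in> points M \<Longrightarrow> \<exists>W s. openin (mfd_top N) W \<and> f p \<in> W \<and>
      smooth_map (open_submfd N W) M s \<and> s (f p) = p \<and> (\<forall>y\<in>W. f (s y) = y)"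
  shows "surjective_submersion M N f"
  unfolding surjective_submersion_def
proof (intro conjI f onto ballI, clarify)
  fix U :: "'a set" and c :: "'a \<Rightarrow> 'e" and V :: "'b set" and d :: "'b \<Rightarrow> 'f" and p
  assume U: "(U, c) \<in> atlas M" and V: "(V, d) \<in> atlas N" and p: "p \<in> U" "f p \<in> V"
  have "p \<in> points M" using chart_subset[OF M U] p(1) by auto
  from sec[OF this] obtain W s where W: "openin (mfd_top N) W" "f p \<in> W"
    and s: "smooth_map (open_submfd N W) M s" "s (f p) = p" "\<And>y. y \<in> W \<Longrightarrow> f (s y) = y" by blast
  note NW = smooth_manifold_open_submfd[OF N W(1)]
  have VW: "(V \<inter> W, d) \<in> atlas (open_submfd N W)"
    using V by (auto simp: open_submfd_def image_iff intro!: bexI[of _ "(V, d)"])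
  let ?F = "d \<circ> f \<circ> inv_into U c" and ?S = "c \<circ> s \<circ> inv_into (V \<inter> W) d"
  define Y where "Y = V \<inter> W \<inter> s -` U"
  have i: "inv_into U c (c x) = x" if "x \<in> U" for x
    using chart_inj[OF M U] that by simp
  have j: "inv_into (V \<inter> W) d (d y) = y" if "y \<in> V \<inter> W" for y
    using chart_inj[OF NW VW] that by simp
  have "openin (mfd_top (open_submfd N W)) Y"
    unfolding Y_def
    by (rule openin_preimage[OF smooth_map_continuous[OF s(1)] chart_openin[OF NW VW] chart_openin[OF M U]])
  then have oY: "open (d ` Y)"
    by (rule chart_image_open[OF NW VW]) (auto simp: Y_def)
  have pY: "d (f p) \<in> d ` Y" using p W s by (auto simp: Y_def)
  have S: "(?S has_derivative frechet_derivative ?S (at (d (f p)))) (at (d (f p)))"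
    by (rule smooth_on_has_derivative[OF smooth_mapD[OF s(1) VW U]]) (use pY in \<open>auto simp: Y_def\<close>)
  have Sp: "?S (d (f p)) = c p" using p W s(2) by (simp add: j)
  have "(?F has_derivative frechet_derivative ?F (at (c p))) (at (c p))"
    by (rule smooth_on_has_derivative[OF smooth_mapD[OF f U V]]) (use p in auto)
  then have F: "(?F has_derivative frechet_derivative ?F (at (c p))) (at (?S (d (f p))))"
    unfolding Sp .
  have FS: "((\<lambda>z. z) has_derivative
      frechet_derivative ?F (at (c p)) \<circ> frechet_derivative ?S (at (d (f p)))) (at (d (f p)))"
    by (rule has_derivative_transform_within_open[OF diff_chain_at[OF S F] oY pY])
      (auto simp: Y_def j i s(3))
  then have "frechet_derivative ?F (at (c p)) \<circ> frechet_derivative ?S (at (d (f p))) = (\<lambda>z. z)"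
    using has_derivative_unique has_derivative_ident by blast
  then show "surj (frechet_derivative ?F (at (c p)))"
    by (metis comp_apply surjI)
qed

text \<open>The definition speaks of \<open>inv_into\<close>; an explicit smooth inverse agrees with
  it on \<open>points N\<close>.\<close>

lemma diffeomorphismI:
  assumes M: "smooth_manifold M" and N: "smooth_manifold N"
    and f: "smooth_map M N f" and g: "smooth_map N M g"
    and gf: "\<And>x. x \<in> points M \<Longrightarrow> g (f x) = x" and fg: "\<And>y. y \<in> points N \<Longrightarrow> f (g y) = y"
  shows "diffeomorphism M N f"
  unfolding diffeomorphism_def
proof (intro conjI f)
  show b: "bij_betw f (points M) (points N)"
    by (rule bij_betw_byWitness[where f' = g])
      (auto simp: gf fg intro: smooth_map_funcset[OF f] smooth_map_funcset[OF g])
  show "smooth_map N M (inv_into (points M) f)"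
  proof (rule smooth_map_cong[OF N M g])
    fix y assume y: "y \<in> points N"
    then show "g y = inv_into (points M) f y"
      using inv_into_f_f[of f "points M" "g y"] b fg smooth_map_funcset[OF g]
      by (simp add: bij_betw_def)
  qed
qed

text \<open>Made for kernels and their fibres, which are treated as mere subsets of the arrow
  manifold: \<open>f\<close> and \<open>g\<close> are smooth on the ambient manifolds and inverse to
  each other only between \<open>A\<close> and \<open>B\<close>.\<close>

lemma diffeo_onI:
  assumes M: "smooth_manifold M" and N: "smooth_manifold N"
    and A: "A \<subseteq> points M" and B: "B \<subseteq> points N"
    and f: "smooth_map M N f" and g: "smooth_map N M g"
    and fA: "\<And>x. x \<in> A \<Longrightarrow> f x \<in> B" and gB: "\<And>y. y \<in> B \<Longrightarrow> g y \<in> A"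
    and gf: "\<And>x. x \<in> A \<Longrightarrow> g (f x) = x" and fg: "\<And>y. y \<in> B \<Longrightarrow> f (g y) = y"
  shows "diffeo_on A M B N f"
  unfolding diffeo_on_def
proof (intro conjI)
  show b: "bij_betw f A B"
    by (rule bij_betw_byWitness[where f' = g]) (auto simp: gf fg fA gB)
  show "smooth_map_on A M N f" by (rule smooth_map_imp_smooth_map_on[OF M N A f])
  have g': "smooth_map_on B N M g" by (rule smooth_map_imp_smooth_map_on[OF N M B g])
  have "g y = inv_into A f y" if "y \<in> B" for y
    using inv_into_f_f[of f A "g y"] b fg[OF that] gB[OF that] by (simp add: bij_betw_def)
  then show "smooth_map_on B N M (inv_into A f)"
    using g' unfolding smooth_map_on_def by (metis IntD1)
qed

section \<open>Crossed modules\<close>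

lemma (in group) inv_cancel_left [simp]:
  assumes "x \<in> carrier G" "y \<in> carrier G"
  shows "inv x \<otimes> (x \<otimes> y) = y" and "x \<otimes> (inv x \<otimes> y) = y"
  using assms by (simp_all flip: m_assoc)

locale lie_crossed_module =
  fixes X :: "('g, 'f::fin_dim_inner, 'h, 'k::fin_dim_inner) crossed_mod"
  assumes crossed: "crossed_module X"
begin

abbreviation G where "G \<equiv> grpG X"
abbreviation H where "H \<equiv> grpH X"
abbreviation \<rho> where "\<rho> \<equiv> rho X"
abbreviation \<alpha> where "\<alpha> \<equiv> jact X"

lemma lie_groups: "is_lie_group G" "is_lie_group H"
  using crossed by (simp_all add: crossed_module_def Let_def)

sublocale G: group G
  using lie_groups by (simp add: is_lie_group_def)

sublocale H: group H
  using lie_groups by (simp add: is_lie_group_def)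

lemma manifold_G: "smooth_manifold (mfd G)" and manifold_H: "smooth_manifold (mfd H)"
  and points_G [simp]: "points (mfd G) = carrier G" and points_H [simp]: "points (mfd H) = carrier H"
  using lie_groups by (simp_all add: is_lie_group_def)

lemma rho_hom: "\<rho> \<in> hom G H"
  using crossed by (simp add: crossed_module_def Let_def)

sublocale \<rho>: group_hom G H \<rho>
  by unfold_locales (rule rho_hom)

lemma jact_lie_aut: "h \<in> carrier H \<Longrightarrow> \<alpha> h \<in> lie_aut G"
  using crossed by (simp add: crossed_module_def Let_def)

lemma jact_group_hom: "h \<in> carrier H \<Longrightarrow> group_hom G G (\<alpha> h)"
  using jact_lie_aut[of h]
  by (intro group_hom.intro group_hom_axioms.intro G.is_group) (auto simp: lie_aut_def iso_def)

lemma jact_inj: "h \<in> carrier H \<Longrightarrow> inj_on (\<alpha> h) (carrier G)"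
  using jact_lie_aut[of h] by (auto simp: lie_aut_def iso_def bij_betw_def)

lemma jact_closed [simp]: "h \<in> carrier H \<Longrightarrow> g \<in> carrier G \<Longrightarrow> \<alpha> h g \<in> carrier G"
  using group_hom.hom_closed[OF jact_group_hom] by simp

lemma jact_mult [simp]:
  "h \<in> carrier H \<Longrightarrow> g \<in> carrier G \<Longrightarrow> g' \<in> carrier G \<Longrightarrow>
    \<alpha> h (g \<otimes>\<^bsub>G\<^esub> g') = \<alpha> h g \<otimes>\<^bsub>G\<^esub> \<alpha> h g'"
  using group_hom.hom_mult[OF jact_group_hom] by simp

lemma jact_one [simp]: "h \<in> carrier H \<Longrightarrow> \<alpha> h \<one>\<^bsub>G\<^esub> = \<one>\<^bsub>G\<^esub>"
  using group_hom.hom_one[OF jact_group_hom] by simp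

lemma jact_inv [simp]:
  "h \<in> carrier H \<Longrightarrow> g \<in> carrier G \<Longrightarrow> \<alpha> h (inv\<^bsub>G\<^esub> g) = inv\<^bsub>G\<^esub> (\<alpha> h g)"
  using group_hom.hom_inv[OF jact_group_hom] by simp

lemma jact_comp:
  "h \<in> carrier H \<Longrightarrow> h' \<in> carrier H \<Longrightarrow> g \<in> carrier G \<Longrightarrow> \<alpha> (h \<otimes>\<^bsub>H\<^esub> h') g = \<alpha> h (\<alpha> h' g)"
  using crossed by (simp add: crossed_module_def Let_def)

lemma jact_one_left [simp]: "g \<in> carrier G \<Longrightarrow> \<alpha> \<one>\<^bsub>H\<^esub> g = g"
  using jact_comp[of "\<one>\<^bsub>H\<^esub>" "\<one>\<^bsub>H\<^esub>" g] jact_inj[of "\<one>\<^bsub>H\<^esub>"] by (auto simp: inj_on_def)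

lemma jact_cancel [simp]:
  assumes "h \<in> carrier H" "g \<in> carrier G"
  shows "\<alpha> h (\<alpha> (inv\<^bsub>H\<^esub> h) g) = g" and "\<alpha> (inv\<^bsub>H\<^esub> h) (\<alpha> h g) = g"
  using assms by (simp_all flip: jact_comp)

lemma rho_jact:
  "h \<in> carrier H \<Longrightarrow> g \<in> carrier G \<Longrightarrow> \<rho> (\<alpha> h g) = h \<otimes>\<^bsub>H\<^esub> \<rho> g \<otimes>\<^bsub>H\<^esub> inv\<^bsub>H\<^esub> h"
  using crossed by (simp add: crossed_module_def Let_def)

lemma peiffer:
  "g \<in> carrier G \<Longrightarrow> g' \<in> carrier G \<Longrightarrow> \<alpha> (\<rho> g) g' = g \<otimes>\<^bsub>G\<^esub> g' \<otimes>\<^bsub>G\<^esub> inv\<^bsub>G\<^esub> g"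
  using crossed by (simp add: crossed_module_def Let_def)

lemma smooth_mult_G: "smooth_map (mfd G \<times>\<^sub>M\<^sub>f mfd G) (mfd G) (\<lambda>(x, y). x \<otimes>\<^bsub>G\<^esub> y)"
  and smooth_inv_G: "smooth_map (mfd G) (mfd G) (\<lambda>x. inv\<^bsub>G\<^esub> x)"
  and smooth_mult_H: "smooth_map (mfd H \<times>\<^sub>M\<^sub>f mfd H) (mfd H) (\<lambda>(x, y). x \<otimes>\<^bsub>H\<^esub> y)"
  and smooth_inv_H: "smooth_map (mfd H) (mfd H) (\<lambda>x. inv\<^bsub>H\<^esub> x)"
  using lie_groups by (simp_all add: is_lie_group_def)

lemma smooth_rho: "smooth_map (mfd G) (mfd H) \<rho>"
  and smooth_jact: "smooth_map (mfd H \<times>\<^sub>M\<^sub>f mfd G) (mfd G) (\<lambda>(h, g). \<alpha> h g)"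
  using crossed by (simp_all add: crossed_module_def Let_def)

lemma smooth_map_compose2:
  assumes "smooth_manifold L" "smooth_manifold M" "smooth_manifold N" "smooth_manifold P"
    and "smooth_map (M \<times>\<^sub>M\<^sub>f N) P (\<lambda>(x, y). F x y)" "smooth_map L M a" "smooth_map L N b"
  shows "smooth_map L P (\<lambda>x. F (a x) (b x))"
  using smooth_map_compose[OF assms(1) smooth_manifold_prod[OF assms(2,3)] assms(4)
      smooth_map_Pair[OF assms(1-3,6,7)] assms(5)] by simp

lemma smooth_ops:
  assumes "smooth_manifold L"
  shows smooth_mult_G': "smooth_map L (mfd G) a \<Longrightarrow> smooth_map L (mfd G) b \<Longrightarrow>
      smooth_map L (mfd G) (\<lambda>x. a x \<otimes>\<^bsub>G\<^esub> b x)"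
    and smooth_inv_G': "smooth_map L (mfd G) a \<Longrightarrow> smooth_map L (mfd G) (\<lambda>x. inv\<^bsub>G\<^esub> (a x))"
    and smooth_mult_H': "smooth_map L (mfd H) c \<Longrightarrow> smooth_map L (mfd H) d \<Longrightarrow>
      smooth_map L (mfd H) (\<lambda>x. c x \<otimes>\<^bsub>H\<^esub> d x)"
    and smooth_inv_H': "smooth_map L (mfd H) c \<Longrightarrow> smooth_map L (mfd H) (\<lambda>x. inv\<^bsub>H\<^esub> (c x))"
    and smooth_rho': "smooth_map L (mfd G) a \<Longrightarrow> smooth_map L (mfd H) (\<lambda>x. \<rho> (a x))"
    and smooth_jact': "smooth_map L (mfd H) c \<Longrightarrow> smooth_map L (mfd G) a \<Longrightarrow>
      smooth_map L (mfd G) (\<lambda>x. \<alpha> (c x) (a x))"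
    and smooth_one_G: "smooth_map L (mfd G) (\<lambda>x. \<one>\<^bsub>G\<^esub>)"
    and smooth_one_H: "smooth_map L (mfd H) (\<lambda>x. \<one>\<^bsub>H\<^esub>)"
  using assms manifold_G manifold_H
  by (auto intro: smooth_map_compose2[OF _ _ _ _ smooth_mult_G] smooth_map_compose2[OF _ _ _ _ smooth_mult_H]
      smooth_map_compose2[OF _ _ _ _ smooth_jact] smooth_map_compose[OF _ _ _ _ smooth_inv_G]
      smooth_map_compose[OF _ _ _ _ smooth_inv_H] smooth_map_compose[OF _ _ _ _ smooth_rho]
      smooth_map_const)

end

section \<open>Covers\<close>

locale crossed_cover = lie_crossed_module X
  for X :: "('g, 'f::fin_dim_inner, 'h, 'k::fin_dim_inner) crossed_mod" +
  fixes N :: "('n, 'e::fin_dim_inner) manifold" and I :: "'i set" and U :: "'i \<Rightarrow> 'n set"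
  assumes manifold_N: "smooth_manifold N" and cover: "open_cover N I U"
begin

abbreviation "C1 \<equiv> cover1 N I U"
abbreviation "C2 \<equiv> cover2 N I U"
abbreviation "C3 \<equiv> cover3 N I U"

lemma open_U: "i \<in> I \<Longrightarrow> openin (mfd_top N) (U i)"
  using cover by (simp add: open_cover_def)

lemma U_subset: "i \<in> I \<Longrightarrow> x \<in> U i \<Longrightarrow> x \<in> points N"
  using openin_subset[OF open_U] by auto

lemma points_C1: "points C1 = {(i, x). i \<in> I \<and> x \<in> U i}"
  and points_C2: "points C2 = {((i, j), x). i \<in> I \<and> j \<in> I \<and> x \<in> U i \<and> x \<in> U j}"
  and points_C3: "points C3 = {((i, j, k), x). i \<in> I \<and> j \<in> I \<and> k \<in> I \<and> x \<in> U i \<and> x \<in> U j \<and> x \<in> U k}"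
  by (auto simp: cover1_def cover2_def cover3_def U_subset)

lemma manifold_U1: "i \<in> I \<Longrightarrow> smooth_manifold (open_submfd N (U i))"
  and manifold_U2: "i \<in> I \<Longrightarrow> j \<in> I \<Longrightarrow> smooth_manifold (open_submfd N (U i \<inter> U j))"
  and manifold_U3: "i \<in> I \<Longrightarrow> j \<in> I \<Longrightarrow> k \<in> I \<Longrightarrow> smooth_manifold (open_submfd N (U i \<inter> U j \<inter> U k))"
  by (intro smooth_manifold_open_submfd manifold_N openin_Int open_U; assumption)+

lemma manifold_C1: "smooth_manifold C1"
  and manifold_C2: "smooth_manifold C2"
  and manifold_C3: "smooth_manifold C3"
  unfolding cover1_def cover2_def cover3_def
  by (auto intro!: smooth_manifold_coprod manifold_U1 manifold_U2 manifold_U3)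

text \<open>With a constant index, smoothness is a matter of the base point alone: the map factors
  through the open submanifold \<open>U i\<close> and the injection of that component.\<close>

lemma smooth_into_C1:
  assumes "smooth_manifold L" "i \<in> I" "smooth_map L N f" "\<And>p. p \<in> points L \<Longrightarrow> f p \<in> U i"
  shows "smooth_map L C1 (\<lambda>p. (i, f p))"
  using smooth_map_compose[OF assms(1) manifold_U1[OF assms(2)] manifold_C1
      smooth_map_into_open_submfd[OF assms(3,4)]
      smooth_map_injection[of i I "\<lambda>i. open_submfd N (U i)", folded cover1_def]] assms(2)
  by (simp add: manifold_U1)

lemma smooth_into_C2:
  assumes "smooth_manifold L" "i \<in> I" "j \<in> I" "smooth_map L N f"
    and "\<And>p. p \<in> points L \<Longrightarrow> f p \<in> U i \<inter> U j"
  shows "smooth_map L C2 (\<lambda>p. ((i, j), f p))"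
  using smooth_map_compose[OF assms(1) manifold_U2[OF assms(2,3)] manifold_C2
      smooth_map_into_open_submfd[OF assms(4,5)]]
    smooth_map_injection[of "(i, j)" "I \<times> I" "\<lambda>(i, j). open_submfd N (U i \<inter> U j)", folded cover2_def]
    assms(2,3)
  by (simp add: manifold_U2)

lemma smooth_into_C3:
  assumes "smooth_manifold L" "i \<in> I" "j \<in> I" "k \<in> I" "smooth_map L N f"
    and "\<And>p. p \<in> points L \<Longrightarrow> f p \<in> U i \<inter> U j \<inter> U k"
  shows "smooth_map L C3 (\<lambda>p. ((i, j, k), f p))"
  using smooth_map_compose[OF assms(1) manifold_U3[OF assms(2-4)] manifold_C3
      smooth_map_into_open_submfd[OF assms(5,6)]]
    smooth_map_injection[of "(i, j, k)" "I \<times> I \<times> I" "\<lambda>(i, j, k). open_submfd N (U i \<inter> U j \<inter> U k)",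
      folded cover3_def]
    assms(2-4)
  by (simp add: manifold_U3)

lemma smooth_from_C1:
  assumes "smooth_manifold M" "\<And>i. i \<in> I \<Longrightarrow> smooth_map (open_submfd N (U i)) M (\<lambda>x. f (i, x))"
  shows "smooth_map C1 M f"
  unfolding cover1_def by (rule smooth_map_coprod) (auto intro: manifold_U1 assms)

lemma smooth_from_C2:
  assumes "smooth_manifold M"
    and "\<And>i j. i \<in> I \<Longrightarrow> j \<in> I \<Longrightarrow> smooth_map (open_submfd N (U i \<inter> U j)) M (\<lambda>x. f ((i, j), x))"
  shows "smooth_map C2 M f"
  unfolding cover2_def by (rule smooth_map_coprod) (auto intro: manifold_U2 assms)

lemma smooth_from_C3:
  assumes "smooth_manifold M"
    and "\<And>i j k. i \<in> I \<Longrightarrow> j \<in> I \<Longrightarrow> k \<in> I \<Longrightarrow>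
      smooth_map (open_submfd N (U i \<inter> U j \<inter> U k)) M (\<lambda>x. f ((i, j, k), x))"
  shows "smooth_map C3 M f"
  unfolding cover3_def by (rule smooth_map_coprod) (auto intro: manifold_U3 assms)

lemma smooth_inclusion_U:
  "i \<in> I \<Longrightarrow> smooth_map (open_submfd N (U i)) N (\<lambda>x. x)"
  "i \<in> I \<Longrightarrow> j \<in> I \<Longrightarrow> smooth_map (open_submfd N (U i \<inter> U j)) N (\<lambda>x. x)"
  "i \<in> I \<Longrightarrow> j \<in> I \<Longrightarrow> k \<in> I \<Longrightarrow> smooth_map (open_submfd N (U i \<inter> U j \<inter> U k)) N (\<lambda>x. x)"
  by (intro smooth_map_inclusion manifold_N openin_Int open_U; assumption)+

lemma smooth_snd_C2: "smooth_map C2 N snd"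
  by (rule smooth_from_C2[OF manifold_N]) (simp add: smooth_inclusion_U)

lemma smooth_snd_C1: "smooth_map C1 N snd"
  by (rule smooth_from_C1[OF manifold_N]) (simp add: smooth_inclusion_U)

text \<open>These are structure maps of the nerve of the Cech groupoid: source, target, unit,
  inverse and two faces. The map \<open>loop2\<close> produces the triple that occurs when an arrow
  is multiplied by its inverse.\<close>

definition "fst2 = (\<lambda>((i, j), x). (i, x))"
definition "snd2 = (\<lambda>((i, j), x). (j, x))"
definition "diag1 = (\<lambda>(i, x). ((i, i), x))"
definition "swap2 = (\<lambda>((i, j), x). ((j, i), x))"
definition "loop2 = (\<lambda>((i, j), x). ((i, j, i), x))"
definition "face12 = (\<lambda>((i, j, k), x). ((i, j), x))"
definition "face23 = (\<lambda>((i, j, k), x). ((j, k), x))"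

lemmas nerve_defs = fst2_def snd2_def diag1_def swap2_def loop2_def face12_def face23_def

lemma nerve_simps [simp]:
  "fst2 ((i, k), x) = (i, x)" "snd2 ((i, k), x) = (k, x)" "diag1 (i, x) = ((i, i), x)"
  "swap2 ((i, k), x) = ((k, i), x)" "loop2 ((i, k), x) = ((i, k, i), x)"
  "face12 ((i, k, l), x) = ((i, k), x)" "face23 ((i, k, l), x) = ((k, l), x)"
  by (simp_all add: nerve_defs)

text \<open>On each component the indices are constant and the base point is kept, so every one of
  these maps is locally an inclusion of overlaps.\<close>

lemma smooth_nerve:
  shows smooth_fst2: "smooth_map C2 C1 fst2"
    and smooth_snd2: "smooth_map C2 C1 snd2"
    and smooth_diag1: "smooth_map C1 C2 diag1"
    and smooth_swap2: "smooth_map C2 C2 swap2"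
    and smooth_loop2: "smooth_map C2 C3 loop2"
    and smooth_face12: "smooth_map C3 C2 face12"
    and smooth_face23: "smooth_map C3 C2 face23"
  unfolding nerve_defs
  by (rule smooth_from_C1 smooth_from_C2 smooth_from_C3, (rule manifold_C1 manifold_C2 manifold_C3),
      simp, (rule smooth_into_C1 smooth_into_C2 smooth_into_C3),
      auto intro: manifold_U1 manifold_U2 manifold_U3 smooth_inclusion_U)+

section \<open>Cohomologous cocycles\<close>

lemma cohomologous_iff:
  "((L, \<g>), (L', \<g>')) \<in> cohomologous X N I U \<longleftrightarrow>
    (L, \<g>) \<in> cocycles X N I U \<and> (L', \<g>') \<in> cocycles X N I U \<and>
    (\<exists>r v. smooth_map C1 (mfd H) r \<and> smooth_map C2 (mfd G) v \<and>
      (\<forall>i\<in>I. \<forall>k\<in>I. \<forall>x\<in>U i \<inter> U k.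
         L' ((i, k), x) =
         \<rho> (v ((i, k), x)) \<otimes>\<^bsub>H\<^esub> r (i, x) \<otimes>\<^bsub>H\<^esub> L ((i, k), x) \<otimes>\<^bsub>H\<^esub> inv\<^bsub>H\<^esub> (r (k, x))) \<and>
      (\<forall>i\<in>I. \<forall>k\<in>I. \<forall>l\<in>I. \<forall>x\<in>U i \<inter> U k \<inter> U l.
         \<g>' ((i, k, l), x) \<otimes>\<^bsub>G\<^esub> v ((i, l), x) =
         \<alpha> (L' ((i, k), x)) (v ((k, l), x)) \<otimes>\<^bsub>G\<^esub> v ((i, k), x)
           \<otimes>\<^bsub>G\<^esub> \<alpha> (r (i, x)) (\<g> ((i, k, l), x))))"
  by (simp add: cohomologous_def Let_def)

lemma C1_closed: "smooth_map C1 M r \<Longrightarrow> i \<in> I \<Longrightarrow> x \<in> U i \<Longrightarrow> r (i, x) \<in> points M"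
  using smooth_map_funcset[of C1 M r "(i, x)"] by (simp add: points_C1)

lemma C2_closed:
  "smooth_map C2 M v \<Longrightarrow> i \<in> I \<Longrightarrow> k \<in> I \<Longrightarrow> x \<in> U i \<Longrightarrow> x \<in> U k \<Longrightarrow> v ((i, k), x) \<in> points M"
  using smooth_map_funcset[of C2 M v "((i, k), x)"] by (simp add: points_C2)

lemma C3_closed:
  "smooth_map C3 M v \<Longrightarrow> i \<in> I \<Longrightarrow> k \<in> I \<Longrightarrow> l \<in> I \<Longrightarrow> x \<in> U i \<Longrightarrow> x \<in> U k \<Longrightarrow> x \<in> U l \<Longrightarrow>
    v ((i, k, l), x) \<in> points M"
  using smooth_map_funcset[of C3 M v "((i, k, l), x)"] by (simp add: points_C3)

lemmas cover_closed = C1_closed[of "mfd G"] C1_closed[of "mfd H"] C2_closed[of "mfd G"]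
  C2_closed[of "mfd H"] C3_closed[of "mfd G"]

lemma cocycles_smooth:
  assumes "(L, \<g>) \<in> cocycles X N I U"
  shows "smooth_map C2 (mfd H) L" "smooth_map C3 (mfd G) \<g>"
  using assms by (auto simp: cocycles_def Let_def)

text \<open>The Peiffer identity in the form used throughout: an element \<open>g\<close> is moved
  across an action, which absorbs or releases \<open>\<rho> g\<close>.\<close>

lemma jact_rho_mult:
  assumes "g \<in> carrier G" "h \<in> carrier H" "a \<in> carrier G"
  shows "\<alpha> (\<rho> g \<otimes>\<^bsub>H\<^esub> h) a \<otimes>\<^bsub>G\<^esub> g = g \<otimes>\<^bsub>G\<^esub> \<alpha> h a"
  using assms by (simp add: jact_comp peiffer G.m_assoc)

text \<open>Pointwise symmetry: the coboundary \<open>(r, v)\<close> is undone by the one with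
  components \<open>inv r_i\<close> and \<open>(inv r_i)(inv v_ik)\<close>. Here \<open>r, s\<close>
  stand for \<open>r_i, r_k\<close> and \<open>u, v, w\<close> for
  \<open>v_ik, v_kl, v_il\<close>.\<close>

lemma coboundary_inverse:
  assumes c: "L \<in> carrier H" "r \<in> carrier H" "s \<in> carrier H" "u \<in> carrier G" "v \<in> carrier G"
    "w \<in> carrier G" "g \<in> carrier G" "g' \<in> carrier G"
    and L': "L' = \<rho> u \<otimes>\<^bsub>H\<^esub> r \<otimes>\<^bsub>H\<^esub> L \<otimes>\<^bsub>H\<^esub> inv\<^bsub>H\<^esub> s"
    and g': "g' \<otimes>\<^bsub>G\<^esub> w = \<alpha> L' v \<otimes>\<^bsub>G\<^esub> u \<otimes>\<^bsub>G\<^esub> \<alpha> r g"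
  shows "g \<otimes>\<^bsub>G\<^esub> \<alpha> (inv\<^bsub>H\<^esub> r) (inv\<^bsub>G\<^esub> w) =
      \<alpha> L (\<alpha> (inv\<^bsub>H\<^esub> s) (inv\<^bsub>G\<^esub> v)) \<otimes>\<^bsub>G\<^esub> \<alpha> (inv\<^bsub>H\<^esub> r) (inv\<^bsub>G\<^esub> u) \<otimes>\<^bsub>G\<^esub> \<alpha> (inv\<^bsub>H\<^esub> r) g'"
proof -
  have "\<alpha> L' v \<otimes>\<^bsub>G\<^esub> u = u \<otimes>\<^bsub>G\<^esub> \<alpha> r (\<alpha> L (\<alpha> (inv\<^bsub>H\<^esub> s) v))"
    using c jact_rho_mult[of u "r \<otimes>\<^bsub>H\<^esub> L \<otimes>\<^bsub>H\<^esub> inv\<^bsub>H\<^esub> s" v] by (simp add: L' H.m_assoc jact_comp)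
  with g' have "\<alpha> (inv\<^bsub>H\<^esub> r) (g' \<otimes>\<^bsub>G\<^esub> w) = \<alpha> (inv\<^bsub>H\<^esub> r) (u \<otimes>\<^bsub>G\<^esub> \<alpha> r (\<alpha> L (\<alpha> (inv\<^bsub>H\<^esub> s) v)) \<otimes>\<^bsub>G\<^esub> \<alpha> r g)"
    by simp
  then have e: "\<alpha> (inv\<^bsub>H\<^esub> r) g' \<otimes>\<^bsub>G\<^esub> \<alpha> (inv\<^bsub>H\<^esub> r) w =
      \<alpha> (inv\<^bsub>H\<^esub> r) u \<otimes>\<^bsub>G\<^esub> (\<alpha> L (\<alpha> (inv\<^bsub>H\<^esub> s) v) \<otimes>\<^bsub>G\<^esub> g)"
    using c by (simp add: G.m_assoc)
  then have "\<alpha> (inv\<^bsub>H\<^esub> r) g' = \<alpha> (inv\<^bsub>H\<^esub> r) u \<otimes>\<^bsub>G\<^esub> (\<alpha> L (\<alpha> (inv\<^bsub>H\<^esub> s) v) \<otimes>\<^bsub>G\<^esub> g) \<otimes>\<^bsub>G\<^esub> inv\<^bsub>G\<^esub> (\<alpha> (inv\<^bsub>H\<^esub> r) w)"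
    using c by (intro G.inv_solve_right[THEN iffD2]) auto
  then show "g \<otimes>\<^bsub>G\<^esub> \<alpha> (inv\<^bsub>H\<^esub> r) (inv\<^bsub>G\<^esub> w) =
      \<alpha> L (\<alpha> (inv\<^bsub>H\<^esub> s) (inv\<^bsub>G\<^esub> v)) \<otimes>\<^bsub>G\<^esub> \<alpha> (inv\<^bsub>H\<^esub> r) (inv\<^bsub>G\<^esub> u) \<otimes>\<^bsub>G\<^esub> \<alpha> (inv\<^bsub>H\<^esub> r) g'"
    using c by (simp add: G.m_assoc)
qed

text \<open>Pointwise transitivity: \<open>(r, v)\<close> followed by \<open>(r', v')\<close> is the
  coboundary with components \<open>r'_i r_i\<close> and \<open>v'_ik r'_i(v_ik)\<close>. The
  letters are those of \<open>coboundary_inverse\<close>.\<close>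

lemma coboundary_product:
  assumes c: "L \<in> carrier H" "L' \<in> carrier H" "r \<in> carrier H" "s \<in> carrier H" "r' \<in> carrier H" "s' \<in> carrier H"
    "u \<in> carrier G" "v \<in> carrier G" "w \<in> carrier G" "u' \<in> carrier G" "v' \<in> carrier G"
    "w' \<in> carrier G" "g \<in> carrier G" "g' \<in> carrier G" "g'' \<in> carrier G"
    and L': "L' = \<rho> u \<otimes>\<^bsub>H\<^esub> r \<otimes>\<^bsub>H\<^esub> L \<otimes>\<^bsub>H\<^esub> inv\<^bsub>H\<^esub> s"
    and g': "g' \<otimes>\<^bsub>G\<^esub> w = \<alpha> L' v \<otimes>\<^bsub>G\<^esub> u \<otimes>\<^bsub>G\<^esub> \<alpha> r g"
    and L'': "L'' = \<rho> u' \<otimes>\<^bsub>H\<^esub> r' \<otimes>\<^bsub>H\<^esub> L' \<otimes>\<^bsub>H\<^esub> inv\<^bsub>H\<^esub> s'"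
    and g'': "g'' \<otimes>\<^bsub>G\<^esub> w' = \<alpha> L'' v' \<otimes>\<^bsub>G\<^esub> u' \<otimes>\<^bsub>G\<^esub> \<alpha> r' g'"
  shows "g'' \<otimes>\<^bsub>G\<^esub> (w' \<otimes>\<^bsub>G\<^esub> \<alpha> r' w) =
      \<alpha> L'' (v' \<otimes>\<^bsub>G\<^esub> \<alpha> s' v) \<otimes>\<^bsub>G\<^esub> (u' \<otimes>\<^bsub>G\<^esub> \<alpha> r' u) \<otimes>\<^bsub>G\<^esub> \<alpha> (r' \<otimes>\<^bsub>H\<^esub> r) g"
proof -
  have cL'': "L'' \<in> carrier H" using c by (simp add: L'')
  \<comment> \<open>Since \<open>L'' s' = \<rho>(u') r' L'\<close>, this is again the Peiffer
    identity; it makes the two factors acted on by \<open>L''\<close> adjacent.\<close>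
  have e: "u' \<otimes>\<^bsub>G\<^esub> \<alpha> r' (\<alpha> L' v) = \<alpha> L'' (\<alpha> s' v) \<otimes>\<^bsub>G\<^esub> u'"
    using c jact_rho_mult[of u' "r' \<otimes>\<^bsub>H\<^esub> L'" v]
    by (simp add: L'' H.m_assoc flip: jact_comp)
  have "g'' \<otimes>\<^bsub>G\<^esub> (w' \<otimes>\<^bsub>G\<^esub> \<alpha> r' w) = (g'' \<otimes>\<^bsub>G\<^esub> w') \<otimes>\<^bsub>G\<^esub> \<alpha> r' w"
    using c by (simp add: G.m_assoc)
  also have "\<dots> = \<alpha> L'' v' \<otimes>\<^bsub>G\<^esub> u' \<otimes>\<^bsub>G\<^esub> \<alpha> r' (g' \<otimes>\<^bsub>G\<^esub> w)"
    using c cL'' by (simp add: g'' G.m_assoc)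
  also have "\<dots> = \<alpha> L'' v' \<otimes>\<^bsub>G\<^esub> (u' \<otimes>\<^bsub>G\<^esub> \<alpha> r' (\<alpha> L' v)) \<otimes>\<^bsub>G\<^esub> \<alpha> r' u \<otimes>\<^bsub>G\<^esub> \<alpha> r' (\<alpha> r g)"
    using c cL'' by (simp add: g' G.m_assoc)
  also have "\<dots> = \<alpha> L'' (v' \<otimes>\<^bsub>G\<^esub> \<alpha> s' v) \<otimes>\<^bsub>G\<^esub> (u' \<otimes>\<^bsub>G\<^esub> \<alpha> r' u) \<otimes>\<^bsub>G\<^esub> \<alpha> (r' \<otimes>\<^bsub>H\<^esub> r) g"
    unfolding e using c cL'' by (simp add: G.m_assoc jact_comp)
  finally show "g'' \<otimes>\<^bsub>G\<^esub> (w' \<otimes>\<^bsub>G\<^esub> \<alpha> r' w) =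
      \<alpha> L'' (v' \<otimes>\<^bsub>G\<^esub> \<alpha> s' v) \<otimes>\<^bsub>G\<^esub> (u' \<otimes>\<^bsub>G\<^esub> \<alpha> r' u) \<otimes>\<^bsub>G\<^esub> \<alpha> (r' \<otimes>\<^bsub>H\<^esub> r) g" .
qed

lemma smooth_fst2': "smooth_map C1 M r \<Longrightarrow> smooth_manifold M \<Longrightarrow> smooth_map C2 M (\<lambda>y. r (fst2 y))"
  by (rule smooth_map_compose[OF manifold_C2 manifold_C1 _ smooth_fst2])

section \<open>The manifolds of arrows and of bundle points of an adapted extension\<close>

lemma manifold_R: "smooth_manifold (mfd G \<times>\<^sub>M\<^sub>f C2)"
  by (rule smooth_manifold_prod[OF manifold_G manifold_C2])

lemma manifold_P: "smooth_manifold (C1 \<times>\<^sub>M\<^sub>f mfd H)"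
  by (rule smooth_manifold_prod[OF manifold_C1 manifold_H])

lemmas fst_R = smooth_map_fst[OF manifold_G manifold_C2]
  and snd_R = smooth_map_snd[OF manifold_G manifold_C2]
  and fst_P = smooth_map_fst[OF manifold_C1 manifold_H]
  and snd_P = smooth_map_snd[OF manifold_C1 manifold_H]

lemma smooth_fst_P': "smooth_map C1 M f \<Longrightarrow> smooth_manifold M \<Longrightarrow> smooth_map (C1 \<times>\<^sub>M\<^sub>f mfd H) M (\<lambda>p. f (fst p))"
  by (rule smooth_map_compose[OF manifold_P manifold_C1 _ fst_P])

lemma smooth_snd_R': "smooth_map C2 M f \<Longrightarrow> smooth_manifold M \<Longrightarrow> smooth_map (mfd G \<times>\<^sub>M\<^sub>f C2) M (\<lambda>p. f (snd p))"
  by (rule smooth_map_compose[OF manifold_R manifold_C2 _ snd_R])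

lemma equiv_cohomologous: "equiv (cocycles X N I U) (cohomologous X N I U)"
proof (rule equivI)
  show "cohomologous X N I U \<subseteq> cocycles X N I U \<times> cocycles X N I U"
    by (auto simp: cohomologous_def)
  show "refl_on (cocycles X N I U) (cohomologous X N I U)"
  proof (rule refl_onI)
    fix c assume c: "c \<in> cocycles X N I U"
    obtain L \<g> where Lg: "c = (L, \<g>)" by (cases c)
    note s = cocycles_smooth[OF c[unfolded Lg]]
    show "(c, c) \<in> cohomologous X N I U"
      unfolding Lg cohomologous_iff
      using c Lg cover_closed(4)[OF s(1)] cover_closed(5)[OF s(2)]
      by (intro conjI exI[of _ "\<lambda>_. \<one>\<^bsub>H\<^esub>"] exI[of _ "\<lambda>_. \<one>\<^bsub>G\<^esub>"])
        (auto intro: smooth_ops manifold_C1 manifold_C2)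
  qed
  show "sym (cohomologous X N I U)"
  proof (rule symI)
    fix c c' assume a: "(c, c') \<in> cohomologous X N I U"
    obtain L \<g> L' \<g>' where cc': "c = (L, \<g>)" "c' = (L', \<g>')" by (cases c, cases c')
    from a[unfolded cc' cohomologous_iff] obtain r v where
      c: "(L, \<g>) \<in> cocycles X N I U" "(L', \<g>') \<in> cocycles X N I U" and
      r: "smooth_map C1 (mfd H) r" and v: "smooth_map C2 (mfd G) v" and
      e1: "\<And>i k x. i \<in> I \<Longrightarrow> k \<in> I \<Longrightarrow> x \<in> U i \<inter> U k \<Longrightarrow> L' ((i, k), x) =
         \<rho> (v ((i, k), x)) \<otimes>\<^bsub>H\<^esub> r (i, x) \<otimes>\<^bsub>H\<^esub> L ((i, k), x) \<otimes>\<^bsub>H\<^esub> inv\<^bsub>H\<^esub> (r (k, x))" and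
      e2: "\<And>i k l x. i \<in> I \<Longrightarrow> k \<in> I \<Longrightarrow> l \<in> I \<Longrightarrow> x \<in> U i \<inter> U k \<inter> U l \<Longrightarrow>
         \<g>' ((i, k, l), x) \<otimes>\<^bsub>G\<^esub> v ((i, l), x) =
         \<alpha> (L' ((i, k), x)) (v ((k, l), x)) \<otimes>\<^bsub>G\<^esub> v ((i, k), x)
           \<otimes>\<^bsub>G\<^esub> \<alpha> (r (i, x)) (\<g> ((i, k, l), x))"
      by auto
    note s = cocycles_smooth[OF c(1)] cocycles_smooth[OF c(2)]
    note cl = cover_closed(2)[OF r] cover_closed(3)[OF v] cover_closed(4)[OF s(1)]
      cover_closed(5)[OF s(2)] cover_closed(5)[OF s(4)]
    show "(c', c) \<in> cohomologous X N I U"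
      unfolding cc' cohomologous_iff
    proof (intro conjI c exI ballI)
      show "smooth_map C1 (mfd H) (\<lambda>y. inv\<^bsub>H\<^esub> (r y))"
        by (intro smooth_ops manifold_C1 r)
      show "smooth_map C2 (mfd G) (\<lambda>y. \<alpha> (inv\<^bsub>H\<^esub> (r (fst2 y))) (inv\<^bsub>G\<^esub> (v y)))"
        by (intro smooth_ops manifold_C2 v smooth_fst2' r manifold_H)
    next
      fix i k x assume i: "i \<in> I" "k \<in> I" "x \<in> U i \<inter> U k"
      show "L ((i, k), x) =
         \<rho> (\<alpha> (inv\<^bsub>H\<^esub> (r (fst2 ((i, k), x)))) (inv\<^bsub>G\<^esub> (v ((i, k), x)))) \<otimes>\<^bsub>H\<^esub> inv\<^bsub>H\<^esub> (r (i, x)) \<otimes>\<^bsub>H\<^esub>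
         L' ((i, k), x) \<otimes>\<^bsub>H\<^esub> inv\<^bsub>H\<^esub> (inv\<^bsub>H\<^esub> (r (k, x)))"
        using i cl unfolding e1[OF i] by (simp add: rho_jact H.m_assoc H.inv_mult_group)
    next
      fix i k l x assume i: "i \<in> I" "k \<in> I" "l \<in> I" "x \<in> U i \<inter> U k \<inter> U l"
      then have i': "x \<in> U i \<inter> U k" by auto
      show "\<g> ((i, k, l), x) \<otimes>\<^bsub>G\<^esub> \<alpha> (inv\<^bsub>H\<^esub> (r (fst2 ((i, l), x)))) (inv\<^bsub>G\<^esub> (v ((i, l), x))) =
         \<alpha> (L ((i, k), x)) (\<alpha> (inv\<^bsub>H\<^esub> (r (fst2 ((k, l), x)))) (inv\<^bsub>G\<^esub> (v ((k, l), x)))) \<otimes>\<^bsub>G\<^esub>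
         \<alpha> (inv\<^bsub>H\<^esub> (r (fst2 ((i, k), x)))) (inv\<^bsub>G\<^esub> (v ((i, k), x)))
           \<otimes>\<^bsub>G\<^esub> \<alpha> (inv\<^bsub>H\<^esub> (r (i, x))) (\<g>' ((i, k, l), x))"
        unfolding nerve_simps
        by (rule coboundary_inverse[OF _ _ _ _ _ _ _ _ e1[OF i(1,2) i'] e2[OF i]])
          (use i cl in auto)
    qed
  qed
  show "trans (cohomologous X N I U)"
  proof (rule transI)
    fix c c' c'' assume a: "(c, c') \<in> cohomologous X N I U" "(c', c'') \<in> cohomologous X N I U"
    obtain L \<g> L' \<g>' L'' \<g>'' where cc': "c = (L, \<g>)" "c' = (L', \<g>')" "c'' = (L'', \<g>'')"
      by (cases c, cases c', cases c'')
    from a(1)[unfolded cc' cohomologous_iff] obtain r v where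
      c: "(L, \<g>) \<in> cocycles X N I U" "(L', \<g>') \<in> cocycles X N I U" and
      r: "smooth_map C1 (mfd H) r" and v: "smooth_map C2 (mfd G) v" and
      e1: "\<And>i k x. i \<in> I \<Longrightarrow> k \<in> I \<Longrightarrow> x \<in> U i \<inter> U k \<Longrightarrow> L' ((i, k), x) =
         \<rho> (v ((i, k), x)) \<otimes>\<^bsub>H\<^esub> r (i, x) \<otimes>\<^bsub>H\<^esub> L ((i, k), x) \<otimes>\<^bsub>H\<^esub> inv\<^bsub>H\<^esub> (r (k, x))" and
      e2: "\<And>i k l x. i \<in> I \<Longrightarrow> k \<in> I \<Longrightarrow> l \<in> I \<Longrightarrow> x \<in> U i \<inter> U k \<inter> U l \<Longrightarrow>
         \<g>' ((i, k, l), x) \<otimes>\<^bsub>G\<^esub> v ((i, l), x) =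
         \<alpha> (L' ((i, k), x)) (v ((k, l), x)) \<otimes>\<^bsub>G\<^esub> v ((i, k), x)
           \<otimes>\<^bsub>G\<^esub> \<alpha> (r (i, x)) (\<g> ((i, k, l), x))"
      by auto
    from a(2)[unfolded cc' cohomologous_iff] obtain r' v' where
      c'': "(L'', \<g>'') \<in> cocycles X N I U" and
      r': "smooth_map C1 (mfd H) r'" and v': "smooth_map C2 (mfd G) v'" and
      e1': "\<And>i k x. i \<in> I \<Longrightarrow> k \<in> I \<Longrightarrow> x \<in> U i \<inter> U k \<Longrightarrow> L'' ((i, k), x) =
         \<rho> (v' ((i, k), x)) \<otimes>\<^bsub>H\<^esub> r' (i, x) \<otimes>\<^bsub>H\<^esub> L' ((i, k), x) \<otimes>\<^bsub>H\<^esub> inv\<^bsub>H\<^esub> (r' (k, x))" and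
      e2': "\<And>i k l x. i \<in> I \<Longrightarrow> k \<in> I \<Longrightarrow> l \<in> I \<Longrightarrow> x \<in> U i \<inter> U k \<inter> U l \<Longrightarrow>
         \<g>'' ((i, k, l), x) \<otimes>\<^bsub>G\<^esub> v' ((i, l), x) =
         \<alpha> (L'' ((i, k), x)) (v' ((k, l), x)) \<otimes>\<^bsub>G\<^esub> v' ((i, k), x)
           \<otimes>\<^bsub>G\<^esub> \<alpha> (r' (i, x)) (\<g>' ((i, k, l), x))"
      by auto
    note s = cocycles_smooth[OF c(1)] cocycles_smooth[OF c(2)] cocycles_smooth[OF c'']
    note cl = cover_closed(2)[OF r] cover_closed(3)[OF v] cover_closed(2)[OF r'] cover_closed(3)[OF v']
      cover_closed(4)[OF s(1)] cover_closed(4)[OF s(3)]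
      cover_closed(5)[OF s(2)] cover_closed(5)[OF s(4)] cover_closed(5)[OF s(6)]
    show "(c, c'') \<in> cohomologous X N I U"
      unfolding cc' cohomologous_iff
    proof (intro conjI c c'' exI ballI)
      show "smooth_map C1 (mfd H) (\<lambda>y. r' y \<otimes>\<^bsub>H\<^esub> r y)"
        by (intro smooth_ops manifold_C1 r r')
      show "smooth_map C2 (mfd G) (\<lambda>y. v' y \<otimes>\<^bsub>G\<^esub> \<alpha> (r' (fst2 y)) (v y))"
        by (intro smooth_ops manifold_C2 v v' smooth_fst2' r' manifold_H)
    next
      fix i k x assume i: "i \<in> I" "k \<in> I" "x \<in> U i \<inter> U k"
      show "L'' ((i, k), x) =
         \<rho> (v' ((i, k), x) \<otimes>\<^bsub>G\<^esub> \<alpha> (r' (fst2 ((i, k), x))) (v ((i, k), x))) \<otimes>\<^bsub>H\<^esub>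
         (r' (i, x) \<otimes>\<^bsub>H\<^esub> r (i, x)) \<otimes>\<^bsub>H\<^esub> L ((i, k), x) \<otimes>\<^bsub>H\<^esub> inv\<^bsub>H\<^esub> (r' (k, x) \<otimes>\<^bsub>H\<^esub> r (k, x))"
        using i cl unfolding e1'[OF i] e1[OF i]
        by (simp add: rho_jact H.m_assoc H.inv_mult_group)
    next
      fix i k l x assume i: "i \<in> I" "k \<in> I" "l \<in> I" "x \<in> U i \<inter> U k \<inter> U l"
      then have i': "x \<in> U i \<inter> U k" by auto
      show "\<g>'' ((i, k, l), x) \<otimes>\<^bsub>G\<^esub> (v' ((i, l), x) \<otimes>\<^bsub>G\<^esub> \<alpha> (r' (fst2 ((i, l), x))) (v ((i, l), x))) =
         \<alpha> (L'' ((i, k), x)) (v' ((k, l), x) \<otimes>\<^bsub>G\<^esub> \<alpha> (r' (fst2 ((k, l), x))) (v ((k, l), x))) \<otimes>\<^bsub>G\<^esub>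
         (v' ((i, k), x) \<otimes>\<^bsub>G\<^esub> \<alpha> (r' (fst2 ((i, k), x))) (v ((i, k), x)))
           \<otimes>\<^bsub>G\<^esub> \<alpha> (r' (i, x) \<otimes>\<^bsub>H\<^esub> r (i, x)) (\<g> ((i, k, l), x))"
        unfolding nerve_simps
        by (rule coboundary_product[OF _ _ _ _ _ _ _ _ _ _ _ _ _ _ _
              e1[OF i(1,2) i'] e2[OF i] e1'[OF i(1,2) i'] e2'[OF i]])
          (use i cl in auto)
    qed
  qed
qed

end

section \<open>Local sections\<close>

text \<open>\<open>surjective_submersion\<close> is a condition on derivatives in charts. Smooth
  local sections through every point imply it and compose without any computation of
  derivatives.\<close>

definition local_sections ::
  "('a, 'e::fin_dim_inner) manifold \<Rightarrow> ('b, 'f::fin_dim_inner) manifold \<Rightarrow> ('a \<Rightarrow> 'b) \<Rightarrow> bool" where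
  "local_sections M N f \<longleftrightarrow> smooth_map M N f \<and> f ` points M = points N \<and>
    (\<forall>p\<in>points M. \<exists>W s. openin (mfd_top N) W \<and> f p \<in> W \<and>
      smooth_map (open_submfd N W) M s \<and> s (f p) = p \<and> (\<forall>y\<in>W. f (s y) = y))"

lemma local_sections_submersion:
  assumes "smooth_manifold M" "smooth_manifold N" "local_sections M N f"
  shows "surjective_submersion M N f"
  using assms(3) unfolding local_sections_def
  by (intro surjective_submersion_sections[OF assms(1,2)]) auto

lemma local_sections_compose:
  assumes M: "smooth_manifold M" and N: "smooth_manifold N" and P: "smooth_manifold P"
    and f: "local_sections M N f" and g: "local_sections N P g"
  shows "local_sections M P (\<lambda>x. g (f x))"
  unfolding local_sections_def
proof (intro conjI ballI)
  have sf: "smooth_map M N f" and sg: "smooth_map N P g"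
    using f g by (simp_all add: local_sections_def)
  show "smooth_map M P (\<lambda>x. g (f x))" by (rule smooth_map_compose[OF M N P sf sg])
  show "(\<lambda>x. g (f x)) ` points M = points P"
    using f g by (simp add: local_sections_def flip: image_image)
  fix p assume p: "p \<in> points M"
  with f obtain W s where W: "openin (mfd_top N) W" "f p \<in> W" and
    s: "smooth_map (open_submfd N W) M s" "s (f p) = p" "\<forall>y\<in>W. f (s y) = y"
    unfolding local_sections_def by meson
  from g smooth_map_funcset[OF sf p] obtain Z t where Z: "openin (mfd_top P) Z" "g (f p) \<in> Z" and
    t: "smooth_map (open_submfd P Z) N t" "t (g (f p)) = f p" "\<forall>z\<in>Z. g (t z) = z"
    unfolding local_sections_def by meson
  note mW = smooth_manifold_open_submfd[OF N W(1)] and mZ = smooth_manifold_open_submfd[OF P Z(1)]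
  have Zp: "Z \<subseteq> points P" by (rule openin_subset[OF Z(1)])
  have "openin (subtopology (mfd_top P) Z) (points (open_submfd P Z) \<inter> t -` W)"
    using openin_preimage[OF smooth_map_continuous[OF t(1)] openin_topspace W(1)] by simp
  then have Y: "openin (mfd_top P) (Z \<inter> t -` W)"
    using Z(1) Zp by (simp add: openin_open_subtopology Int_absorb1)
  \<comment> \<open>The two sections can be chained only where \<open>t\<close> lands in the domain
    of \<open>s\<close>.\<close>
  let ?Y = "Z \<inter> t -` W"
  note mY = smooth_manifold_open_submfd[OF P Y]
  have "smooth_map (open_submfd P ?Y) (open_submfd P Z) (\<lambda>x. x)"
    by (rule smooth_map_into_open_submfd[OF smooth_map_inclusion[OF P Y]]) simp
  from smooth_map_compose[OF mY mZ N this t(1)]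
  have "smooth_map (open_submfd P ?Y) (open_submfd N W) t"
    by (rule smooth_map_into_open_submfd) simp
  from smooth_map_compose[OF mY mW M this s(1)]
  have "smooth_map (open_submfd P ?Y) M (\<lambda>z. s (t z))" .
  with Y Z s t W show "\<exists>W s. openin (mfd_top P) W \<and> g (f p) \<in> W \<and>
      smooth_map (open_submfd P W) M s \<and> s (g (f p)) = p \<and> (\<forall>y\<in>W. g (f (s y)) = y)"
    by (intro exI[of _ ?Y] exI[of _ "\<lambda>z. s (t z)"]) auto
qed

lemma local_sections_fst:
  assumes M: "smooth_manifold M" and N: "smooth_manifold N" and "points N \<noteq> {}"
  shows "local_sections (M \<times>\<^sub>M\<^sub>f N) M fst"
  unfolding local_sections_def
proof (intro conjI ballI smooth_map_fst M N)
  fix p assume p: "p \<in> points (M \<times>\<^sub>M\<^sub>f N)"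
  have "smooth_map (open_submfd M (points M)) (M \<times>\<^sub>M\<^sub>f N) (\<lambda>x. (x, snd p))"
    using p by (intro smooth_map_restrict smooth_map_Pair smooth_manifold_prod M N smooth_map_id
        smooth_map_const) auto
  with p show "\<exists>W s. openin (mfd_top M) W \<and> fst p \<in> W \<and> smooth_map (open_submfd M W) (M \<times>\<^sub>M\<^sub>f N) s \<and>
      s (fst p) = p \<and> (\<forall>y\<in>W. fst (s y) = y)"
    by (intro exI[of _ "points M"] exI[of _ "\<lambda>x. (x, snd p)"]) auto
qed (use assms(3) in auto)

lemma local_sections_snd:
  assumes M: "smooth_manifold M" and N: "smooth_manifold N" and "points M \<noteq> {}"
  shows "local_sections (M \<times>\<^sub>M\<^sub>f N) N snd"
  unfolding local_sections_def
proof (intro conjI ballI smooth_map_snd M N)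
  fix p assume p: "p \<in> points (M \<times>\<^sub>M\<^sub>f N)"
  have "smooth_map (open_submfd N (points N)) (M \<times>\<^sub>M\<^sub>f N) (\<lambda>x. (fst p, x))"
    using p by (intro smooth_map_restrict smooth_map_Pair smooth_manifold_prod M N smooth_map_id
        smooth_map_const) auto
  with p show "\<exists>W s. openin (mfd_top N) W \<and> snd p \<in> W \<and> smooth_map (open_submfd N W) (M \<times>\<^sub>M\<^sub>f N) s \<and>
      s (snd p) = p \<and> (\<forall>y\<in>W. snd (s y) = y)"
    by (intro exI[of _ "points N"] exI[of _ "\<lambda>x. (fst p, x)"]) auto
qed (use assms(3) in auto)

lemma smooth_map_onI:
  assumes "\<And>p. p \<in> A \<Longrightarrow> \<exists>W. openin (mfd_top M) W \<and> p \<in> W \<and> smooth_map (open_submfd M W) N f"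
  shows "smooth_map_on A M N f"
  unfolding smooth_map_on_def using assms by blast

section \<open>The extension defined by a cocycle\<close>

context crossed_cover
begin

text \<open>Over the part \<open>U i \<inter> U k\<close> of the component \<open>i\<close>,
  reinserting the index \<open>k\<close> is a section through \<open>x_ik\<close>.\<close>

lemma local_sections_fst2: "local_sections C2 C1 fst2"
  unfolding local_sections_def
proof (intro conjI ballI smooth_fst2)
  show "fst2 ` points C2 = points C1"
    by (force simp: points_C1 points_C2 image_iff)
  fix p assume "p \<in> points C2"
  then obtain i k x where p: "p = ((i, k), x)" "i \<in> I" "k \<in> I" "x \<in> U i" "x \<in> U k"
    by (auto simp: points_C2)
  let ?W = "{i} \<times> (U i \<inter> U k)"
  have W: "openin (mfd_top C1) ?W"
    using openin_sum_component[of i I "\<lambda>i. mfd_top (open_submfd N (U i))" "U i \<inter> U k"] p(2,3)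
    by (simp add: cover1_def openin_open_subtopology open_U openin_Int)
  have "smooth_map (open_submfd C1 ?W) C2 (\<lambda>z. ((i, k), snd z))"
    by (intro smooth_into_C2 p smooth_manifold_open_submfd manifold_C1 manifold_N W smooth_map_restrict smooth_snd_C1)
      auto
  with W p show "\<exists>W s. openin (mfd_top C1) W \<and> fst2 p \<in> W \<and> smooth_map (open_submfd C1 W) C2 s \<and>
      s (fst2 p) = p \<and> (\<forall>y\<in>W. fst2 (s y) = y)"
    by (intro exI[of _ ?W] exI[of _ "\<lambda>z. ((i, k), snd z)"]) auto
qed

text \<open>The target is the source after inversion, and inversion is its own global
  section.\<close>

lemma local_sections_snd2: "local_sections C2 C1 snd2"
proof -
  have swap: "local_sections C2 C2 swap2"
    unfolding local_sections_def
  proof (intro conjI ballI smooth_swap2)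
    show "swap2 ` points C2 = points C2"
      by (force simp: points_C2 image_iff)
    have *: "swap2 (swap2 z) = z" for z :: "('i \<times> 'i) \<times> 'n"
      by (cases z) (auto simp: swap2_def)
    fix p assume p: "p \<in> points C2"
    show "\<exists>W s. openin (mfd_top C2) W \<and> swap2 p \<in> W \<and> smooth_map (open_submfd C2 W) C2 s \<and>
      s (swap2 p) = p \<and> (\<forall>y\<in>W. swap2 (s y) = y)"
      using smooth_map_funcset[OF smooth_swap2 p]
      by (intro exI[of _ "points C2"] exI[of _ swap2])
        (simp add: * smooth_map_restrict manifold_C2 smooth_swap2)
  qed
  have "(\<lambda>z :: ('i \<times> 'i) \<times> 'n. fst2 (swap2 z)) = snd2"
    by (auto simp: nerve_defs)
  with local_sections_compose[OF manifold_C2 manifold_C2 manifold_C1 swap local_sections_fst2]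
  show ?thesis by simp
qed

text \<open>On a composable pair this is the associated point of the triple overlap. It is a total
  function, taking the middle index and the base point from \<open>y\<close>, so that product
  formulas make sense near composable pairs as well.\<close>

definition "triple y y' = ((fst (fst y), snd (fst y), snd (fst y')), snd y)"
definition "face13 = (\<lambda>((i, j, k), x). ((i, k), x))"

lemma face13_simps [simp]: "face13 ((i, k, l), x) = ((i, l), x)"
  and triple_simps [simp]: "triple ((i, k), x) ((k', l), x') = ((i, k, l), x)"
  by (simp_all add: face13_def triple_def)

lemma smooth_face13: "smooth_map C3 C2 face13"
  by (rule smooth_from_C3[OF manifold_C2])
    (auto intro!: smooth_into_C2 manifold_U3 smooth_inclusion_U)

text \<open>Around a composable pair the index triple is constant and the base point of the first
  factor lies in a triple intersection, even for pairs that are not composable.\<close>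

lemma smooth_map_on_triple:
  assumes S: "smooth_manifold S" and a: "smooth_map S C2 a" and b: "smooth_map S C2 b"
    and A: "A \<subseteq> points S" "\<And>p. p \<in> A \<Longrightarrow> snd2 (a p) = fst2 (b p)"
    and f: "\<And>W. openin (mfd_top S) W \<Longrightarrow>
      smooth_map (open_submfd S W) C3 (\<lambda>p. triple (a p) (b p)) \<Longrightarrow> smooth_map (open_submfd S W) M f"
  shows "smooth_map_on A S M f"
proof (rule smooth_map_onI)
  fix p assume p: "p \<in> A"
  with A have pS: "p \<in> points S" by auto
  obtain i k x where ap: "a p = ((i, k), x)" "i \<in> I" "k \<in> I" "x \<in> U i" "x \<in> U k"
    using smooth_map_funcset[OF a pS] by (auto simp: points_C2)
  obtain k' l x' where bp: "b p = ((k', l), x')" "k' \<in> I" "l \<in> I" "x' \<in> U k'" "x' \<in> U l"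
    using smooth_map_funcset[OF b pS] by (auto simp: points_C2)
  have e: "k' = k" "x' = x" using A(2)[OF p] ap bp by auto
  let ?A = "{(i, k)} \<times> (U i \<inter> U k \<inter> U l)" and ?B = "{(k, l)} \<times> (U k \<inter> U l)"
  have oA: "openin (mfd_top C2) ?A"
    unfolding cover2_def mfd_top_coprod_mfd
    by (rule openin_sum_component)
      (use ap bp e in \<open>auto simp: openin_open_subtopology open_U openin_Int\<close>)
  have oB: "openin (mfd_top C2) ?B"
    unfolding cover2_def mfd_top_coprod_mfd
    by (rule openin_sum_component)
      (use ap bp e in \<open>auto simp: openin_open_subtopology open_U openin_Int\<close>)
  define W where "W = (points S \<inter> a -` ?A) \<inter> (points S \<inter> b -` ?B)"
  have W: "openin (mfd_top S) W"
    unfolding W_def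
    by (intro openin_Int openin_preimage[OF smooth_map_continuous[OF a] _ oA]
        openin_preimage[OF smooth_map_continuous[OF b] _ oB]) auto
  note SW = smooth_manifold_open_submfd[OF S W]
  have "smooth_map (open_submfd S W) N (\<lambda>p. snd (a p))"
    by (rule smooth_map_restrict[OF S manifold_N W smooth_map_compose[OF S manifold_C2 manifold_N a smooth_snd_C2]])
  then have "smooth_map (open_submfd S W) C3 (\<lambda>p. ((i, k, l), snd (a p)))"
    using ap bp e by (intro smooth_into_C3 SW) (auto simp: W_def)
  then have "smooth_map (open_submfd S W) C3 (\<lambda>p. triple (a p) (b p))"
    by (rule smooth_map_cong[OF SW manifold_C3]) (auto simp: W_def triple_def)
  from f[OF W this] W ap bp e pS
  show "\<exists>W. openin (mfd_top S) W \<and> p \<in> W \<and> smooth_map (open_submfd S W) M f"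
    by (intro exI[of _ W]) (simp add: W_def)
qed

section \<open>The Cech groupoid as a Lie groupoid\<close>

abbreviation "cech \<equiv> cech_groupoid N I U"

lemma cech_simps [simp]:
  "obj cech = C1" "arr cech = C2" "src cech = fst2" "tgt cech = snd2" "idt cech = diag1"
  "cmp cech y y' = face13 (triple y y')" "ginv cech = swap2"
  by (auto simp: cech_groupoid_def nerve_defs triple_def face13_def split: prod.splits)

lemma composable_cech:
  "composable cech = {(((i, k), x), ((k', l), x')). i \<in> I \<and> k \<in> I \<and> l \<in> I \<and>
    x \<in> U i \<and> x \<in> U k \<and> x \<in> U l \<and> k' = k \<and> x' = x}"
  by (auto simp: composable_def points_C2)

lemma is_lie_groupoid_cech: "is_lie_groupoid cech"
  unfolding is_lie_groupoid_def
proof (intro conjI)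
  show "smooth_map_on (composable cech) (arr cech \<times>\<^sub>M\<^sub>f arr cech) (arr cech) (\<lambda>(x, y). cmp cech x y)"
    unfolding cech_simps
    by (rule smooth_map_on_triple[OF smooth_manifold_prod[OF manifold_C2 manifold_C2]
          smooth_map_fst[OF manifold_C2 manifold_C2] smooth_map_snd[OF manifold_C2 manifold_C2]])
      (auto simp: composable_def case_prod_unfold smooth_manifold_open_submfd smooth_manifold_prod
        manifold_C2 manifold_C3 intro: smooth_map_compose[OF _ manifold_C3 manifold_C2 _ smooth_face13])
qed (auto simp: manifold_C1 manifold_C2 smooth_nerve local_sections_submersion local_sections_fst2
    local_sections_snd2 points_C1 points_C2 composable_cech)

text \<open>The formula for \<open>ginv\<close> comes from solving
  \<open>g L_ik(g') \<gamma>_iki = e\<close> for \<open>g'\<close>.\<close>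

definition cocycle_gpd ::
  "(('i \<times> 'i) \<times> 'n \<Rightarrow> 'h) \<Rightarrow> (('i \<times> 'i \<times> 'i) \<times> 'n \<Rightarrow> 'g) \<Rightarrow>
    ('g \<times> (('i \<times> 'i) \<times> 'n), 'f \<times> 'e, 'i \<times> 'n, 'e) lie_groupoid" where
  "cocycle_gpd L \<gamma> =
    \<lparr>obj = C1, arr = mfd G \<times>\<^sub>M\<^sub>f C2, src = (\<lambda>p. fst2 (snd p)), tgt = (\<lambda>p. snd2 (snd p)),
     idt = (\<lambda>m. (\<one>\<^bsub>G\<^esub>, diag1 m)),
     cmp = (\<lambda>p q. (fst p \<otimes>\<^bsub>G\<^esub> \<alpha> (L (snd p)) (fst q) \<otimes>\<^bsub>G\<^esub> \<gamma> (triple (snd p) (snd q)),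
       face13 (triple (snd p) (snd q)))),
     ginv = (\<lambda>p. (\<alpha> (inv\<^bsub>H\<^esub> (L (snd p))) (inv\<^bsub>G\<^esub> (fst p) \<otimes>\<^bsub>G\<^esub> inv\<^bsub>G\<^esub> (\<gamma> (loop2 (snd p)))),
       swap2 (snd p)))\<rparr>"

definition cocycle_ext ::
  "(('i \<times> 'i) \<times> 'n \<Rightarrow> 'h) \<Rightarrow> (('i \<times> 'i \<times> 'i) \<times> 'n \<Rightarrow> 'g) \<Rightarrow>
    ('g, 'f, 'h, 'k, 'i, 'n, 'e) cech_ext" where
  "cocycle_ext L \<gamma> =
    \<lparr>ext_gpd = cocycle_gpd L \<gamma>, ext_proj = snd, ext_bdl = C1 \<times>\<^sub>M\<^sub>f mfd H, bdl_proj = fst,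
     bdl_right = (\<lambda>p h. (fst p, snd p \<otimes>\<^bsub>H\<^esub> h)),
     bdl_left = (\<lambda>r p. (fst2 (snd r), \<rho> (fst r) \<otimes>\<^bsub>H\<^esub> L (snd r) \<otimes>\<^bsub>H\<^esub> snd p)),
     ext_chi = (\<lambda>p. (fst p, \<lambda>g\<in>carrier G. (\<alpha> (snd p) g, diag1 (fst p))))\<rparr>"

end

locale cech_cocycle = crossed_cover X N I U
  for X :: "('g, 'f::fin_dim_inner, 'h, 'k::fin_dim_inner) crossed_mod"
    and N :: "('n, 'e::fin_dim_inner) manifold" and I :: "'i set" and U :: "'i \<Rightarrow> 'n set" +
  fixes L :: "('i \<times> 'i) \<times> 'n \<Rightarrow> 'h" and \<gamma> :: "('i \<times> 'i \<times> 'i) \<times> 'n \<Rightarrow> 'g"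
  assumes cocycle: "(L, \<gamma>) \<in> cocycles X N I U"
begin

section \<open>Consequences of the cocycle equations\<close>

lemmas smooth_L = cocycles_smooth(1)[OF cocycle] and smooth_\<gamma> = cocycles_smooth(2)[OF cocycle]
lemmas L_closed [simp] = C2_closed[OF smooth_L, simplified]
lemmas \<gamma>_closed [simp] = C3_closed[OF smooth_\<gamma>, simplified]

lemma rho_\<gamma>:
  "\<lbrakk>i \<in> I; k \<in> I; l \<in> I; x \<in> U i; x \<in> U k; x \<in> U l\<rbrakk> \<Longrightarrow>
    \<rho> (\<gamma> ((i, k, l), x)) \<otimes>\<^bsub>H\<^esub> L ((i, l), x) = L ((i, k), x) \<otimes>\<^bsub>H\<^esub> L ((k, l), x)"
  using cocycle by (auto simp: cocycles_def Let_def)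

lemma \<gamma>_\<gamma>:
  "\<lbrakk>i \<in> I; k \<in> I; l \<in> I; m \<in> I; x \<in> U i; x \<in> U k; x \<in> U l; x \<in> U m\<rbrakk> \<Longrightarrow>
    \<gamma> ((i, k, l), x) \<otimes>\<^bsub>G\<^esub> \<gamma> ((i, l, m), x) =
    \<alpha> (L ((i, k), x)) (\<gamma> ((k, l, m), x)) \<otimes>\<^bsub>G\<^esub> \<gamma> ((i, k, m), x)"
  using cocycle by (auto simp: cocycles_def Let_def)

lemma \<gamma>_unit_left [simp]: "\<lbrakk>i \<in> I; k \<in> I; x \<in> U i; x \<in> U k\<rbrakk> \<Longrightarrow> \<gamma> ((i, i, k), x) = \<one>\<^bsub>G\<^esub>"
  using cocycle by (auto simp: cocycles_def Let_def)

text \<open>As \<open>\<gamma>_iii = e\<close>, the first cocycle equation at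
  \<open>(i, i, i)\<close> makes \<open>L_ii\<close> idempotent.\<close>

lemma L_unit [simp]: "i \<in> I \<Longrightarrow> x \<in> U i \<Longrightarrow> L ((i, i), x) = \<one>\<^bsub>H\<^esub>"
  using rho_\<gamma>[of i i i x] by simp

text \<open>The second cocycle equation at \<open>(i, k, k, k)\<close> makes
  \<open>\<gamma>_ikk\<close> idempotent, because \<open>\<gamma>_kkk = e\<close>.\<close>

lemma \<gamma>_unit_right [simp]: "\<lbrakk>i \<in> I; k \<in> I; x \<in> U i; x \<in> U k\<rbrakk> \<Longrightarrow> \<gamma> ((i, k, k), x) = \<one>\<^bsub>G\<^esub>"
  using \<gamma>_\<gamma>[of i k k k x] by simp

text \<open>Acting by \<open>L_ik L_kl\<close> and acting by \<open>L_il\<close> differ by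
  conjugation with \<open>\<gamma>_ikl\<close>: apply the Peiffer identity to the first cocycle
  equation. This is the defect that \<open>\<gamma>\<close> compensates in the product of the
  groupoid.\<close>

lemma L_L:
  assumes "i \<in> I" "k \<in> I" "l \<in> I" "x \<in> U i" "x \<in> U k" "x \<in> U l" "g \<in> carrier G"
  shows "\<alpha> (L ((i, k), x)) (\<alpha> (L ((k, l), x)) g) \<otimes>\<^bsub>G\<^esub> \<gamma> ((i, k, l), x) =
    \<gamma> ((i, k, l), x) \<otimes>\<^bsub>G\<^esub> \<alpha> (L ((i, l), x)) g"
  using jact_rho_mult[of "\<gamma> ((i, k, l), x)" "L ((i, l), x)" g] assms
  by (simp add: rho_\<gamma> jact_comp)

section \<open>The Lie groupoid of a cocycle\<close>

abbreviation "R \<equiv> cocycle_gpd L \<gamma>"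

lemma gpd_simps [simp]:
  "obj R = C1" "arr R = mfd G \<times>\<^sub>M\<^sub>f C2" "src R = (\<lambda>p. fst2 (snd p))" "tgt R = (\<lambda>p. snd2 (snd p))"
  "idt R = (\<lambda>m. (\<one>\<^bsub>G\<^esub>, diag1 m))"
  "cmp R p q = (fst p \<otimes>\<^bsub>G\<^esub> \<alpha> (L (snd p)) (fst q) \<otimes>\<^bsub>G\<^esub> \<gamma> (triple (snd p) (snd q)),
       face13 (triple (snd p) (snd q)))"
  "ginv R = (\<lambda>p. (\<alpha> (inv\<^bsub>H\<^esub> (L (snd p))) (inv\<^bsub>G\<^esub> (fst p) \<otimes>\<^bsub>G\<^esub> inv\<^bsub>G\<^esub> (\<gamma> (loop2 (snd p)))),
       swap2 (snd p)))"
  by (simp_all add: cocycle_gpd_def)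

lemma composable_R:
  "composable R = {((g, ((i, k), x)), (g', ((k', l), x'))). g \<in> carrier G \<and> g' \<in> carrier G \<and>
    i \<in> I \<and> k \<in> I \<and> l \<in> I \<and> x \<in> U i \<and> x \<in> U k \<and> x \<in> U l \<and> k' = k \<and> x' = x}"
  by (auto simp: composable_def points_C2)

text \<open>The factor \<open>\<gamma>\<close> is smooth on triple overlaps only, so the formula is
  extended just to neighbourhoods of composable pairs, where \<open>triple\<close> is smooth into
  \<open>C3\<close>.\<close>

lemma smooth_cmp_R:
  "smooth_map_on (composable R) (arr R \<times>\<^sub>M\<^sub>f arr R) (arr R) (\<lambda>(x, y). cmp R x y)"
proof (rule smooth_map_on_triple)
  let ?S = "arr R \<times>\<^sub>M\<^sub>f arr R"
  have mR: "smooth_manifold (arr R)" using manifold_R by simp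
  then show S: "smooth_manifold ?S" by (intro smooth_manifold_prod)
  have p1: "smooth_map ?S (arr R) fst" and p2: "smooth_map ?S (arr R) snd"
    by (intro smooth_map_fst smooth_map_snd mR)+
  have q: "smooth_map (arr R) (mfd G) fst" "smooth_map (arr R) C2 snd"
    using fst_R snd_R by simp_all
  show a: "smooth_map ?S C2 (\<lambda>p. snd (fst p))"
    by (rule smooth_map_compose[OF S mR manifold_C2 p1 q(2)])
  show b: "smooth_map ?S C2 (\<lambda>p. snd (snd p))"
    by (rule smooth_map_compose[OF S mR manifold_C2 p2 q(2)])
  show "composable R \<subseteq> points ?S" "\<And>p. p \<in> composable R \<Longrightarrow> snd2 (snd (fst p)) = fst2 (snd (snd p))"
    by (auto simp: composable_def)
  fix W assume W: "openin (mfd_top ?S) W"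
    and t: "smooth_map (open_submfd ?S W) C3 (\<lambda>p. triple (snd (fst p)) (snd (snd p)))"
  note SW = smooth_manifold_open_submfd[OF S W]
  have "smooth_map (open_submfd ?S W) (mfd G \<times>\<^sub>M\<^sub>f C2)
     (\<lambda>p. (fst (fst p) \<otimes>\<^bsub>G\<^esub> \<alpha> (L (snd (fst p))) (fst (snd p)) \<otimes>\<^bsub>G\<^esub> \<gamma> (triple (snd (fst p)) (snd (snd p))),
       face13 (triple (snd (fst p)) (snd (snd p)))))"
    by (intro smooth_map_Pair smooth_mult_G' smooth_jact' SW manifold_G manifold_C2
        smooth_map_compose[OF SW manifold_C3 manifold_G t smooth_\<gamma>]
        smooth_map_compose[OF SW manifold_C3 manifold_C2 t smooth_face13]
        smooth_map_restrict[OF S _ W] smooth_map_compose[OF S mR manifold_G p1 q(1)] manifold_H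
        smooth_map_compose[OF S mR manifold_G p2 q(1)]
        smooth_map_compose[OF S manifold_C2 manifold_H a smooth_L])
  then show "smooth_map (open_submfd ?S W) (arr R) (\<lambda>(x, y). cmp R x y)"
    by (simp add: case_prod_unfold)
qed

lemma smooth_ginv_R: "smooth_map (arr R) (arr R) (ginv R)"
proof -
  have "smooth_map (mfd G \<times>\<^sub>M\<^sub>f C2) (mfd G \<times>\<^sub>M\<^sub>f C2)
    (\<lambda>p. (\<alpha> (inv\<^bsub>H\<^esub> (L (snd p))) (inv\<^bsub>G\<^esub> (fst p) \<otimes>\<^bsub>G\<^esub> inv\<^bsub>G\<^esub> (\<gamma> (loop2 (snd p)))), swap2 (snd p)))"
    by (intro smooth_map_Pair smooth_ops manifold_R manifold_G manifold_C2 fst_R manifold_H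
        smooth_snd_R'[OF smooth_L] smooth_snd_R'[OF smooth_swap2]
        smooth_snd_R'[OF smooth_map_compose[OF manifold_C2 manifold_C3 manifold_G smooth_loop2 smooth_\<gamma>]])
  then show ?thesis by simp
qed

lemma is_lie_groupoid_R: "is_lie_groupoid R"
  unfolding is_lie_groupoid_def
proof (intro conjI smooth_cmp_R smooth_ginv_R)
  have ne: "points (mfd G) \<noteq> {}" by auto
  show "surjective_submersion (arr R) (obj R) (src R)"
    using local_sections_submersion[OF manifold_R manifold_C1 local_sections_compose[OF manifold_R manifold_C2
          manifold_C1 local_sections_snd[OF manifold_G manifold_C2 ne] local_sections_fst2]] by simp
  show "surjective_submersion (arr R) (obj R) (tgt R)"
    using local_sections_submersion[OF manifold_R manifold_C1 local_sections_compose[OF manifold_R manifold_C2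
          manifold_C1 local_sections_snd[OF manifold_G manifold_C2 ne] local_sections_snd2]] by simp
  have "smooth_map C1 (mfd G \<times>\<^sub>M\<^sub>f C2) (\<lambda>m. (\<one>\<^bsub>G\<^esub>, diag1 m))"
    by (intro smooth_map_Pair smooth_ops manifold_C1 manifold_C2 manifold_G smooth_diag1)
  then show "smooth_map (obj R) (arr R) (idt R)"
    by simp
  show "\<forall>x y z. (x, y) \<in> composable R \<and> (y, z) \<in> composable R \<longrightarrow>
      cmp R (cmp R x y) z = cmp R x (cmp R y z)"
  proof (intro allI impI)
    fix a b c assume "(a, b) \<in> composable R \<and> (b, c) \<in> composable R"
    then obtain g g' g'' i k l m x where *: "a = (g, ((i, k), x))" "b = (g', ((k, l), x))"
        "c = (g'', ((l, m), x))" and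
      c: "g \<in> carrier G" "g' \<in> carrier G" "g'' \<in> carrier G" "i \<in> I" "k \<in> I" "l \<in> I" "m \<in> I"
        "x \<in> U i" "x \<in> U k" "x \<in> U l" "x \<in> U m"
      by (auto simp: composable_R)
    \<comment> \<open>\<open>L_L\<close> moves \<open>\<gamma>_ikl\<close> past the third factor
      \<open>g''\<close>; the two values of \<open>\<gamma>\<close> become adjacent and the second
      cocycle equation applies.\<close>
    have "\<gamma> ((i, k, l), x) \<otimes>\<^bsub>G\<^esub> (\<alpha> (L ((i, l), x)) g'' \<otimes>\<^bsub>G\<^esub> \<gamma> ((i, l, m), x)) =
        \<alpha> (L ((i, k), x)) (\<alpha> (L ((k, l), x)) g'') \<otimes>\<^bsub>G\<^esub> (\<gamma> ((i, k, l), x) \<otimes>\<^bsub>G\<^esub> \<gamma> ((i, l, m), x))"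
      using c L_L[of i k l x g''] by (simp flip: G.m_assoc)
    then show "cmp R (cmp R a b) c = cmp R a (cmp R b c)"
      using c by (simp add: * G.m_assoc \<gamma>_\<gamma>)
  qed
  show "\<forall>x\<in>arrows R. src R (ginv R x) = tgt R x \<and> tgt R (ginv R x) = src R x \<and>
      cmp R x (ginv R x) = idt R (src R x) \<and> cmp R (ginv R x) x = idt R (tgt R x)"
  proof
    fix a assume "a \<in> arrows R"
    then obtain g i k x where a: "a = (g, ((i, k), x))" and
      c: "g \<in> carrier G" "i \<in> I" "k \<in> I" "x \<in> U i" "x \<in> U k"
      by (auto simp: points_C2)
    let ?l = "L ((i, k), x)"
    \<comment> \<open>The right inverse law holds by construction of \<open>ginv\<close>. For the
      left one, the remaining factor is computed after acting by \<open>L_ik\<close>: use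
      \<open>L_L\<close> at \<open>(i, k, i)\<close> and the second cocycle equation at
      \<open>(i, k, i, k)\<close>, which gives
      \<open>L_ik(\<gamma>_kik) = \<gamma>_iki\<close>.\<close>
    have "\<alpha> ?l (\<alpha> (L ((k, i), x)) g \<otimes>\<^bsub>G\<^esub> \<gamma> ((k, i, k), x)) = \<gamma> ((i, k, i), x) \<otimes>\<^bsub>G\<^esub> g"
      using c L_L[of i k i x g] \<gamma>_\<gamma>[of i k i k x] by simp
    then have "\<alpha> (inv\<^bsub>H\<^esub> ?l) (\<alpha> ?l (\<alpha> (L ((k, i), x)) g \<otimes>\<^bsub>G\<^esub> \<gamma> ((k, i, k), x))) =
        \<alpha> (inv\<^bsub>H\<^esub> ?l) (\<gamma> ((i, k, i), x) \<otimes>\<^bsub>G\<^esub> g)"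
      by simp
    then have "\<alpha> (L ((k, i), x)) g \<otimes>\<^bsub>G\<^esub> \<gamma> ((k, i, k), x) = \<alpha> (inv\<^bsub>H\<^esub> ?l) (\<gamma> ((i, k, i), x)) \<otimes>\<^bsub>G\<^esub> \<alpha> (inv\<^bsub>H\<^esub> ?l) g"
      using c by (simp del: jact_mult) simp
    then show "src R (ginv R a) = tgt R a \<and> tgt R (ginv R a) = src R a \<and>
      cmp R a (ginv R a) = idt R (src R a) \<and> cmp R (ginv R a) a = idt R (tgt R a)"
      using c by (simp add: a G.m_assoc)
  qed
qed (auto simp: manifold_C1 manifold_R points_C1 points_C2 composable_R)

end

context cech_cocycle
begin

section \<open>Kernel, band and bundle of the cocycle extension\<close>

abbreviation "E \<equiv> cocycle_ext L \<gamma>"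

lemma ext_simps [simp]:
  "ext_gpd E = R" "ext_proj E = snd" "ext_bdl E = C1 \<times>\<^sub>M\<^sub>f mfd H" "bdl_proj E = fst"
  "bdl_right E p h = (fst p, snd p \<otimes>\<^bsub>H\<^esub> h)"
  "bdl_left E r p = (fst2 (snd r), \<rho> (fst r) \<otimes>\<^bsub>H\<^esub> L (snd r) \<otimes>\<^bsub>H\<^esub> snd p)"
  "ext_chi E p = (fst p, \<lambda>g\<in>carrier G. (\<alpha> (snd p) g, diag1 (fst p)))"
  by (simp_all add: cocycle_ext_def)

lemma groupoid_extension_R: "groupoid_extension R cech snd"
  unfolding groupoid_extension_def
proof (intro conjI is_lie_groupoid_R is_lie_groupoid_cech)
  show "morphism_over_id R cech snd"
    unfolding morphism_over_id_def using snd_R by auto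
  have "points (mfd G) \<noteq> {}" by auto
  then show "surjective_submersion (arr R) (arr cech) snd"
    using local_sections_submersion[OF manifold_R manifold_C2 local_sections_snd[OF manifold_G manifold_C2]]
    by simp
qed

lemma kernel_over_R:
  assumes "V \<subseteq> points C1"
  shows "kernel_over R cech snd V = carrier G \<times> diag1 ` V"
proof -
  have *: "diag1 ` V \<subseteq> points C2" using assms smooth_map_funcset[OF smooth_diag1] by auto
  have "p \<in> kernel_over R cech snd V \<longleftrightarrow> p \<in> carrier G \<times> diag1 ` V" for p
    using * by (simp add: kernel_over_def mem_Times_iff) blast
  then show ?thesis by blast
qed

text \<open>Over \<open>x_ii\<close> both \<open>L\<close> and \<open>\<gamma>\<close> are trivial,
  so the kernel group is a copy of \<open>G\<close> and \<open>h\<close> acts by an automorphism.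
  The inverse bijection is the action of the inverse of \<open>h\<close>.\<close>

lemma iso_kernel_group:
  assumes m: "m \<in> points C1" and h: "h \<in> carrier H"
  shows "(\<lambda>g\<in>carrier G. (\<alpha> h g, diag1 m)) \<in> iso G (kernel_group R cech snd m)"
proof -
  obtain i x where ix: "m = (i, x)" "i \<in> I" "x \<in> U i" using m by (auto simp: points_C1)
  have "bij_betw (\<lambda>g\<in>carrier G. (\<alpha> h g, diag1 m)) (carrier G) (carrier G \<times> {diag1 m})"
    by (rule bij_betw_byWitness[where f' = "\<lambda>p. \<alpha> (inv\<^bsub>H\<^esub> h) (fst p)"]) (use h in auto)
  then show ?thesis
    using m h ix by (auto simp: iso_def hom_def kernel_group_def kernel_over_R)
qed

lemma G_extension_R: "G_extension G R cech snd"
  unfolding G_extension_def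
proof (intro conjI groupoid_extension_R ballI)
  fix m assume m: "m \<in> objects R"
  \<comment> \<open>The kernel is trivial over the whole base at once; the inverse map reads off the
    source and the group component.\<close>
  let ?t = "\<lambda>p. (snd p, diag1 (fst p))"
  have M: "smooth_manifold (C1 \<times>\<^sub>M\<^sub>f mfd G)" by (rule smooth_manifold_prod[OF manifold_C1 manifold_G])
  have t: "smooth_map (C1 \<times>\<^sub>M\<^sub>f mfd G) (mfd G \<times>\<^sub>M\<^sub>f C2) ?t"
    by (intro smooth_map_Pair M manifold_G manifold_C2 smooth_map_snd manifold_C1
        smooth_map_compose[OF M manifold_C1 manifold_C2 smooth_map_fst[OF manifold_C1 manifold_G] smooth_diag1])
  have t': "smooth_map (mfd G \<times>\<^sub>M\<^sub>f C2) (C1 \<times>\<^sub>M\<^sub>f mfd G) (\<lambda>p. (fst2 (snd p), fst p))"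
    by (intro smooth_map_Pair manifold_R manifold_G manifold_C1 fst_R smooth_snd_R'[OF smooth_fst2])
  have "diffeo_on (points C1 \<times> carrier G) (C1 \<times>\<^sub>M\<^sub>f mfd G) (kernel_over R cech snd (points C1)) (mfd G \<times>\<^sub>M\<^sub>f C2) ?t"
    by (rule diffeo_onI[OF M manifold_R _ _ t t'])
      (auto simp: kernel_over_R points_C1 points_C2)
  moreover have "(\<lambda>g. ?t (x, g)) \<in> iso G (kernel_group R cech snd x)" if "x \<in> points C1" for x
  proof -
    have "(\<lambda>g\<in>carrier G. (g, diag1 x)) \<in> iso G (kernel_group R cech snd x)"
      using iso_kernel_group[OF that H.one_closed]
      by (simp add: restrict_def cong: if_cong)
    then show ?thesis
      by (auto simp: iso_def hom_def Pi_iff cong: bij_betw_cong)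
  qed
  ultimately show "\<exists>V \<tau>. openin (mfd_top (obj R)) V \<and> m \<in> V \<and>
      diffeo_on (V \<times> carrier G) (obj R \<times>\<^sub>M\<^sub>f mfd G) (kernel_over R cech snd V) (arr R) \<tau> \<and>
      (\<forall>x\<in>V. (\<lambda>g. \<tau> (x, g)) \<in> iso G (kernel_group R cech snd x))"
    using m by (intro exI[of _ "points C1"] exI[of _ ?t]) simp
qed

lemma band_R:
  assumes m: "m \<in> points C1" and h: "h \<in> carrier H"
  shows "(m, \<lambda>g\<in>carrier G. (\<alpha> h g, diag1 m)) \<in> band G R cech snd"
proof -
  have d: "diag1 m \<in> points C2" using m by (auto simp: points_C1 points_C2)
  have "smooth_map (mfd G) (mfd G \<times>\<^sub>M\<^sub>f C2) (\<lambda>g. (\<alpha> h g, diag1 m))"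
    by (intro smooth_map_Pair smooth_jact' smooth_map_const smooth_map_id manifold_G manifold_C2)
      (use h d in auto)
  then have f: "smooth_map (mfd G) (mfd G \<times>\<^sub>M\<^sub>f C2) (\<lambda>g\<in>carrier G. (\<alpha> h g, diag1 m))"
    by (rule smooth_map_cong[OF manifold_G manifold_R]) simp
  have f': "smooth_map (mfd G \<times>\<^sub>M\<^sub>f C2) (mfd G) (\<lambda>p. \<alpha> (inv\<^bsub>H\<^esub> h) (fst p))"
    by (intro smooth_jact' smooth_map_const manifold_R fst_R) (use h in auto)
  have "diffeo_on (carrier G) (mfd G) (kernel_over R cech snd {m}) (mfd G \<times>\<^sub>M\<^sub>f C2)
      (\<lambda>g\<in>carrier G. (\<alpha> h g, diag1 m))"
    by (rule diffeo_onI[OF manifold_G manifold_R _ _ f f']) (use m h d in \<open>auto simp: kernel_over_R\<close>)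
  then show ?thesis
    using m iso_kernel_group[OF m h] by (simp add: band_def)
qed

lemma right_principal_bundle_E:
  "right_principal_bundle H (C1 \<times>\<^sub>M\<^sub>f mfd H) C1 fst (\<lambda>p h. (fst p, snd p \<otimes>\<^bsub>H\<^esub> h))"
  unfolding right_principal_bundle_def
proof (intro conjI manifold_P manifold_C1 ballI)
  let ?P = "C1 \<times>\<^sub>M\<^sub>f mfd H"
  have "points (mfd H) \<noteq> {}" by auto
  then show "surjective_submersion ?P C1 fst"
    by (intro local_sections_submersion manifold_P manifold_C1 local_sections_fst manifold_H)
  have PH: "smooth_manifold (?P \<times>\<^sub>M\<^sub>f mfd H)" by (intro smooth_manifold_prod manifold_P manifold_H)
  have "smooth_map (?P \<times>\<^sub>M\<^sub>f mfd H) ?P (\<lambda>q. (fst (fst q), snd (fst q) \<otimes>\<^bsub>H\<^esub> snd q))"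
    by (intro smooth_map_Pair smooth_mult_H' PH manifold_C1 manifold_H smooth_map_snd manifold_P
        smooth_map_compose[OF PH manifold_P _ smooth_map_fst[OF manifold_P manifold_H]] fst_P snd_P)
  then show "smooth_map (?P \<times>\<^sub>M\<^sub>f mfd H) ?P (\<lambda>(p, h). (fst p, snd p \<otimes>\<^bsub>H\<^esub> h))"
    by (simp add: case_prod_unfold)
  fix m assume m: "m \<in> points C1"
  \<comment> \<open>The trivialisation is the identity over the whole base, seen as a map between
    two constructions of the same space: restriction followed by product, and product followed by
    restriction.\<close>
  let ?A = "open_submfd C1 (points C1) \<times>\<^sub>M\<^sub>f mfd H"
    and ?B = "open_submfd ?P {p \<in> points ?P. fst p \<in> points C1}"
  have oB: "openin (mfd_top ?P) {p \<in> points ?P. fst p \<in> points C1}"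
    using openin_continuous_map_preimage[OF smooth_map_continuous[OF fst_P] openin_topspace] .
  have mC: "smooth_manifold (open_submfd C1 (points C1))"
    by (intro smooth_manifold_open_submfd manifold_C1) simp
  have A: "smooth_manifold ?A" by (intro smooth_manifold_prod mC manifold_H)
  have B: "smooth_manifold ?B" by (rule smooth_manifold_open_submfd[OF manifold_P oB])
  have "smooth_map ?A ?P (\<lambda>q. (fst q, snd q))"
    by (intro smooth_map_Pair A manifold_C1 manifold_H smooth_map_snd mC
        smooth_map_compose[OF A mC _ smooth_map_fst[OF mC manifold_H]] smooth_map_inclusion) simp
  then have f: "smooth_map ?A ?B (\<lambda>q. q)"
    by (intro smooth_map_into_open_submfd) auto
  have "smooth_map ?B (open_submfd C1 (points C1)) fst"
    by (intro smooth_map_into_open_submfd[OF smooth_map_restrict[OF manifold_P manifold_C1 oB fst_P]]) simp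
  moreover have "smooth_map ?B (mfd H) snd"
    by (rule smooth_map_restrict[OF manifold_P manifold_H oB snd_P])
  ultimately have "smooth_map ?B ?A (\<lambda>q. (fst q, snd q))"
    by (intro smooth_map_Pair B mC manifold_H)
  then have g: "smooth_map ?B ?A (\<lambda>q. q)" by simp
  have "diffeomorphism ?A ?B (\<lambda>q. q)"
    by (rule diffeomorphismI[OF A B f g]) simp_all
  with m show "\<exists>V \<tau>. openin (mfd_top C1) V \<and> m \<in> V \<and>
       diffeomorphism (open_submfd C1 V \<times>\<^sub>M\<^sub>f mfd H) (open_submfd ?P {p \<in> points ?P. fst p \<in> V}) \<tau> \<and>
       (\<forall>x\<in>V. \<forall>h\<in>carrier H. fst (\<tau> (x, h)) = x \<and>
          (\<forall>h'\<in>carrier H. (fst (\<tau> (x, h)), snd (\<tau> (x, h)) \<otimes>\<^bsub>H\<^esub> h') = \<tau> (x, h \<otimes>\<^bsub>H\<^esub> h')))"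
    by (intro exI[of _ "points C1"] exI[of _ "\<lambda>q. q"]) simp
qed (auto simp: H.m_assoc)

lemma left_action_E: "left_action R (C1 \<times>\<^sub>M\<^sub>f mfd H) fst (bdl_left E)"
  unfolding left_action_def
proof (intro conjI)
  let ?P = "C1 \<times>\<^sub>M\<^sub>f mfd H"
  show "surjective_submersion ?P (obj R) fst"
    using right_principal_bundle_E by (simp add: right_principal_bundle_def)
  let ?S = "(mfd G \<times>\<^sub>M\<^sub>f C2) \<times>\<^sub>M\<^sub>f ?P"
  have S: "smooth_manifold ?S" by (intro smooth_manifold_prod manifold_R manifold_P)
  note p1 = smooth_map_fst[OF manifold_R manifold_P] and p2 = smooth_map_snd[OF manifold_R manifold_P]
  \<comment> \<open>The formula of the action involves only the base point of the arrow, hence it is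
    smooth on the full product and extends the action globally.\<close>
  have "smooth_map ?S ?P (\<lambda>q. (fst2 (snd (fst q)),
      \<rho> (fst (fst q)) \<otimes>\<^bsub>H\<^esub> L (snd (fst q)) \<otimes>\<^bsub>H\<^esub> snd (snd q)))"
    by (intro smooth_map_Pair smooth_ops S manifold_C1 manifold_H
        smooth_map_compose[OF S manifold_R _ p1] smooth_map_compose[OF S manifold_P _ p2]
        smooth_snd_R' smooth_fst2 smooth_L fst_R snd_P manifold_G)
  then show "smooth_map_on {(x, p). x \<in> arrows R \<and> p \<in> points ?P \<and> tgt R x = fst p}
      (arr R \<times>\<^sub>M\<^sub>f ?P) ?P (\<lambda>(x, p). bdl_left E x p)"
    by (intro smooth_map_imp_smooth_map_on) (auto simp: case_prod_unfold S manifold_P)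
  have "bdl_left E (cmp R a b) p = bdl_left E a (bdl_left E b p)"
    if ab: "(a, b) \<in> composable R" and p: "p \<in> points ?P" "tgt R b = fst p" for a b p
  proof -
    from ab obtain g g' i k l x where *: "a = (g, ((i, k), x))" "b = (g', ((k, l), x))" and
      c: "g \<in> carrier G" "g' \<in> carrier G" "i \<in> I" "k \<in> I" "l \<in> I" "x \<in> U i" "x \<in> U k" "x \<in> U l"
      by (auto simp: composable_R)
    have h: "snd p \<in> carrier H" using p by auto
    \<comment> \<open>Compatibility with products is the first cocycle equation applied to
      \<open>snd p\<close>.\<close>
    have "\<rho> (\<gamma> ((i, k, l), x)) \<otimes>\<^bsub>H\<^esub> (L ((i, l), x) \<otimes>\<^bsub>H\<^esub> snd p) =
        L ((i, k), x) \<otimes>\<^bsub>H\<^esub> (L ((k, l), x) \<otimes>\<^bsub>H\<^esub> snd p)"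
      using c h rho_\<gamma>[of i k l x] by (simp flip: H.m_assoc)
    with c h show ?thesis by (simp add: * rho_jact H.m_assoc)
  qed
  then show "\<forall>(x, y)\<in>composable R. \<forall>p\<in>points ?P. tgt R y = fst p \<longrightarrow>
      bdl_left E (cmp R x y) p = bdl_left E x (bdl_left E y p)"
    by blast
qed (auto simp: points_C1 points_C2)

lemma adapted_cocycle_ext: "E \<in> adapted_exts X N I U"
proof -
  let ?P = "C1 \<times>\<^sub>M\<^sub>f mfd H"
  have PG: "smooth_manifold (?P \<times>\<^sub>M\<^sub>f mfd G)" by (intro smooth_manifold_prod manifold_P manifold_G)
  note p1 = smooth_map_fst[OF manifold_P manifold_G] and p2 = smooth_map_snd[OF manifold_P manifold_G]
  have "smooth_map (?P \<times>\<^sub>M\<^sub>f mfd G) (mfd G \<times>\<^sub>M\<^sub>f C2) (\<lambda>q. (\<alpha> (snd (fst q)) (snd q), diag1 (fst (fst q))))"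
    by (intro smooth_map_Pair smooth_ops PG manifold_G manifold_C2 p2
        smooth_map_compose[OF PG manifold_P _ p1] snd_P manifold_H smooth_fst_P' smooth_diag1)
  then have chi: "smooth_map (?P \<times>\<^sub>M\<^sub>f mfd G) (mfd G \<times>\<^sub>M\<^sub>f C2)
      (\<lambda>(p, g). (\<lambda>g\<in>carrier G. (\<alpha> (snd p) g, diag1 (fst p))) g)"
    by (rule smooth_map_cong[OF PG manifold_R]) auto
  have equivariant: "ext_chi E (bdl_right E (bdl_left E r p) h) = band_right G (band_left G R r (ext_chi E p)) (\<alpha> h)"
    if "r \<in> arrows R" "p \<in> points ?P" "h \<in> carrier H" "tgt R r = fst p" for r p h
  proof -
    from that obtain g i k x h' where *: "r = (g, ((i, k), x))" "p = ((k, x), h')" and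
      c: "g \<in> carrier G" "h' \<in> carrier H" "h \<in> carrier H" "i \<in> I" "k \<in> I" "x \<in> U i" "x \<in> U k"
      by (auto simp: points_C1 points_C2)
    \<comment> \<open>Conjugating \<open>(b, x_kk)\<close> by \<open>(g, x_ik)\<close> gives
      \<open>g L_ik(b) inv g\<close> over \<open>x_ii\<close>, the factor
      \<open>\<gamma>_iki\<close> cancelling against the one in \<open>ginv\<close>. By the Peiffer
      identity this is the action of \<open>\<rho>(g) L_ik\<close> on \<open>b\<close>.\<close>
    have "\<alpha> (\<rho> g \<otimes>\<^bsub>H\<^esub> L ((i, k), x) \<otimes>\<^bsub>H\<^esub> h' \<otimes>\<^bsub>H\<^esub> h) a =
        fst (cmp R (cmp R r (\<alpha> h' (\<alpha> h a), ((k, k), x))) (ginv R r))" if a: "a \<in> carrier G" for a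
      using c a by (simp add: * jact_comp peiffer G.m_assoc)
    with c show ?thesis
      by (auto simp: * band_left_def band_right_def fun_eq_iff restrict_def)
  qed
  have "gh_extension X cech E"
    unfolding gh_extension_def Let_def
  proof (intro conjI)
    show "G_extension G (ext_gpd E) cech (ext_proj E)" using G_extension_R by simp
    show "right_principal_bundle H (ext_bdl E) (obj (ext_gpd E)) (bdl_proj E) (bdl_right E)"
      using right_principal_bundle_E by (simp add: cocycle_ext_def)
    show "left_action (ext_gpd E) (ext_bdl E) (bdl_proj E) (bdl_left E)" using left_action_E by simp
    show "smooth_map (ext_bdl E \<times>\<^sub>M\<^sub>f mfd G) (arr (ext_gpd E)) (\<lambda>(p, g). snd (ext_chi E p) g)"
      using chi by simp
    show "\<forall>p\<in>points (ext_bdl E). ext_chi E p \<in> band G (ext_gpd E) cech (ext_proj E) \<and>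
        fst (ext_chi E p) = bdl_proj E p"
      using band_R by auto
    show "\<forall>r\<in>arrows (ext_gpd E). \<forall>p\<in>points (ext_bdl E). \<forall>h\<in>carrier H.
        tgt (ext_gpd E) r = bdl_proj E p \<longrightarrow>
        ext_chi E (bdl_right E (bdl_left E r p) h) =
        band_right G (band_left G (ext_gpd E) r (ext_chi E p)) (\<alpha> h)"
      using equivariant by (simp only: ext_simps) blast
  qed (auto simp: points_C1 points_C2 H.m_assoc rho_jact)
  then show ?thesis
    by (auto simp: adapted_exts_def Let_def points_C1 points_C2)
qed

end

section \<open>The cocycle of an adapted extension\<close>

lemma is_lie_groupoidD:
  assumes "is_lie_groupoid \<Gamma>"
  shows "smooth_map (obj \<Gamma>) (arr \<Gamma>) (idt \<Gamma>)"
    and "smooth_map (arr \<Gamma>) (arr \<Gamma>) (ginv \<Gamma>)"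
    and "smooth_map_on (composable \<Gamma>) (arr \<Gamma> \<times>\<^sub>M\<^sub>f arr \<Gamma>) (arr \<Gamma>) (\<lambda>(x, y). cmp \<Gamma> x y)"
    and "(x, y) \<in> composable \<Gamma> \<Longrightarrow> cmp \<Gamma> x y \<in> arrows \<Gamma>"
    and "(x, y) \<in> composable \<Gamma> \<Longrightarrow> (y, z) \<in> composable \<Gamma> \<Longrightarrow>
      cmp \<Gamma> (cmp \<Gamma> x y) z = cmp \<Gamma> x (cmp \<Gamma> y z)"
    and "x \<in> arrows \<Gamma> \<Longrightarrow> cmp \<Gamma> (idt \<Gamma> (src \<Gamma> x)) x = x"
    and "x \<in> arrows \<Gamma> \<Longrightarrow> cmp \<Gamma> x (idt \<Gamma> (tgt \<Gamma> x)) = x"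
    and "x \<in> arrows \<Gamma> \<Longrightarrow> src \<Gamma> (ginv \<Gamma> x) = tgt \<Gamma> x"
    and "x \<in> arrows \<Gamma> \<Longrightarrow> tgt \<Gamma> (ginv \<Gamma> x) = src \<Gamma> x"
    and "x \<in> arrows \<Gamma> \<Longrightarrow> cmp \<Gamma> (ginv \<Gamma> x) x = idt \<Gamma> (tgt \<Gamma> x)"
  using assms unfolding is_lie_groupoid_def by blast+

lemma morphism_over_idD:
  assumes "morphism_over_id \<Gamma> \<Delta> f"
  shows "smooth_map (arr \<Gamma>) (arr \<Delta>) f"
    and "obj \<Gamma> = obj \<Delta>"
    and "x \<in> arrows \<Gamma> \<Longrightarrow> src \<Delta> (f x) = src \<Gamma> x"
    and "x \<in> arrows \<Gamma> \<Longrightarrow> tgt \<Delta> (f x) = tgt \<Gamma> x"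
    and "m \<in> objects \<Gamma> \<Longrightarrow> f (idt \<Gamma> m) = idt \<Delta> m"
    and "(x, y) \<in> composable \<Gamma> \<Longrightarrow> f (cmp \<Gamma> x y) = cmp \<Delta> (f x) (f y)"
  using assms unfolding morphism_over_id_def by blast+

lemma left_actionD:
  assumes "left_action \<Gamma> P \<pi> act"
  shows "smooth_map_on {(x, p). x \<in> arrows \<Gamma> \<and> p \<in> points P \<and> tgt \<Gamma> x = \<pi> p}
      (arr \<Gamma> \<times>\<^sub>M\<^sub>f P) P (\<lambda>(x, p). act x p)"
    and "x \<in> arrows \<Gamma> \<Longrightarrow> p \<in> points P \<Longrightarrow> tgt \<Gamma> x = \<pi> p \<Longrightarrow> act x p \<in> points P"
    and "x \<in> arrows \<Gamma> \<Longrightarrow> p \<in> points P \<Longrightarrow> tgt \<Gamma> x = \<pi> p \<Longrightarrow> \<pi> (act x p) = src \<Gamma> x"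
    and "(x, y) \<in> composable \<Gamma> \<Longrightarrow> p \<in> points P \<Longrightarrow> tgt \<Gamma> y = \<pi> p \<Longrightarrow>
      act (cmp \<Gamma> x y) p = act x (act y p)"
  using assms unfolding left_action_def by blast+

lemma gh_extensionD:
  assumes "gh_extension X \<Gamma> E"
  shows "is_lie_groupoid (ext_gpd E)"
    and "morphism_over_id (ext_gpd E) \<Gamma> (ext_proj E)"
    and "left_action (ext_gpd E) (ext_bdl E) (bdl_proj E) (bdl_left E)"
    and "\<lbrakk>r \<in> arrows (ext_gpd E); p \<in> points (ext_bdl E); h \<in> carrier (grpH X);
        tgt (ext_gpd E) r = bdl_proj E p\<rbrakk> \<Longrightarrow>
      bdl_right E (bdl_left E r p) h = bdl_left E r (bdl_right E p h)"
    and "\<lbrakk>r \<in> arrows (ext_gpd E); p \<in> points (ext_bdl E); h \<in> carrier (grpH X);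
        tgt (ext_gpd E) r = bdl_proj E p\<rbrakk> \<Longrightarrow>
      ext_chi E (bdl_right E (bdl_left E r p) h) =
      band_right (grpG X) (band_left (grpG X) (ext_gpd E) r (ext_chi E p)) (jact X h)"
    and "\<lbrakk>p \<in> points (ext_bdl E); g \<in> carrier (grpG X)\<rbrakk> \<Longrightarrow>
      bdl_right E p (rho X g) = bdl_left E (snd (ext_chi E p) g) p"
  using assms unfolding gh_extension_def Let_def G_extension_def groupoid_extension_def by blast+

context crossed_cover
begin

definition ext_L :: "('g, 'f, 'h, 'k, 'i, 'n, 'e) cech_ext \<Rightarrow> ('i \<times> 'i) \<times> 'n \<Rightarrow> 'h" where
  "ext_L E y = snd (bdl_left E (\<one>\<^bsub>G\<^esub>, y) (snd2 y, \<one>\<^bsub>H\<^esub>))"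

definition ext_\<gamma> :: "('g, 'f, 'h, 'k, 'i, 'n, 'e) cech_ext \<Rightarrow> ('i \<times> 'i \<times> 'i) \<times> 'n \<Rightarrow> 'g" where
  "ext_\<gamma> E z = fst (cmp (ext_gpd E) (\<one>\<^bsub>G\<^esub>, face12 z) (\<one>\<^bsub>G\<^esub>, face23 z))"

end

locale adapted_ext = crossed_cover X N I U
  for X :: "('g, 'f::fin_dim_inner, 'h, 'k::fin_dim_inner) crossed_mod"
    and N :: "('n, 'e::fin_dim_inner) manifold" and I :: "'i set" and U :: "'i \<Rightarrow> 'n set" +
  fixes E :: "('g, 'f, 'h, 'k, 'i, 'n, 'e) cech_ext"
  assumes adapted: "E \<in> adapted_exts X N I U"
begin

abbreviation "R \<equiv> ext_gpd E"
abbreviation "la \<equiv> bdl_left E"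
abbreviation "ra \<equiv> bdl_right E"
abbreviation "L \<equiv> ext_L E"
abbreviation "\<gamma> \<equiv> ext_\<gamma> E"

section \<open>Structure maps of an adapted extension\<close>

lemma gh: "gh_extension X cech E"
  and arr_R [simp]: "arr R = mfd G \<times>\<^sub>M\<^sub>f C2"
  and bdl_E [simp]: "ext_bdl E = C1 \<times>\<^sub>M\<^sub>f mfd H"
  using adapted by (auto simp: adapted_exts_def Let_def)

lemma
  shows proj_E [simp]: "p \<in> carrier G \<times> points C2 \<Longrightarrow> ext_proj E p = snd p"
    and bdl_proj_E [simp]: "q \<in> points C1 \<times> carrier H \<Longrightarrow> bdl_proj E q = fst q"
    and ra_E: "q \<in> points C1 \<times> carrier H \<Longrightarrow> h \<in> carrier H \<Longrightarrow> ra q h = (fst q, snd q \<otimes>\<^bsub>H\<^esub> h)"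
    and chi_E: "i \<in> I \<Longrightarrow> x \<in> U i \<Longrightarrow> h \<in> carrier H \<Longrightarrow>
      ext_chi E ((i, x), h) = ((i, x), \<lambda>g\<in>carrier G. (\<alpha> h g, ((i, i), x)))"
    and cmp_unit: "\<lbrakk>i \<in> I; k \<in> I; x \<in> U i; x \<in> U k; g \<in> carrier G; g' \<in> carrier G\<rbrakk> \<Longrightarrow>
      cmp R (g, ((i, i), x)) (g', ((i, k), x)) = (g \<otimes>\<^bsub>G\<^esub> g', ((i, k), x))"
  using adapted by (auto simp: adapted_exts_def Let_def)

lemmas gpd = is_lie_groupoidD[OF gh_extensionD(1)[OF gh]]
  and mor = morphism_over_idD[OF gh_extensionD(2)[OF gh]]
  and action = left_actionD[OF gh_extensionD(3)[OF gh]]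

lemma obj_R [simp]: "obj R = C1"
  using mor(2) by simp

lemma
  assumes "p \<in> carrier G \<times> points C2"
  shows src_R [simp]: "src R p = fst2 (snd p)" and tgt_R [simp]: "tgt R p = snd2 (snd p)"
  using mor(3,4)[of p] assms by simp_all

lemma arrow_iff [simp]: "(g, ((i, k), x)) \<in> carrier G \<times> points C2 \<longleftrightarrow>
    g \<in> carrier G \<and> i \<in> I \<and> k \<in> I \<and> x \<in> U i \<and> x \<in> U k"
  by (auto simp: points_C2)

lemma composableI:
  "\<lbrakk>g \<in> carrier G; g' \<in> carrier G; i \<in> I; k \<in> I; l \<in> I; x \<in> U i; x \<in> U k; x \<in> U l\<rbrakk> \<Longrightarrow>
    ((g, ((i, k), x)), (g', ((k, l), x))) \<in> composable R"
  using arrow_iff[of g i k x] arrow_iff[of g' k l x] unfolding composable_def by simp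

text \<open>The projection onto the Cech groupoid is a morphism, so it fixes the second component of
  every product; only the component in \<open>G\<close> remains to be determined.\<close>

lemma
  assumes "(a, b) \<in> composable R"
  shows cmp_closed: "cmp R a b \<in> carrier G \<times> points C2"
    and snd_cmp: "snd (cmp R a b) = face13 (triple (snd a) (snd b))"
proof -
  show c: "cmp R a b \<in> carrier G \<times> points C2"
    using gpd(4)[OF assms] by simp
  have "ext_proj E (cmp R a b) = cmp cech (ext_proj E a) (ext_proj E b)"
    by (rule mor(6)[OF assms])
  then show "snd (cmp R a b) = face13 (triple (snd a) (snd b))"
    using c assms by (simp add: composable_def)
qed

lemma cmp_assoc:
  "(a, b) \<in> composable R \<Longrightarrow> (b, c) \<in> composable R \<Longrightarrow> cmp R (cmp R a b) c = cmp R a (cmp R b c)"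
  by (rule gpd(5))

lemma
  assumes "a \<in> carrier G \<times> points C2"
  shows cmp_idt: "cmp R (idt R (fst2 (snd a))) a = a" "cmp R a (idt R (snd2 (snd a))) = a"
    and cmp_ginv: "cmp R (ginv R a) a = idt R (snd2 (snd a))"
    and ginv_closed: "ginv R a \<in> carrier G \<times> points C2" "src R (ginv R a) = snd2 (snd a)"
      "tgt R (ginv R a) = fst2 (snd a)"
proof -
  have a: "a \<in> arrows R" using assms by simp
  show "cmp R (idt R (fst2 (snd a))) a = a" "cmp R a (idt R (snd2 (snd a))) = a"
    "cmp R (ginv R a) a = idt R (snd2 (snd a))" "src R (ginv R a) = snd2 (snd a)"
    "tgt R (ginv R a) = fst2 (snd a)"
    using gpd(6-10)[OF a] assms by simp_all
  from smooth_map_funcset[OF gpd(2) a] show "ginv R a \<in> carrier G \<times> points C2" by simp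
qed

lemma idt_R:
  assumes "i \<in> I" "x \<in> U i"
  shows "idt R (i, x) = (\<one>\<^bsub>G\<^esub>, ((i, i), x))"
proof -
  have m: "(i, x) \<in> points C1" using assms by (simp add: points_C1)
  then have c: "idt R (i, x) \<in> carrier G \<times> points C2"
    using smooth_map_funcset[OF gpd(1), of "(i, x)"] by simp
  have "ext_proj E (idt R (i, x)) = diag1 (i, x)"
    using mor(5) m by simp
  then have "snd (idt R (i, x)) = ((i, i), x)" using c by simp
  then obtain e where e: "idt R (i, x) = (e, ((i, i), x))" "e \<in> carrier G"
    using c by (cases "idt R (i, x)") auto
  have "cmp R (idt R (i, x)) (\<one>\<^bsub>G\<^esub>, ((i, i), x)) = (\<one>\<^bsub>G\<^esub>, ((i, i), x))"
    using cmp_idt(1)[of "(\<one>\<^bsub>G\<^esub>, ((i, i), x))"] assms by (simp del: mem_Sigma_iff)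
  then show ?thesis using e assms by (simp add: cmp_unit)
qed

lemma la_closed:
  assumes "g \<in> carrier G" "i \<in> I" "k \<in> I" "x \<in> U i" "x \<in> U k" "h \<in> carrier H"
  shows "la (g, ((i, k), x)) ((k, x), h) \<in> points C1 \<times> carrier H"
    and "fst (la (g, ((i, k), x)) ((k, x), h)) = (i, x)"
proof -
  let ?a = "(g, ((i, k), x))" and ?p = "((k, x), h)"
  have a: "?a \<in> carrier G \<times> points C2" and p: "?p \<in> points C1 \<times> carrier H"
    using assms by (auto simp: points_C1 points_C2)
  have t: "tgt R ?a = bdl_proj E ?p" unfolding tgt_R[OF a] bdl_proj_E[OF p] by simp
  show c: "la ?a ?p \<in> points C1 \<times> carrier H"
    using action(2)[OF _ _ t] a p by simp
  show "fst (la ?a ?p) = (i, x)"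
    using action(3)[OF _ _ t] a p bdl_proj_E[OF c] src_R[OF a] by simp
qed

lemma la_ra:
  assumes "g \<in> carrier G" "i \<in> I" "k \<in> I" "x \<in> U i" "x \<in> U k" "h \<in> carrier H" "h' \<in> carrier H"
  shows "ra (la (g, ((i, k), x)) ((k, x), h)) h' = la (g, ((i, k), x)) ((k, x), h \<otimes>\<^bsub>H\<^esub> h')"
proof -
  let ?a = "(g, ((i, k), x))" and ?p = "((k, x), h)"
  have a: "?a \<in> carrier G \<times> points C2" and p: "?p \<in> points C1 \<times> carrier H"
    using assms by (auto simp: points_C1 points_C2)
  have t: "tgt R ?a = bdl_proj E ?p" unfolding tgt_R[OF a] bdl_proj_E[OF p] by simp
  have "ra (la ?a ?p) h' = la ?a (ra ?p h')"
    by (rule gh_extensionD(4)[OF gh _ _ _ t]) (use a p assms(7) in simp_all)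
  with ra_E[OF p assms(7)] show ?thesis by simp
qed

lemma la_cmp:
  assumes "(a, (g, ((i, k), x))) \<in> composable R" "k \<in> I" "x \<in> U k" "h \<in> carrier H"
  shows "la (cmp R a (g, ((i, k), x))) ((k, x), h) = la a (la (g, ((i, k), x)) ((k, x), h))"
proof -
  let ?b = "(g, ((i, k), x))" and ?p = "((k, x), h)"
  have b: "?b \<in> carrier G \<times> points C2" and p: "?p \<in> points C1 \<times> carrier H"
    using assms by (auto simp: points_C1 composable_def)
  have "tgt R ?b = bdl_proj E ?p" unfolding tgt_R[OF b] bdl_proj_E[OF p] by simp
  then show ?thesis using p by (intro action(4)[OF assms(1)]) simp_all
qed

lemma L_closed [simp]:
  assumes "i \<in> I" "k \<in> I" "x \<in> U i" "x \<in> U k"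
  shows "L ((i, k), x) \<in> carrier H"
  using la_closed(1)[OF G.one_closed assms H.one_closed] by (auto simp: ext_L_def)

lemma la_one:
  assumes "i \<in> I" "k \<in> I" "x \<in> U i" "x \<in> U k"
  shows "la (\<one>\<^bsub>G\<^esub>, ((i, k), x)) ((k, x), \<one>\<^bsub>H\<^esub>) = ((i, x), L ((i, k), x))"
  using la_closed(2)[OF G.one_closed assms H.one_closed] by (simp add: ext_L_def prod_eq_iff)

text \<open>At the point \<open>(x_i, e)\<close> the map \<open>\<chi>\<close> sends
  \<open>g\<close> to \<open>(g, x_ii)\<close>, so the axiom relating \<open>\<rho>\<close> to the
  left action computes the case \<open>h = e\<close>; the right action then gives all
  \<open>h\<close>.\<close>

lemma la_unit:
  assumes "g \<in> carrier G" "i \<in> I" "x \<in> U i" "h \<in> carrier H"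
  shows "la (g, ((i, i), x)) ((i, x), h) = ((i, x), \<rho> g \<otimes>\<^bsub>H\<^esub> h)"
proof -
  have p: "((i, x), \<one>\<^bsub>H\<^esub>) \<in> points C1 \<times> carrier H" using assms by (simp add: points_C1)
  then have "ra ((i, x), \<one>\<^bsub>H\<^esub>) (\<rho> g) = la (snd (ext_chi E ((i, x), \<one>\<^bsub>H\<^esub>)) g) ((i, x), \<one>\<^bsub>H\<^esub>)"
    using assms(1) by (intro gh_extensionD(6)[OF gh]) simp_all
  then have "la (g, ((i, i), x)) ((i, x), \<one>\<^bsub>H\<^esub>) = ((i, x), \<rho> g)"
    using assms p by (simp add: chi_E ra_E)
  then show ?thesis
    using la_ra[of g i i x "\<one>\<^bsub>H\<^esub>" h] assms p by (simp add: ra_E points_C1)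
qed

text \<open>Condition (4) factors \<open>(g, x_ik)\<close> as \<open>(g, x_ii)\<close> times
  \<open>(e, x_ik)\<close>; the second factor acts through \<open>L\<close> and the first is covered
  by \<open>la_unit\<close>.\<close>

lemma la_formula:
  assumes "g \<in> carrier G" "i \<in> I" "k \<in> I" "x \<in> U i" "x \<in> U k" "h \<in> carrier H"
  shows "la (g, ((i, k), x)) ((k, x), h) = ((i, x), \<rho> g \<otimes>\<^bsub>H\<^esub> L ((i, k), x) \<otimes>\<^bsub>H\<^esub> h)"
proof -
  have "la (g, ((i, k), x)) ((k, x), \<one>\<^bsub>H\<^esub>) = la (cmp R (g, ((i, i), x)) (\<one>\<^bsub>G\<^esub>, ((i, k), x))) ((k, x), \<one>\<^bsub>H\<^esub>)"
    using assms by (simp add: cmp_unit)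
  also have "\<dots> = ((i, x), \<rho> g \<otimes>\<^bsub>H\<^esub> L ((i, k), x))"
    using assms by (subst la_cmp) (auto intro: composableI simp: la_one la_unit)
  finally show ?thesis
    using la_ra[of g i k x "\<one>\<^bsub>H\<^esub>" h] assms by (simp add: ra_E points_C1)
qed

text \<open>Evaluating the equivariance of \<open>\<chi>\<close> at \<open>(e, x\<^sub>i\<^sub>k)\<close> computes conjugation by this arrow.\<close>

lemma cmp_one_left:
  assumes c: "g \<in> carrier G" "i \<in> I" "k \<in> I" "x \<in> U i" "x \<in> U k"
  shows "cmp R (\<one>\<^bsub>G\<^esub>, ((i, k), x)) (g, ((k, k), x)) = (\<alpha> (L ((i, k), x)) g, ((i, k), x))"
proof -
  let ?a = "(\<one>\<^bsub>G\<^esub>, ((i, k), x))" and ?p = "((k, x), \<one>\<^bsub>H\<^esub>)" and ?b = "(g, ((k, k), x))"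
  have a: "?a \<in> carrier G \<times> points C2" and p: "?p \<in> points C1 \<times> carrier H"
    using c by (auto simp: points_C1 points_C2)
  have t: "tgt R ?a = bdl_proj E ?p" unfolding tgt_R[OF a] bdl_proj_E[OF p] by simp
  have "ext_chi E (ra (la ?a ?p) \<one>\<^bsub>H\<^esub>) =
      band_right G (band_left G R ?a (ext_chi E ?p)) (\<alpha> \<one>\<^bsub>H\<^esub>)"
    by (rule gh_extensionD(5)[OF gh _ _ _ t]) (use a p in simp_all)
  then have "snd (ext_chi E (ra (la ?a ?p) \<one>\<^bsub>H\<^esub>)) g =
      snd (band_right G (band_left G R ?a (ext_chi E ?p)) (\<alpha> \<one>\<^bsub>H\<^esub>)) g"
    by simp
  then have e: "cmp R (cmp R ?a ?b) (ginv R ?a) = (\<alpha> (L ((i, k), x)) g, ((i, i), x))"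
    using c by (simp add: la_one ra_E points_C1 chi_E band_left_def band_right_def)
  have ab: "(?a, ?b) \<in> composable R" using c by (intro composableI) auto
  note cab = cmp_closed[OF ab] and sab = snd_cmp[OF ab]
  have 1: "(cmp R ?a ?b, ginv R ?a) \<in> composable R"
    using cab sab ginv_closed[OF a] unfolding composable_def by simp
  have 2: "(ginv R ?a, ?a) \<in> composable R"
    using a ginv_closed[OF a] src_R[OF a] unfolding composable_def by simp
  \<comment> \<open>Inserting \<open>ginv ?a\<close> times \<open>?a\<close> exhibits the conjugate
    computed in \<open>e\<close>; it lies over \<open>x_ii\<close>, so condition (4) evaluates its
    product with \<open>?a\<close>.\<close>
  have "cmp R ?a ?b = cmp R (cmp R ?a ?b) (idt R (k, x))"
    using cmp_idt(2)[OF cab] sab by simp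
  also have "\<dots> = cmp R (cmp R (cmp R ?a ?b) (ginv R ?a)) ?a"
    using cmp_ginv[OF a] cmp_assoc[OF 1 2] by simp
  also have "\<dots> = (\<alpha> (L ((i, k), x)) g, ((i, k), x))"
    using c by (simp add: e cmp_unit)
  finally show ?thesis .
qed

lemma cmp_ones:
  assumes "i \<in> I" "k \<in> I" "l \<in> I" "x \<in> U i" "x \<in> U k" "x \<in> U l"
  shows "cmp R (\<one>\<^bsub>G\<^esub>, ((i, k), x)) (\<one>\<^bsub>G\<^esub>, ((k, l), x)) = (\<gamma> ((i, k, l), x), ((i, l), x))"
    and \<gamma>_closed [simp]: "\<gamma> ((i, k, l), x) \<in> carrier G"
proof -
  have "((\<one>\<^bsub>G\<^esub>, ((i, k), x)), (\<one>\<^bsub>G\<^esub>, ((k, l), x))) \<in> composable R"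
    using assms by (intro composableI) auto
  from snd_cmp[OF this] cmp_closed[OF this]
  show "cmp R (\<one>\<^bsub>G\<^esub>, ((i, k), x)) (\<one>\<^bsub>G\<^esub>, ((k, l), x)) = (\<gamma> ((i, k, l), x), ((i, l), x))"
    "\<gamma> ((i, k, l), x) \<in> carrier G"
    by (auto simp: ext_\<gamma>_def prod_eq_iff)
qed

text \<open>Write the arrows as \<open>(g, x_ii)\<close> times \<open>(e, x_ik)\<close> and
  \<open>(g', x_kk)\<close> times \<open>(e, x_kl)\<close>. Then \<open>cmp_one_left\<close> moves
  \<open>g'\<close> to the left across \<open>(e, x_ik)\<close>, and the product of the two arrows
  with trivial group component is \<open>\<gamma>\<close>.\<close>

lemma cmp_formula:
  assumes c: "g \<in> carrier G" "g' \<in> carrier G" "i \<in> I" "k \<in> I" "l \<in> I" "x \<in> U i" "x \<in> U k" "x \<in> U l"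
  shows "cmp R (g, ((i, k), x)) (g', ((k, l), x)) =
    (g \<otimes>\<^bsub>G\<^esub> \<alpha> (L ((i, k), x)) g' \<otimes>\<^bsub>G\<^esub> \<gamma> ((i, k, l), x), ((i, l), x))"
proof -
  have pull: "cmp R (a, ((i, k), x)) (b, ((k, l), x)) =
      cmp R (a, ((i, i), x)) (cmp R (\<one>\<^bsub>G\<^esub>, ((i, k), x)) (b, ((k, l), x)))"
    if "a \<in> carrier G" "b \<in> carrier G" for a b
    using that c by (subst cmp_assoc[symmetric]) (auto intro: composableI simp: cmp_unit)
  have 1: "cmp R (a, ((i, k), x)) (\<one>\<^bsub>G\<^esub>, ((k, l), x)) = (a \<otimes>\<^bsub>G\<^esub> \<gamma> ((i, k, l), x), ((i, l), x))"
    if "a \<in> carrier G" for a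
    using that c pull[of a "\<one>\<^bsub>G\<^esub>"] by (simp add: cmp_ones cmp_unit)
  have "cmp R (\<one>\<^bsub>G\<^esub>, ((i, k), x)) (g', ((k, l), x)) =
      cmp R (\<one>\<^bsub>G\<^esub>, ((i, k), x)) (cmp R (g', ((k, k), x)) (\<one>\<^bsub>G\<^esub>, ((k, l), x)))"
    using c by (simp add: cmp_unit)
  also have "\<dots> = cmp R (cmp R (\<one>\<^bsub>G\<^esub>, ((i, k), x)) (g', ((k, k), x))) (\<one>\<^bsub>G\<^esub>, ((k, l), x))"
    using c by (subst cmp_assoc) (auto intro: composableI)
  also have "\<dots> = (\<alpha> (L ((i, k), x)) g' \<otimes>\<^bsub>G\<^esub> \<gamma> ((i, k, l), x), ((i, l), x))"
    using c by (simp add: cmp_one_left 1)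
  finally show ?thesis
    using c pull[of g g'] by (simp add: cmp_unit G.m_assoc)
qed

text \<open>The action is smooth on its fibre product only; \<open>y\<close> is mapped smoothly to
  the pair of the arrow \<open>(e, y)\<close> and the neutral point over its target, which belongs
  to that fibre product.\<close>

lemma smooth_L: "smooth_map C2 (mfd H) L"
proof -
  let ?S = "(mfd G \<times>\<^sub>M\<^sub>f C2) \<times>\<^sub>M\<^sub>f (C1 \<times>\<^sub>M\<^sub>f mfd H)"
  have S: "smooth_manifold ?S" by (intro smooth_manifold_prod manifold_R manifold_P)
  have g: "smooth_map C2 ?S (\<lambda>y. ((\<one>\<^bsub>G\<^esub>, y), (snd2 y, \<one>\<^bsub>H\<^esub>)))"
    by (intro smooth_map_Pair smooth_ops manifold_C2 manifold_R manifold_P manifold_G manifold_H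
        manifold_C1 smooth_map_id smooth_snd2)
  let ?A = "{(x, p). x \<in> arrows R \<and> p \<in> points (C1 \<times>\<^sub>M\<^sub>f mfd H) \<and> tgt R x = bdl_proj E p}"
  have "smooth_map_on ?A ?S (C1 \<times>\<^sub>M\<^sub>f mfd H) (\<lambda>(x, p). la x p)"
    using action(1) by simp
  moreover have "(\<lambda>y. ((\<one>\<^bsub>G\<^esub>, y), (snd2 y, \<one>\<^bsub>H\<^esub>))) ` points C2 \<subseteq> ?A"
  proof (rule image_subsetI)
    fix y assume y: "y \<in> points C2"
    have "snd2 y \<in> points C1" by (rule smooth_map_funcset[OF smooth_snd2 y])
    with y show "((\<one>\<^bsub>G\<^esub>, y), (snd2 y, \<one>\<^bsub>H\<^esub>)) \<in> ?A"
      using tgt_R[of "(\<one>\<^bsub>G\<^esub>, y)"] bdl_proj_E[of "(snd2 y, \<one>\<^bsub>H\<^esub>)"] by simp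
  qed
  ultimately have "smooth_map C2 (C1 \<times>\<^sub>M\<^sub>f mfd H) (\<lambda>y. (\<lambda>(x, p). la x p) ((\<one>\<^bsub>G\<^esub>, y), (snd2 y, \<one>\<^bsub>H\<^esub>)))"
    by (intro smooth_map_on_compose[OF manifold_C2 S manifold_P _ g])
  from smooth_map_compose[OF manifold_C2 manifold_P manifold_H this smooth_map_snd[OF manifold_C1 manifold_H]]
  show ?thesis by (simp add: ext_L_def[abs_def])
qed

lemma smooth_\<gamma>: "smooth_map C3 (mfd G) \<gamma>"
proof -
  let ?S = "(mfd G \<times>\<^sub>M\<^sub>f C2) \<times>\<^sub>M\<^sub>f (mfd G \<times>\<^sub>M\<^sub>f C2)"
  have S: "smooth_manifold ?S" by (intro smooth_manifold_prod manifold_R)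
  have g: "smooth_map C3 ?S (\<lambda>z. ((\<one>\<^bsub>G\<^esub>, face12 z), (\<one>\<^bsub>G\<^esub>, face23 z)))"
    by (intro smooth_map_Pair smooth_ops manifold_C3 manifold_R manifold_G manifold_C2
        smooth_face12 smooth_face23)
  have "smooth_map_on (composable R) ?S (mfd G \<times>\<^sub>M\<^sub>f C2) (\<lambda>(x, p). cmp R x p)"
    using gpd(3) by simp
  moreover have "(\<lambda>z. ((\<one>\<^bsub>G\<^esub>, face12 z), (\<one>\<^bsub>G\<^esub>, face23 z))) ` points C3 \<subseteq> composable R"
    by (auto simp: points_C3 intro!: composableI)
  ultimately have "smooth_map C3 (mfd G \<times>\<^sub>M\<^sub>f C2)
      (\<lambda>z. (\<lambda>(x, p). cmp R x p) ((\<one>\<^bsub>G\<^esub>, face12 z), (\<one>\<^bsub>G\<^esub>, face23 z)))"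
    by (intro smooth_map_on_compose[OF manifold_C3 S manifold_R _ g])
  from smooth_map_compose[OF manifold_C3 manifold_R manifold_G this smooth_map_fst[OF manifold_G manifold_C2]]
  show ?thesis by (simp add: ext_\<gamma>_def[abs_def])
qed

lemma ext_cocycle: "(L, \<gamma>) \<in> cocycles X N I U"
proof -
  have "\<rho> (\<gamma> ((i, k, l), x)) \<otimes>\<^bsub>H\<^esub> L ((i, l), x) = L ((i, k), x) \<otimes>\<^bsub>H\<^esub> L ((k, l), x)"
    if c: "i \<in> I" "k \<in> I" "l \<in> I" "x \<in> U i" "x \<in> U k" "x \<in> U l" for i k l x
  proof -
    have "la (cmp R (\<one>\<^bsub>G\<^esub>, ((i, k), x)) (\<one>\<^bsub>G\<^esub>, ((k, l), x))) ((l, x), \<one>\<^bsub>H\<^esub>) =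
        la (\<one>\<^bsub>G\<^esub>, ((i, k), x)) (la (\<one>\<^bsub>G\<^esub>, ((k, l), x)) ((l, x), \<one>\<^bsub>H\<^esub>))"
      using c by (intro la_cmp composableI) auto
    then show ?thesis using c by (simp add: cmp_ones la_formula)
  qed
  moreover have "\<gamma> ((i, k, l), x) \<otimes>\<^bsub>G\<^esub> \<gamma> ((i, l, m), x) =
      \<alpha> (L ((i, k), x)) (\<gamma> ((k, l, m), x)) \<otimes>\<^bsub>G\<^esub> \<gamma> ((i, k, m), x)"
    if c: "i \<in> I" "k \<in> I" "l \<in> I" "m \<in> I" "x \<in> U i" "x \<in> U k" "x \<in> U l" "x \<in> U m" for i k l m x
  proof -
    have "cmp R (cmp R (\<one>\<^bsub>G\<^esub>, ((i, k), x)) (\<one>\<^bsub>G\<^esub>, ((k, l), x))) (\<one>\<^bsub>G\<^esub>, ((l, m), x)) =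
        cmp R (\<one>\<^bsub>G\<^esub>, ((i, k), x)) (cmp R (\<one>\<^bsub>G\<^esub>, ((k, l), x)) (\<one>\<^bsub>G\<^esub>, ((l, m), x)))"
      using c by (intro cmp_assoc composableI) auto
    then show ?thesis using c by (simp add: cmp_ones cmp_formula)
  qed
  \<comment> \<open>Condition (4) of adaptedness yields the normalisation of the cocycle.\<close>
  moreover have "\<gamma> ((i, i, k), x) = \<one>\<^bsub>G\<^esub>" if "i \<in> I" "k \<in> I" "x \<in> U i" "x \<in> U k" for i k x
    using that cmp_ones(1)[of i i k x] by (simp add: cmp_unit)
  ultimately show ?thesis
    using smooth_L smooth_\<gamma> by (auto simp: cocycles_def Let_def)
qed

end

section \<open>Isomorphic extensions and cohomologous cocycles\<close>

lemma gh_isoD: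
  assumes "gh_iso X E E' \<Phi> \<Psi>"
  shows "morphism_over_id (ext_gpd E) (ext_gpd E') \<Phi>"
    and "r \<in> arrows (ext_gpd E) \<Longrightarrow> ext_proj E' (\<Phi> r) = ext_proj E r"
    and "smooth_map (ext_bdl E) (ext_bdl E') \<Psi>"
    and "p \<in> points (ext_bdl E) \<Longrightarrow> bdl_proj E' (\<Psi> p) = bdl_proj E p"
    and "\<lbrakk>r \<in> arrows (ext_gpd E); p \<in> points (ext_bdl E); h \<in> carrier (grpH X);
        tgt (ext_gpd E) r = bdl_proj E p\<rbrakk> \<Longrightarrow>
      \<Psi> (bdl_right E (bdl_left E r p) h) = bdl_right E' (bdl_left E' (\<Phi> r) (\<Psi> p)) h"
    and "p \<in> points (ext_bdl E) \<Longrightarrow> ext_chi E' (\<Psi> p) = band_map (grpG X) \<Phi> (ext_chi E p)"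
  using assms unfolding gh_iso_def Let_def diffeomorphism_def by blast+

text \<open>Passes between multiplicativity of an isomorphism, stated with \<open>u\<close>, and the
  second coboundary equation, stated with the inverse \<open>v\<close> of \<open>u\<close>; it
  serves both directions of the correspondence.\<close>

lemma (in group) cancel_across:
  assumes "a \<otimes> b = c \<otimes> d \<otimes> e" "a \<in> carrier G" "b \<in> carrier G" "c \<in> carrier G" "d \<in> carrier G"
    "e \<in> carrier G"
  shows "e \<otimes> inv b = inv d \<otimes> inv c \<otimes> a"
proof -
  have "inv d \<otimes> inv c \<otimes> a = inv d \<otimes> inv c \<otimes> (a \<otimes> b) \<otimes> inv b"
    using assms(2-) by (simp add: m_assoc)
  also have "\<dots> = e \<otimes> inv b"
    unfolding assms(1) using assms(2-) by (simp add: m_assoc)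
  finally show ?thesis by simp
qed

context crossed_cover
begin

lemma gh_iso_imp_cohomologous:
  assumes E: "E \<in> adapted_exts X N I U" and E': "E' \<in> adapted_exts X N I U"
    and iso: "gh_iso X E E' \<Phi> \<Psi>"
  shows "((ext_L E, ext_\<gamma> E), (ext_L E', ext_\<gamma> E')) \<in> cohomologous X N I U"
proof -
  interpret A: adapted_ext X N I U E by unfold_locales (rule E)
  interpret B: adapted_ext X N I U E' by unfold_locales (rule E')
  note iso' = gh_isoD[OF iso] and mor = morphism_over_idD[OF gh_isoD(1)[OF iso]]
  define r where "r = (\<lambda>m. snd (\<Psi> (m, \<one>\<^bsub>H\<^esub>)))"
  \<comment> \<open>The coboundary will be \<open>(r, v)\<close> with \<open>v\<close> the inverse
    of \<open>u\<close>.\<close>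
  define u where "u = (\<lambda>y. fst (\<Phi> (\<one>\<^bsub>G\<^esub>, y)))"
  have \<Phi>_closed: "\<Phi> p \<in> carrier G \<times> points C2" if "p \<in> carrier G \<times> points C2" for p
    using smooth_map_funcset[OF mor(1), of p] that by simp
  have \<Phi>_snd: "snd (\<Phi> p) = snd p" if "p \<in> carrier G \<times> points C2" for p
    using iso'(2)[of p] B.proj_E[OF \<Phi>_closed[OF that]] A.proj_E[OF that] that by simp
  have \<Psi>_closed: "\<Psi> p \<in> points C1 \<times> carrier H" if "p \<in> points C1 \<times> carrier H" for p
    using smooth_map_funcset[OF iso'(3), of p] that by simp
  have \<Psi>_fst: "fst (\<Psi> p) = fst p" if "p \<in> points C1 \<times> carrier H" for p
    using iso'(4)[of p] B.bdl_proj_E[OF \<Psi>_closed[OF that]] A.bdl_proj_E[OF that] that by simp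
  have r: "smooth_map C1 (mfd H) r"
  proof -
    have "smooth_map C1 (C1 \<times>\<^sub>M\<^sub>f mfd H) (\<lambda>m. (m, \<one>\<^bsub>H\<^esub>))"
      by (intro smooth_map_Pair smooth_ops manifold_C1 manifold_H smooth_map_id)
    from smooth_map_compose[OF manifold_C1 manifold_P manifold_P this]
    have "smooth_map C1 (C1 \<times>\<^sub>M\<^sub>f mfd H) (\<lambda>m. \<Psi> (m, \<one>\<^bsub>H\<^esub>))" using iso'(3) by simp
    from smooth_map_compose[OF manifold_C1 manifold_P manifold_H this smooth_map_snd[OF manifold_C1 manifold_H]]
    show ?thesis by (simp add: r_def)
  qed
  have u: "smooth_map C2 (mfd G) u"
  proof -
    have "smooth_map C2 (mfd G \<times>\<^sub>M\<^sub>f C2) (\<lambda>y. (\<one>\<^bsub>G\<^esub>, y))"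
      by (intro smooth_map_Pair smooth_ops manifold_C2 manifold_G smooth_map_id)
    from smooth_map_compose[OF manifold_C2 manifold_R manifold_R this]
    have "smooth_map C2 (mfd G \<times>\<^sub>M\<^sub>f C2) (\<lambda>y. \<Phi> (\<one>\<^bsub>G\<^esub>, y))" using mor(1) by simp
    from smooth_map_compose[OF manifold_C2 manifold_R manifold_G this smooth_map_fst[OF manifold_G manifold_C2]]
    show ?thesis by (simp add: u_def)
  qed
  note [simp] = cover_closed(2)[OF r, simplified] cover_closed(3)[OF u, simplified]
  have \<Psi>_one: "\<Psi> ((i, x), \<one>\<^bsub>H\<^esub>) = ((i, x), r (i, x))" if "i \<in> I" "x \<in> U i" for i x
    using \<Psi>_fst[of "((i, x), \<one>\<^bsub>H\<^esub>)"] that by (simp add: points_C1 r_def prod_eq_iff)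
  have \<Phi>_one: "\<Phi> (\<one>\<^bsub>G\<^esub>, ((i, k), x)) = (u ((i, k), x), ((i, k), x))"
    if "i \<in> I" "k \<in> I" "x \<in> U i" "x \<in> U k" for i k x
    using \<Phi>_snd[of "(\<one>\<^bsub>G\<^esub>, ((i, k), x))"] that by (simp add: points_C2 u_def prod_eq_iff)
  \<comment> \<open>\<open>gh_iso\<close> states left and right equivariance jointly; here it is
    tested on the arrow \<open>(e, x_ik)\<close>, the point \<open>(x_k, e)\<close> and
    \<open>h\<close>.\<close>
  have equivariant: "\<Psi> ((i, x), A.L ((i, k), x) \<otimes>\<^bsub>H\<^esub> h) =
      ((i, x), \<rho> (u ((i, k), x)) \<otimes>\<^bsub>H\<^esub> B.L ((i, k), x) \<otimes>\<^bsub>H\<^esub> r (k, x) \<otimes>\<^bsub>H\<^esub> h)"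
    if c: "i \<in> I" "k \<in> I" "x \<in> U i" "x \<in> U k" "h \<in> carrier H" for i k x h
  proof -
    let ?a = "(\<one>\<^bsub>G\<^esub>, ((i, k), x))" and ?p = "((k, x), \<one>\<^bsub>H\<^esub>)"
    have a: "?a \<in> carrier G \<times> points C2" and p: "?p \<in> points C1 \<times> carrier H"
      using c by (auto simp: points_C1 points_C2)
    have t: "tgt A.R ?a = bdl_proj E ?p" unfolding A.tgt_R[OF a] A.bdl_proj_E[OF p] by simp
    have "\<Psi> (A.ra (A.la ?a ?p) h) = B.ra (B.la (\<Phi> ?a) (\<Psi> ?p)) h"
      by (rule iso'(5)[OF _ _ _ t]) (use a p c in simp_all)
    then show ?thesis
      using c by (simp add: \<Phi>_one \<Psi>_one A.la_formula B.la_formula A.ra_E B.ra_E points_C1)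
  qed
  have \<Phi>_unit: "\<Phi> (\<one>\<^bsub>G\<^esub>, ((i, i), x)) = (\<one>\<^bsub>G\<^esub>, ((i, i), x))" if "i \<in> I" "x \<in> U i" for i x
    using mor(5)[of "(i, x)"] that by (simp add: A.idt_R B.idt_R points_C1)
  interpret CA: cech_cocycle X N I U "A.L" "A.\<gamma>" by unfold_locales (rule A.ext_cocycle)
  interpret CB: cech_cocycle X N I U "B.L" "B.\<gamma>" by unfold_locales (rule B.ext_cocycle)
  have u_unit: "u ((i, i), x) = \<one>\<^bsub>G\<^esub>" if "i \<in> I" "x \<in> U i" for i x
    using \<Phi>_unit[OF that] by (simp add: u_def)
  \<comment> \<open>For \<open>k = i\<close> the factors \<open>L_ii\<close> and \<open>u_ii\<close>
    are trivial, which leaves right equivariance by itself.\<close>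
  have \<Psi>: "\<Psi> ((i, x), h) = ((i, x), r (i, x) \<otimes>\<^bsub>H\<^esub> h)" if "i \<in> I" "x \<in> U i" "h \<in> carrier H" for i x h
    using equivariant[of i i x h] that by (simp add: u_unit)
  \<comment> \<open>Over the units, compatibility with \<open>\<chi>\<close> at the point
    \<open>(x_i, e)\<close> determines the isomorphism.\<close>
  have \<Phi>_diag: "\<Phi> (g, ((i, i), x)) = (\<alpha> (r (i, x)) g, ((i, i), x))"
    if c: "g \<in> carrier G" "i \<in> I" "x \<in> U i" for g i x
  proof -
    have "ext_chi E' (\<Psi> ((i, x), \<one>\<^bsub>H\<^esub>)) = band_map G \<Phi> (ext_chi E ((i, x), \<one>\<^bsub>H\<^esub>))"
      by (rule iso'(6)) (use c in \<open>simp add: points_C1\<close>)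
    then have "snd (ext_chi E' (\<Psi> ((i, x), \<one>\<^bsub>H\<^esub>))) g = snd (band_map G \<Phi> (ext_chi E ((i, x), \<one>\<^bsub>H\<^esub>))) g"
      by simp
    then show ?thesis using c by (simp add: \<Psi>_one A.chi_E B.chi_E band_map_def)
  qed
  \<comment> \<open>Apply multiplicativity to the factorisation of \<open>(g, x_ik)\<close> into
    \<open>(g, x_ii)\<close> and \<open>(e, x_ik)\<close>.\<close>
  have \<Phi>: "\<Phi> (g, ((i, k), x)) = (\<alpha> (r (i, x)) g \<otimes>\<^bsub>G\<^esub> u ((i, k), x), ((i, k), x))"
    if c: "g \<in> carrier G" "i \<in> I" "k \<in> I" "x \<in> U i" "x \<in> U k" for g i k x
  proof -
    have "((g, ((i, i), x)), (\<one>\<^bsub>G\<^esub>, ((i, k), x))) \<in> composable A.R"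
      using c by (intro A.composableI) auto
    from mor(6)[OF this] show ?thesis
      using c by (simp add: A.cmp_unit B.cmp_unit \<Phi>_diag \<Phi>_one)
  qed
  show ?thesis
    unfolding cohomologous_iff
  proof (intro conjI A.ext_cocycle B.ext_cocycle exI ballI)
    show "smooth_map C1 (mfd H) r" by (rule r)
    show "smooth_map C2 (mfd G) (\<lambda>y. inv\<^bsub>G\<^esub> (u y))" by (intro smooth_ops manifold_C2 u)
  next
    fix i k x assume "i \<in> I" "k \<in> I" "x \<in> U i \<inter> U k"
    then have c: "i \<in> I" "k \<in> I" "x \<in> U i" "x \<in> U k" by auto
    have "r (i, x) \<otimes>\<^bsub>H\<^esub> A.L ((i, k), x) = \<rho> (u ((i, k), x)) \<otimes>\<^bsub>H\<^esub> B.L ((i, k), x) \<otimes>\<^bsub>H\<^esub> r (k, x)"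
      using equivariant[of i k x "\<one>\<^bsub>H\<^esub>"] c by (simp add: \<Psi>)
    then show "B.L ((i, k), x) = \<rho> (inv\<^bsub>G\<^esub> (u ((i, k), x))) \<otimes>\<^bsub>H\<^esub> r (i, x) \<otimes>\<^bsub>H\<^esub>
        A.L ((i, k), x) \<otimes>\<^bsub>H\<^esub> inv\<^bsub>H\<^esub> (r (k, x))"
      using c by (simp add: H.m_assoc)
  next
    fix i k l x assume "i \<in> I" "k \<in> I" "l \<in> I" "x \<in> U i \<inter> U k \<inter> U l"
    then have c: "i \<in> I" "k \<in> I" "l \<in> I" "x \<in> U i" "x \<in> U k" "x \<in> U l" by auto
    have "((\<one>\<^bsub>G\<^esub>, ((i, k), x)), (\<one>\<^bsub>G\<^esub>, ((k, l), x))) \<in> composable A.R"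
      using c by (intro A.composableI) auto
    from mor(6)[OF this]
    have "\<alpha> (r (i, x)) (A.\<gamma> ((i, k, l), x)) \<otimes>\<^bsub>G\<^esub> u ((i, l), x) =
        u ((i, k), x) \<otimes>\<^bsub>G\<^esub> \<alpha> (B.L ((i, k), x)) (u ((k, l), x)) \<otimes>\<^bsub>G\<^esub> B.\<gamma> ((i, k, l), x)"
      using c by (simp add: A.cmp_formula B.cmp_formula \<Phi>)
    from G.cancel_across[OF this]
    show "B.\<gamma> ((i, k, l), x) \<otimes>\<^bsub>G\<^esub> inv\<^bsub>G\<^esub> (u ((i, l), x)) =
        \<alpha> (B.L ((i, k), x)) (inv\<^bsub>G\<^esub> (u ((k, l), x))) \<otimes>\<^bsub>G\<^esub> inv\<^bsub>G\<^esub> (u ((i, k), x)) \<otimes>\<^bsub>G\<^esub>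
        \<alpha> (r (i, x)) (A.\<gamma> ((i, k, l), x))"
      using c by simp
  qed
qed

lemma cohomologous_imp_gh_iso:
  assumes E: "E \<in> adapted_exts X N I U" and E': "E' \<in> adapted_exts X N I U"
    and coh: "((ext_L E, ext_\<gamma> E), (ext_L E', ext_\<gamma> E')) \<in> cohomologous X N I U"
  shows "\<exists>\<Phi> \<Psi>. gh_iso X E E' \<Phi> \<Psi>"
proof -
  interpret A: adapted_ext X N I U E by unfold_locales (rule E)
  interpret B: adapted_ext X N I U E' by unfold_locales (rule E')
  interpret CA: cech_cocycle X N I U "A.L" "A.\<gamma>" by unfold_locales (rule A.ext_cocycle)
  interpret CB: cech_cocycle X N I U "B.L" "B.\<gamma>" by unfold_locales (rule B.ext_cocycle)
  from coh[unfolded cohomologous_iff] obtain r v where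
    r: "smooth_map C1 (mfd H) r" and v: "smooth_map C2 (mfd G) v" and
    e1: "\<And>i k x. i \<in> I \<Longrightarrow> k \<in> I \<Longrightarrow> x \<in> U i \<Longrightarrow> x \<in> U k \<Longrightarrow> B.L ((i, k), x) =
       \<rho> (v ((i, k), x)) \<otimes>\<^bsub>H\<^esub> r (i, x) \<otimes>\<^bsub>H\<^esub> A.L ((i, k), x) \<otimes>\<^bsub>H\<^esub> inv\<^bsub>H\<^esub> (r (k, x))" and
    e2: "\<And>i k l x. i \<in> I \<Longrightarrow> k \<in> I \<Longrightarrow> l \<in> I \<Longrightarrow> x \<in> U i \<Longrightarrow> x \<in> U k \<Longrightarrow> x \<in> U l \<Longrightarrow>
       B.\<gamma> ((i, k, l), x) \<otimes>\<^bsub>G\<^esub> v ((i, l), x) =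
       \<alpha> (B.L ((i, k), x)) (v ((k, l), x)) \<otimes>\<^bsub>G\<^esub> v ((i, k), x)
         \<otimes>\<^bsub>G\<^esub> \<alpha> (r (i, x)) (A.\<gamma> ((i, k, l), x))"
    by auto
  note [simp] = cover_closed(2)[OF r, simplified] cover_closed(3)[OF v, simplified]
  \<comment> \<open>At \<open>(i, i, i)\<close> all values of \<open>L\<close> and
    \<open>\<gamma>\<close> are trivial and the second coboundary equation becomes
    \<open>v_ii = v_ii v_ii\<close>. This is what makes \<open>\<Phi>\<close> preserve units and
    respect \<open>\<chi>\<close>.\<close>
  have v_unit: "v ((i, i), x) = \<one>\<^bsub>G\<^esub>" if "i \<in> I" "x \<in> U i" for i x
    using e2[of i i i x] that by simp
  define \<Phi> where "\<Phi> = (\<lambda>p. (\<alpha> (r (fst2 (snd p))) (fst p) \<otimes>\<^bsub>G\<^esub> inv\<^bsub>G\<^esub> (v (snd p)), snd p))"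
  define \<Psi> where "\<Psi> = (\<lambda>p. (fst p, r (fst p) \<otimes>\<^bsub>H\<^esub> snd p))"
  define \<Phi>' where "\<Phi>' = (\<lambda>p. (\<alpha> (inv\<^bsub>H\<^esub> (r (fst2 (snd p)))) (fst p \<otimes>\<^bsub>G\<^esub> v (snd p)), snd p))"
  define \<Psi>' where "\<Psi>' = (\<lambda>p. (fst p, inv\<^bsub>H\<^esub> (r (fst p)) \<otimes>\<^bsub>H\<^esub> snd p))"
  note smR = smooth_snd_R'[OF smooth_fst2' [OF r manifold_H] manifold_H] smooth_snd_R'[OF v manifold_G]
  have s\<Phi>: "smooth_map (mfd G \<times>\<^sub>M\<^sub>f C2) (mfd G \<times>\<^sub>M\<^sub>f C2) \<Phi>"
    unfolding \<Phi>_def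
    by (intro smooth_map_Pair smooth_ops manifold_R manifold_G manifold_C2 fst_R snd_R smR)
  have s\<Phi>': "smooth_map (mfd G \<times>\<^sub>M\<^sub>f C2) (mfd G \<times>\<^sub>M\<^sub>f C2) \<Phi>'"
    unfolding \<Phi>'_def
    by (intro smooth_map_Pair smooth_ops manifold_R manifold_G manifold_C2 fst_R snd_R smR)
  have s\<Psi>: "smooth_map (C1 \<times>\<^sub>M\<^sub>f mfd H) (C1 \<times>\<^sub>M\<^sub>f mfd H) \<Psi>"
    unfolding \<Psi>_def
    by (intro smooth_map_Pair smooth_ops manifold_P manifold_H manifold_C1 fst_P snd_P
        smooth_fst_P'[OF r])
  have s\<Psi>': "smooth_map (C1 \<times>\<^sub>M\<^sub>f mfd H) (C1 \<times>\<^sub>M\<^sub>f mfd H) \<Psi>'"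
    unfolding \<Psi>'_def
    by (intro smooth_map_Pair smooth_ops manifold_P manifold_H manifold_C1 fst_P snd_P
        smooth_fst_P'[OF r])
  have d\<Phi>: "diffeomorphism (mfd G \<times>\<^sub>M\<^sub>f C2) (mfd G \<times>\<^sub>M\<^sub>f C2) \<Phi>"
    by (rule diffeomorphismI[OF manifold_R manifold_R s\<Phi> s\<Phi>'])
      (auto simp: \<Phi>_def \<Phi>'_def points_C2 G.m_assoc simp del: jact_mult)
  have d\<Psi>: "diffeomorphism (C1 \<times>\<^sub>M\<^sub>f mfd H) (C1 \<times>\<^sub>M\<^sub>f mfd H) \<Psi>"
    by (rule diffeomorphismI[OF manifold_P manifold_P s\<Psi> s\<Psi>']) (auto simp: \<Psi>_def \<Psi>'_def points_C1)
  have \<Phi>_eq: "\<Phi> (g, ((i, k), x)) = (\<alpha> (r (i, x)) g \<otimes>\<^bsub>G\<^esub> inv\<^bsub>G\<^esub> (v ((i, k), x)), ((i, k), x))" for g i k x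
    by (simp add: \<Phi>_def)
  have \<Psi>_eq: "\<Psi> (m, h) = (m, r m \<otimes>\<^bsub>H\<^esub> h)" for m h by (simp add: \<Psi>_def)
  have arrowE: "\<exists>g i k x. p = (g, ((i, k), x)) \<and> g \<in> carrier G \<and> i \<in> I \<and> k \<in> I \<and> x \<in> U i \<and> x \<in> U k"
    if "p \<in> carrier G \<times> points C2" for p
    using that by (auto simp: points_C2)
  \<comment> \<open>The first coboundary equation freed of the inverse of \<open>r_k\<close>, so
    that \<open>jact_rho_mult\<close> applies to its right-hand side.\<close>
  have L_r: "B.L ((i, k), x) \<otimes>\<^bsub>H\<^esub> r (k, x) = \<rho> (v ((i, k), x)) \<otimes>\<^bsub>H\<^esub> (r (i, x) \<otimes>\<^bsub>H\<^esub> A.L ((i, k), x))"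
    if "i \<in> I" "k \<in> I" "x \<in> U i" "x \<in> U k" for i k x
    unfolding e1[OF that] using that by (simp add: H.m_assoc)
  have cmp: "\<Phi> (cmp A.R a b) = cmp B.R (\<Phi> a) (\<Phi> b)" if ab: "(a, b) \<in> composable A.R" for a b
  proof -
    have "a \<in> carrier G \<times> points C2" "b \<in> carrier G \<times> points C2" "tgt A.R a = src A.R b"
      using ab by (simp_all add: composable_def)
    then obtain g i k x g' l where *: "a = (g, ((i, k), x))" "b = (g', ((k, l), x))" and
      c: "g \<in> carrier G" "g' \<in> carrier G" "i \<in> I" "k \<in> I" "l \<in> I" "x \<in> U i" "x \<in> U k" "x \<in> U l"
      using arrowE[of a] arrowE[of b] by auto
    let ?v = "v ((i, k), x)" and ?w = "\<alpha> (r (i, x)) (\<alpha> (A.L ((i, k), x)) g')"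
    have 1: "\<alpha> (B.L ((i, k), x)) (\<alpha> (r (k, x)) g') \<otimes>\<^bsub>G\<^esub> ?v = ?v \<otimes>\<^bsub>G\<^esub> ?w"
      using c jact_rho_mult[of ?v "r (i, x) \<otimes>\<^bsub>H\<^esub> A.L ((i, k), x)" g'] by (simp add: jact_comp flip: L_r)
    have 2: "inv\<^bsub>G\<^esub> ?v \<otimes>\<^bsub>G\<^esub> \<alpha> (B.L ((i, k), x)) (\<alpha> (r (k, x)) g') = ?w \<otimes>\<^bsub>G\<^esub> inv\<^bsub>G\<^esub> ?v"
    proof -
      have "\<alpha> (B.L ((i, k), x)) (\<alpha> (r (k, x)) g') = ?v \<otimes>\<^bsub>G\<^esub> ?w \<otimes>\<^bsub>G\<^esub> inv\<^bsub>G\<^esub> ?v"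
        using c by (simp add: G.m_assoc flip: 1)
      then show ?thesis using c by (simp add: G.m_assoc)
    qed
    \<comment> \<open>The second coboundary equation rearranged to trade the \<open>\<gamma>\<close>
      of the target extension for that of the source.\<close>
    have 3: "inv\<^bsub>G\<^esub> ?v \<otimes>\<^bsub>G\<^esub> inv\<^bsub>G\<^esub> (\<alpha> (B.L ((i, k), x)) (v ((k, l), x))) \<otimes>\<^bsub>G\<^esub> B.\<gamma> ((i, k, l), x) =
        \<alpha> (r (i, x)) (A.\<gamma> ((i, k, l), x)) \<otimes>\<^bsub>G\<^esub> inv\<^bsub>G\<^esub> (v ((i, l), x))"
      using c by (intro G.cancel_across[symmetric] e2) auto
    have "\<alpha> (r (i, x)) g \<otimes>\<^bsub>G\<^esub> inv\<^bsub>G\<^esub> ?v \<otimes>\<^bsub>G\<^esub>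
          \<alpha> (B.L ((i, k), x)) (\<alpha> (r (k, x)) g' \<otimes>\<^bsub>G\<^esub> inv\<^bsub>G\<^esub> (v ((k, l), x))) \<otimes>\<^bsub>G\<^esub> B.\<gamma> ((i, k, l), x) =
        \<alpha> (r (i, x)) g \<otimes>\<^bsub>G\<^esub> (inv\<^bsub>G\<^esub> ?v \<otimes>\<^bsub>G\<^esub> \<alpha> (B.L ((i, k), x)) (\<alpha> (r (k, x)) g')) \<otimes>\<^bsub>G\<^esub>
          inv\<^bsub>G\<^esub> (\<alpha> (B.L ((i, k), x)) (v ((k, l), x))) \<otimes>\<^bsub>G\<^esub> B.\<gamma> ((i, k, l), x)"
      using c by (simp add: G.m_assoc)
    also have "\<dots> = \<alpha> (r (i, x)) g \<otimes>\<^bsub>G\<^esub> ?w \<otimes>\<^bsub>G\<^esub>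
        (inv\<^bsub>G\<^esub> ?v \<otimes>\<^bsub>G\<^esub> inv\<^bsub>G\<^esub> (\<alpha> (B.L ((i, k), x)) (v ((k, l), x))) \<otimes>\<^bsub>G\<^esub> B.\<gamma> ((i, k, l), x))"
      unfolding 2 using c by (simp add: G.m_assoc)
    also have "\<dots> = \<alpha> (r (i, x)) g \<otimes>\<^bsub>G\<^esub> ?w \<otimes>\<^bsub>G\<^esub>
        (\<alpha> (r (i, x)) (A.\<gamma> ((i, k, l), x)) \<otimes>\<^bsub>G\<^esub> inv\<^bsub>G\<^esub> (v ((i, l), x)))"
      unfolding 3 ..
    finally show ?thesis
      using c by (simp add: * A.cmp_formula B.cmp_formula \<Phi>_eq G.m_assoc)
  qed
  have mor: "morphism_over_id A.R B.R \<Phi>"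
    unfolding morphism_over_id_def
  proof (intro conjI ballI)
    show "smooth_map (arr A.R) (arr B.R) \<Phi>" using s\<Phi> by simp
    fix p assume "p \<in> arrows A.R"
    then have p: "p \<in> carrier G \<times> points C2" by simp
    have "\<Phi> p \<in> carrier G \<times> points C2" using smooth_map_funcset[OF s\<Phi>, of p] p by simp
    then show "src B.R (\<Phi> p) = src A.R p" "tgt B.R (\<Phi> p) = tgt A.R p"
      using p by (simp_all del: mem_Sigma_iff) (simp_all add: \<Phi>_def)
  next
    fix m assume "m \<in> objects A.R"
    then obtain i x where "m = (i, x)" "i \<in> I" "x \<in> U i" by (auto simp: points_C1)
    then show "\<Phi> (idt A.R m) = idt B.R m" by (simp add: A.idt_R B.idt_R \<Phi>_eq v_unit)
  qed (use cmp in auto)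
  have "gh_iso X E E' \<Phi> \<Psi>"
    unfolding gh_iso_def Let_def
  proof (intro conjI mor ballI impI)
    show "diffeomorphism (arr A.R) (arr B.R) \<Phi>" "diffeomorphism (ext_bdl E) (ext_bdl E') \<Psi>"
      using d\<Phi> d\<Psi> by simp_all
    fix a assume a0: "a \<in> arrows A.R"
    then have a: "a \<in> carrier G \<times> points C2" by simp
    have "\<Phi> a \<in> carrier G \<times> points C2" using smooth_map_funcset[OF s\<Phi>, of a] a by simp
    then show "ext_proj E' (\<Phi> a) = ext_proj E a"
      using a by (simp del: mem_Sigma_iff) (simp add: \<Phi>_def)
    fix p h assume "p \<in> points (ext_bdl E)" and h: "h \<in> carrier H" and t: "tgt A.R a = bdl_proj E p"
    then have p: "p \<in> points C1 \<times> carrier H" by simp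
    from t A.tgt_R[OF a] A.bdl_proj_E[OF p] have "snd2 (snd a) = fst p" by simp
    with arrowE[OF a] p obtain g i k x h' where *: "a = (g, ((i, k), x))" "p = ((k, x), h')" and
      c: "g \<in> carrier G" "h' \<in> carrier H" "i \<in> I" "k \<in> I" "x \<in> U i" "x \<in> U k"
      by auto
    have "\<rho> (\<alpha> (r (i, x)) g \<otimes>\<^bsub>G\<^esub> inv\<^bsub>G\<^esub> (v ((i, k), x))) \<otimes>\<^bsub>H\<^esub> B.L ((i, k), x) \<otimes>\<^bsub>H\<^esub> (r (k, x) \<otimes>\<^bsub>H\<^esub> h') =
        \<rho> (\<alpha> (r (i, x)) g \<otimes>\<^bsub>G\<^esub> inv\<^bsub>G\<^esub> (v ((i, k), x))) \<otimes>\<^bsub>H\<^esub> (B.L ((i, k), x) \<otimes>\<^bsub>H\<^esub> r (k, x)) \<otimes>\<^bsub>H\<^esub> h'"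
      using c by (simp add: H.m_assoc)
    also have "\<dots> = r (i, x) \<otimes>\<^bsub>H\<^esub> (\<rho> g \<otimes>\<^bsub>H\<^esub> A.L ((i, k), x) \<otimes>\<^bsub>H\<^esub> h')"
      using c by (simp add: L_r rho_jact H.m_assoc)
    finally show "\<Psi> (A.ra (A.la a p) h) = B.ra (B.la (\<Phi> a) (\<Psi> p)) h"
      using c h by (simp add: * \<Phi>_eq \<Psi>_eq A.la_formula B.la_formula A.ra_E B.ra_E points_C1 H.m_assoc)
  next
    fix p assume "p \<in> points (ext_bdl E)"
    then have p: "p \<in> points C1 \<times> carrier H" by simp
    have p': "\<Psi> p \<in> points C1 \<times> carrier H" using smooth_map_funcset[OF s\<Psi>, of p] p by simp
    show "bdl_proj E' (\<Psi> p) = bdl_proj E p"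
      unfolding A.bdl_proj_E[OF p] B.bdl_proj_E[OF p'] by (simp add: \<Psi>_def)
    from p obtain i x h where *: "p = ((i, x), h)" and c: "i \<in> I" "x \<in> U i" "h \<in> carrier H"
      by (auto simp: points_C1)
    show "ext_chi E' (\<Psi> p) = band_map G \<Phi> (ext_chi E p)"
      using c by (auto simp: * \<Psi>_eq \<Phi>_eq A.chi_E B.chi_E band_map_def jact_comp v_unit restrict_def)
  qed
  then show ?thesis by blast
qed

text \<open>Cochains are total functions with arbitrary values off the overlaps, so the cocycle read
  off from its extension agrees with the original only on the overlaps. The trivial coboundary
  accounts for this.\<close>

lemma cohomologous_cocycle_ext:
  assumes "(L, \<gamma>) \<in> cocycles X N I U"
  shows "((ext_L (cocycle_ext L \<gamma>), ext_\<gamma> (cocycle_ext L \<gamma>)), (L, \<gamma>)) \<in> cohomologous X N I U"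
proof -
  interpret C: cech_cocycle X N I U L \<gamma> by unfold_locales (rule assms)
  interpret A: adapted_ext X N I U "C.E" by unfold_locales (rule C.adapted_cocycle_ext)
  have "A.L ((i, k), x) = L ((i, k), x)" if "i \<in> I" "k \<in> I" "x \<in> U i" "x \<in> U k" for i k x
    using that by (simp add: ext_L_def)
  moreover have "A.\<gamma> ((i, k, l), x) = \<gamma> ((i, k, l), x)"
    if "i \<in> I" "k \<in> I" "l \<in> I" "x \<in> U i" "x \<in> U k" "x \<in> U l" for i k l x
    using that by (simp add: ext_\<gamma>_def)
  ultimately show ?thesis
    unfolding cohomologous_iff
    by (intro conjI assms A.ext_cocycle exI[of _ "\<lambda>_. \<one>\<^bsub>H\<^esub>"] exI[of _ "\<lambda>_. \<one>\<^bsub>G\<^esub>"])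
      (auto intro: smooth_ops manifold_C1 manifold_C2)
qed

end

text \<open>The bijection sends a class of \<open>r\<close> to its preimage under \<open>f\<close>.
  Since \<open>f\<close> meets every class, preimages are nonempty and determine the class; as
  \<open>s\<close> is the pullback of \<open>r\<close>, the preimage of the class of
  \<open>f y\<close> is the class of \<open>y\<close>.\<close>

lemma quotient_bij_betw:
  assumes r: "equiv A r" and f: "f ` B \<subseteq> A"
    and s: "s = {(x, y). x \<in> B \<and> y \<in> B \<and> (f x, f y) \<in> r}"
    and onto: "\<And>a. a \<in> A \<Longrightarrow> \<exists>x\<in>B. (f x, a) \<in> r"
  shows "\<exists>F. bij_betw F (A // r) (B // s)"
proof -
  have "bij_betw (\<lambda>C. {x \<in> B. f x \<in> C}) (A // r) (B // s)"
    unfolding bij_betw_def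
  proof
    show "inj_on (\<lambda>C. {x \<in> B. f x \<in> C}) (A // r)"
    proof (rule inj_onI)
      fix C D assume C: "C \<in> A // r" and D: "D \<in> A // r"
        and eq: "{x \<in> B. f x \<in> C} = {x \<in> B. f x \<in> D}"
      from C obtain a where a: "a \<in> A" "C = r `` {a}" by (rule quotientE)
      with onto obtain x where x: "x \<in> B" "(f x, a) \<in> r" by blast
      then have "f x \<in> C" using a r by (auto simp: equiv_def sym_def)
      with x eq have "f x \<in> D" by blast
      with \<open>f x \<in> C\<close> show "C = D" using quotient_disj[OF r C D] by blast
    qed
    have eq: "{x \<in> B. f x \<in> r `` {f y}} = s `` {y}" if "y \<in> B" for y
      using that s by auto
    show "(\<lambda>C. {x \<in> B. f x \<in> C}) ` (A // r) = B // s"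
    proof (intro equalityI subsetI)
      fix S assume "S \<in> (\<lambda>C. {x \<in> B. f x \<in> C}) ` (A // r)"
      then obtain a where a: "a \<in> A" "S = {x \<in> B. f x \<in> r `` {a}}"
        by (auto elim!: quotientE)
      with onto obtain y where y: "y \<in> B" "(f y, a) \<in> r" by blast
      with a have "S = s `` {y}" using eq[OF y(1)] equiv_class_eq[OF r y(2)] by simp
      with y show "S \<in> B // s" by (simp add: quotientI)
    next
      fix S assume "S \<in> B // s"
      then obtain y where y: "y \<in> B" "S = s `` {y}" by (rule quotientE)
      then have "r `` {f y} \<in> A // r" using f by (auto intro: quotientI)
      then show "S \<in> (\<lambda>C. {x \<in> B. f x \<in> C}) ` (A // r)"
        using y eq by blast
    qed
  qed
  then show ?thesis by blast
qed

theorem corollary2p18: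
  fixes N :: "('n, 'e::fin_dim_inner) manifold"
    and I :: "'i set"
    and U :: "'i \<Rightarrow> 'n set"
    and X :: "('g, 'f::fin_dim_inner, 'h, 'k::fin_dim_inner) crossed_mod"
  assumes "smooth_manifold N"
    and "open_cover N I U"
    and "crossed_module X"
  shows "\<exists>F. bij_betw F (nonabelian_H1 X N I U) (adapted_exts X N I U // adapted_iso_rel X N I U)"
proof -
  interpret crossed_cover X N I U
    using assms by unfold_locales
  show ?thesis
    unfolding nonabelian_H1_def
  proof (rule quotient_bij_betw[OF equiv_cohomologous])
    show "(\<lambda>E. (ext_L E, ext_\<gamma> E)) ` adapted_exts X N I U \<subseteq> cocycles X N I U"
    proof (rule image_subsetI)
      fix E assume E: "E \<in> adapted_exts X N I U"
      interpret adapted_ext X N I U E by unfold_locales (rule E)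
      show "(ext_L E, ext_\<gamma> E) \<in> cocycles X N I U" by (rule ext_cocycle)
    qed
    \<comment> \<open>The two implications between isomorphism and cohomology identify the
      isomorphism relation with the pullback of \<open>cohomologous\<close>.\<close>
    show "adapted_iso_rel X N I U = {(E, E'). E \<in> adapted_exts X N I U \<and> E' \<in> adapted_exts X N I U \<and>
        ((ext_L E, ext_\<gamma> E), (ext_L E', ext_\<gamma> E')) \<in> cohomologous X N I U}"
      unfolding adapted_iso_rel_def
      using gh_iso_imp_cohomologous cohomologous_imp_gh_iso by blast
    fix c assume "c \<in> cocycles X N I U"
    moreover obtain L \<gamma> where c: "c = (L, \<gamma>)" by (cases c)
    ultimately interpret cech_cocycle X N I U L \<gamma> by unfold_locales simp
    show "\<exists>E\<in>adapted_exts X N I U. ((ext_L E, ext_\<gamma> E), c) \<in> cohomologous X N I U"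
      using adapted_cocycle_ext cohomologous_cocycle_ext[OF cocycle] c by blast
  qed
qed

end
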